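(* Let $J\neq F_n^\infty$ be a WOT-closed two-sided ideal of $F_n^\infty$ generated by a family $\mathcal P_J$ of homogeneous polynomials, let $\mathcal H$ be a separable Hilbert space, and let $T:=[T_1,\ldots,T_n]$, $T_i\in B(\mathcal H)$, be a row contraction such that $$p(T_1,\ldots,T_n)=0\quad\text{for any }p\in\mathcal P_J.$$ Then there exist a separable Hilbert space $\mathcal K_\pi$ and a $*$-representation $\pi:C^*(B_1,\ldots,B_n)\to B(\mathcal K_\pi)$ which annihilates the compact operators and satisfies $$\pi(B_1)\pi(B_1)^*+\cdots+\pi(B_n)\pi(B_n)^*=I_{\mathcal K_\pi},$$ such that (i) $\mathcal H$ can be identified (via an isometry) with a $*$-cyclic co-invariant subspace of $\tilde{\mathcal K}:=(\mathcal N_J\otimes\overline{\Delta_T\mathcal H})\oplus\mathcal K_\pi$ under the operators $$V_i:=\begin{bmatrix}B_i\otimes I_{\overline{\Delta_T\mathcal H}}&0\\0&\pi(B_i)\end{bmatrix},\quad i=1,\ldots,n;$$ (ii) under this identification, $T_i^*=V_i^*|_{\mathcal H}$, $i=1,\ldots,n$.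
   Context: Let $n\in\{1,2,\dots\}$ and let $F^2(H_n)=\bigoplus_{k\ge 0}H_n^{\otimes k}$ be the full Fock space of an $n$-dimensional complex Hilbert space $H_n$ with orthonormal basis $e_1,\dots,e_n$ (with $H_n^{\otimes 0}=\mathbb C1$). The left creation operators are $S_i\varphi=e_i\otimes\varphi$. $F_n^\infty\subset B(F^2(H_n))$ is the WOT-closed algebra generated by $S_1,\dots,S_n$ and the identity. Polynomials in $F_n^\infty$ are the operators $p(S_1,\dots,S_n)$, $p$ a polynomial in $n$ noncommuting indeterminates; $p(T_1,\dots,T_n)$ is the corresponding evaluation. "Generated by $\mathcal P_J$" means $J$ is the smallest WOT-closed two-sided ideal containing $\mathcal P_J$. Put $\mathcal N_J=F^2(H_n)\ominus\overline{JF^2(H_n)}$ and $B_i=P_{\mathcal N_J}S_i|_{\mathcal N_J}$. $C^*(B_1,\dots,B_n)$ is the $C^*$-algebra generated by $B_1,\dots,B_n$ and the identity on $\mathcal N_J$ (in this setting it contains all compact operators on $\mathcal N_J$). $T$ is a row contraction if $\sum_iT_iT_i^*\le I$; $\Delta_T=(I-\sum_iT_iT_i^* )^{1/2}$. A subspace is co-invariant under a set of operators if it is invariant under their adjoints; it is $*$-cyclic if the whole space is the smallest closed subspace containing it that is reducing for these operators. The space $\mathcal K_\pi$ may be $\{0\}$. *)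

theory Defs
  imports "HOL-Analysis.Analysis" "HOL-Library.Poly_Mapping"
begin

section \<open>Complex Hilbert spaces\<close>

text \<open>
  The inner product is linear in the first and conjugate-linear in the second argument. Norm,
  metric and topology are inherited from the underlying real Hilbert space.
\<close>

class complex_hilbert = real_inner + complete_space +
  fixes scaleC :: "complex \<Rightarrow> 'a \<Rightarrow> 'a"  (infixr \<open>*\<^sub>C\<close> 75)
    and cinner :: "'a \<Rightarrow> 'a \<Rightarrow> complex"
  assumes scaleC_add_right: "c *\<^sub>C (x + y) = c *\<^sub>C x + c *\<^sub>C y"
    and scaleC_add_left: "(c + d) *\<^sub>C x = c *\<^sub>C x + d *\<^sub>C x"
    and scaleC_scaleC: "c *\<^sub>C (d *\<^sub>C x) = (c * d) *\<^sub>C x"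
    and scaleR_scaleC: "scaleR r x = complex_of_real r *\<^sub>C x"
    and cinner_add_left: "cinner (x + y) z = cinner x z + cinner y z"
    and cinner_scaleC_left: "cinner (c *\<^sub>C x) y = c * cinner x y"
    and cinner_commute: "cinner y x = cnj (cinner x y)"
    and inner_eq_Re_cinner: "inner x y = Re (cinner x y)"

subclass (in complex_hilbert) banach ..

lemma scaleC_one [simp]: "1 *\<^sub>C x = (x :: 'a::complex_hilbert)"
  using scaleR_scaleC[of 1 x] by simp

lemma cinner_self: "cinner x x = complex_of_real ((norm x)\<^sup>2)" for x :: "'a::complex_hilbert"
proof (rule complex_eqI)
  show "Re (cinner x x) = Re (complex_of_real ((norm x)\<^sup>2))"
    by (simp add: inner_eq_Re_cinner[symmetric] power2_norm_eq_inner)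
  show "Im (cinner x x) = Im (complex_of_real ((norm x)\<^sup>2))"
    using arg_cong[OF cinner_commute[of x x], of Im] by simp
qed

lemma cinner_scaleC_right: "cinner x (c *\<^sub>C y) = cnj c * cinner x y" for x y :: "'a::complex_hilbert"
  by (metis cinner_commute cinner_scaleC_left complex_cnj_cnj complex_cnj_mult)

lemma cinner_add_right: "cinner x (y + z) = cinner x y + cinner x z"
  for x y z :: "'a::complex_hilbert"
  by (metis cinner_commute cinner_add_left complex_cnj_add)

lemma norm_scaleC: "norm (c *\<^sub>C x) = cmod c * norm x" for x :: "'a::complex_hilbert"
proof -
  have "complex_of_real ((norm (c *\<^sub>C x))\<^sup>2) = complex_of_real ((cmod c * norm x)\<^sup>2)"
    by (simp only: cinner_self[symmetric] cinner_scaleC_left cinner_scaleC_right)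
       (simp add: cinner_self complex_norm_square power_mult_distrib del: of_real_power)
  then have "(norm (c *\<^sub>C x))\<^sup>2 = (cmod c * norm x)\<^sup>2"
    using of_real_eq_iff by blast
  then show ?thesis by (simp add: power2_eq_iff_nonneg)
qed

lemma cmod_cinner_le: "cmod (cinner x y) \<le> norm x * norm y" for x y :: "'a::complex_hilbert"
proof -
  obtain u where u: "cmod u = 1" "u * cinner x y = complex_of_real (cmod (cinner x y))"
  proof (cases "cinner x y = 0")
    case True then show ?thesis using that[of 1] by simp
  next
    case False
    show ?thesis
    proof (rule that)
      show "cmod (cnj (cinner x y) / cmod (cinner x y)) = 1"
        using False by (simp add: norm_divide)
      show "cnj (cinner x y) / cmod (cinner x y) * cinner x y = complex_of_real (cmod (cinner x y))"
        using False by (simp add: mult.commute complex_norm_square[symmetric] power2_eq_square)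
    qed
  qed
  have "cmod (cinner x y) = inner (u *\<^sub>C x) y"
    by (simp add: inner_eq_Re_cinner cinner_scaleC_left u(2))
  also have "\<dots> \<le> norm (u *\<^sub>C x) * norm y" by (rule norm_cauchy_schwarz)
  finally show ?thesis by (simp add: norm_scaleC u(1))
qed

instantiation complex :: complex_hilbert
begin

definition scaleC_complex :: "complex \<Rightarrow> complex \<Rightarrow> complex"
  where "scaleC_complex c z = c * z"

definition cinner_complex :: "complex \<Rightarrow> complex \<Rightarrow> complex"
  where "cinner_complex z w = z * cnj w"

instance
  by standard
    (simp_all add: scaleC_complex_def cinner_complex_def algebra_simps scaleR_conv_of_real
      inner_complex_def)

end

text \<open>
  With the library's norm on products, \<open>'a \<times> 'b\<close> is the Hilbert space direct sum.
\<close>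

instantiation prod :: (complex_hilbert, complex_hilbert) complex_hilbert
begin

definition scaleC_prod :: "complex \<Rightarrow> 'a \<times> 'b \<Rightarrow> 'a \<times> 'b"
  where "scaleC_prod c x = (c *\<^sub>C fst x, c *\<^sub>C snd x)"

definition cinner_prod :: "'a \<times> 'b \<Rightarrow> 'a \<times> 'b \<Rightarrow> complex"
  where "cinner_prod x y = cinner (fst x) (fst y) + cinner (snd x) (snd y)"

instance
proof
  fix x y :: "'a \<times> 'b"
  show "cinner y x = cnj (cinner x y)"
    by (simp add: cinner_prod_def cinner_commute[of "fst x"] cinner_commute[of "snd x"])
qed (simp_all add: scaleC_prod_def cinner_prod_def inner_prod_def scaleC_add_right scaleC_add_left
      scaleC_scaleC scaleR_scaleC cinner_add_left cinner_scaleC_left inner_eq_Re_cinner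
      prod_eq_iff algebra_simps)

end


section \<open>Square-summable families\<close>

text \<open>
  Every separable Hilbert space, \<open>{0}\<close> included, is isometrically isomorphic to a closed subspace
  of \<open>(nat, complex) l2\<close>, and all these subspaces are separable. Existence of a separable Hilbert
  space is therefore expressed as existence of such a subspace.
\<close>

typedef (overloaded) ('i, 'h::complex_hilbert) l2 =
  "{f :: 'i \<Rightarrow> 'h. (\<lambda>i. (norm (f i))\<^sup>2) summable_on UNIV}"
  by (rule exI[of _ "\<lambda>_. 0"]) simp

setup_lifting type_definition_l2

lemma l2_summable_scaleC:
  fixes f :: "'i \<Rightarrow> 'h::complex_hilbert"
  assumes "(\<lambda>i. (norm (f i))\<^sup>2) summable_on UNIV"
  shows "(\<lambda>i. (norm (c *\<^sub>C f i))\<^sup>2) summable_on UNIV"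
  using summable_on_cmult_right[OF assms, of "(cmod c)\<^sup>2"]
  by (simp add: norm_scaleC power_mult_distrib)

lemma l2_summable_add:
  fixes f g :: "'i \<Rightarrow> 'h::complex_hilbert"
  assumes "(\<lambda>i. (norm (f i))\<^sup>2) summable_on UNIV" "(\<lambda>i. (norm (g i))\<^sup>2) summable_on UNIV"
  shows "(\<lambda>i. (norm (f i + g i))\<^sup>2) summable_on UNIV"
proof (rule summable_on_comparison_test)
  show "(\<lambda>i. 2 * (norm (f i))\<^sup>2 + 2 * (norm (g i))\<^sup>2) summable_on UNIV"
    by (intro summable_on_add summable_on_cmult_right assms)
  fix i
  have "(norm (f i + g i))\<^sup>2 \<le> (norm (f i) + norm (g i))\<^sup>2"
    by (intro power_mono norm_triangle_ineq) simp
  also have "\<dots> \<le> 2 * (norm (f i))\<^sup>2 + 2 * (norm (g i))\<^sup>2"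
    using sum_squares_bound[of "norm (f i)" "norm (g i)"] by (simp add: power2_sum)
  finally show "(norm (f i + g i))\<^sup>2 \<le> 2 * (norm (f i))\<^sup>2 + 2 * (norm (g i))\<^sup>2" .
qed simp

lemma l2_summable_minus:
  fixes f g :: "'i \<Rightarrow> 'h::complex_hilbert"
  assumes "(\<lambda>i. (norm (f i))\<^sup>2) summable_on UNIV" "(\<lambda>i. (norm (g i))\<^sup>2) summable_on UNIV"
  shows "(\<lambda>i. (norm (f i - g i))\<^sup>2) summable_on UNIV"
  using l2_summable_add[of f "\<lambda>i. - g i"] assms by simp

lemma l2_summable_cinner:
  fixes f g :: "'i \<Rightarrow> 'h::complex_hilbert"
  assumes "(\<lambda>i. (norm (f i))\<^sup>2) summable_on UNIV" "(\<lambda>i. (norm (g i))\<^sup>2) summable_on UNIV"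
  shows "(\<lambda>i. cinner (f i) (g i)) summable_on UNIV"
proof -
  have sq: "(\<lambda>i. norm ((norm (f i))\<^sup>2 + (norm (g i))\<^sup>2)) summable_on UNIV"
    using summable_on_add[OF assms] by simp
  have "cmod (cinner (f i) (g i)) \<le> norm ((norm (f i))\<^sup>2 + (norm (g i))\<^sup>2)" for i
  proof -
    have "cmod (cinner (f i) (g i)) \<le> norm (f i) * norm (g i)" by (rule cmod_cinner_le)
    also have "\<dots> \<le> (norm (f i))\<^sup>2 + (norm (g i))\<^sup>2"
    proof -
      have "0 \<le> norm (f i) * norm (g i)" by simp
      then show ?thesis using sum_squares_bound[of "norm (f i)" "norm (g i)"] by linarith
    qed
    finally show ?thesis by simp
  qed
  then have "(\<lambda>i. norm (cinner (f i) (g i))) summable_on UNIV"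
    by (intro Infinite_Sum.abs_summable_on_comparison_test[OF sq])
  then show ?thesis by (rule abs_summable_summable)
qed

instantiation l2 :: (type, complex_hilbert) real_inner
begin

lift_definition zero_l2 :: "('a, 'b) l2" is "\<lambda>_. 0" by simp

lift_definition plus_l2 :: "('a, 'b) l2 \<Rightarrow> ('a, 'b) l2 \<Rightarrow> ('a, 'b) l2"
  is "\<lambda>f g i. f i + g i" by (rule l2_summable_add)

lift_definition minus_l2 :: "('a, 'b) l2 \<Rightarrow> ('a, 'b) l2 \<Rightarrow> ('a, 'b) l2"
  is "\<lambda>f g i. f i - g i" by (rule l2_summable_minus)

lift_definition uminus_l2 :: "('a, 'b) l2 \<Rightarrow> ('a, 'b) l2"
  is "\<lambda>f i. - f i" by simp

lift_definition scaleR_l2 :: "real \<Rightarrow> ('a, 'b) l2 \<Rightarrow> ('a, 'b) l2"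
  is "\<lambda>r f i. r *\<^sub>R f i" by (simp add: scaleR_scaleC l2_summable_scaleC)

definition inner_l2 :: "('a, 'b) l2 \<Rightarrow> ('a, 'b) l2 \<Rightarrow> real"
  where "inner_l2 f g = (\<Sum>\<^sub>\<infinity>i. inner (Rep_l2 f i) (Rep_l2 g i))"

definition norm_l2 :: "('a, 'b) l2 \<Rightarrow> real"
  where "norm_l2 f = sqrt (inner f f)"

definition sgn_l2 :: "('a, 'b) l2 \<Rightarrow> ('a, 'b) l2"
  where "sgn_l2 f = inverse (norm f) *\<^sub>R f"

definition dist_l2 :: "('a, 'b) l2 \<Rightarrow> ('a, 'b) l2 \<Rightarrow> real"
  where "dist_l2 f g = norm (f - g)"

definition uniformity_l2 :: "(('a, 'b) l2 \<times> ('a, 'b) l2) filter"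
  where "uniformity_l2 = (INF e\<in>{0 <..}. principal {(x, y). dist x y < e})"

definition open_l2 :: "('a, 'b) l2 set \<Rightarrow> bool"
  where "open_l2 U = (\<forall>x\<in>U. eventually (\<lambda>(x', y). x' = x \<longrightarrow> y \<in> U) uniformity)"

lemma inner_l2_summable:
  "(\<lambda>i. inner (Rep_l2 f i) (Rep_l2 g i)) summable_on UNIV" for f g :: "('a, 'b) l2"
proof -
  have "(\<lambda>i. cinner (Rep_l2 f i) (Rep_l2 g i)) summable_on UNIV"
    using Rep_l2[of f] Rep_l2[of g] by (intro l2_summable_cinner) simp_all
  then have "(\<lambda>i. Re (cinner (Rep_l2 f i) (Rep_l2 g i))) summable_on UNIV"
    by (rule summable_on_bounded_linear[OF bounded_linear_Re])
  then show ?thesis by (simp add: inner_eq_Re_cinner)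
qed

instance
proof
  fix x y z :: "('a, 'b) l2" and r :: real and a b :: real
  show "x + y + z = x + (y + z)" by transfer (simp add: add.assoc)
  show "x + y = y + x" by transfer (simp add: add.commute)
  show "0 + x = x" by transfer simp
  show "- x + x = 0" by transfer simp
  show "x - y = x + - y" by transfer simp
  show "a *\<^sub>R (x + y) = a *\<^sub>R x + a *\<^sub>R y" by transfer (simp add: scaleR_add_right)
  show "(a + b) *\<^sub>R x = a *\<^sub>R x + b *\<^sub>R x" by transfer (simp add: scaleR_add_left)
  show "a *\<^sub>R b *\<^sub>R x = (a * b) *\<^sub>R x" by transfer simp
  show "1 *\<^sub>R x = x" by transfer simp
  show "dist x y = norm (x - y)" by (rule dist_l2_def)
  show "sgn x = inverse (norm x) *\<^sub>R x" by (rule sgn_l2_def)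
  show "(uniformity :: (('a, 'b) l2 \<times> ('a, 'b) l2) filter)
      = (INF e\<in>{0 <..}. principal {(x, y). dist x y < e})"
    by (rule uniformity_l2_def)
  show "open U \<longleftrightarrow> (\<forall>x\<in>U. eventually (\<lambda>(x', y). x' = x \<longrightarrow> y \<in> U) uniformity)"
    for U :: "('a, 'b) l2 set"
    by (rule open_l2_def)
  show "inner x y = inner y x" by (simp add: inner_l2_def inner_commute)
  show "inner (x + y) z = inner x z + inner y z"
    by (simp add: inner_l2_def plus_l2.rep_eq inner_add_left infsum_add inner_l2_summable)
  show "inner (r *\<^sub>R x) y = r * inner x y"
    by (simp add: inner_l2_def scaleR_l2.rep_eq infsum_cmult_right')
  show "0 \<le> inner x x" by (simp add: inner_l2_def infsum_nonneg)
  show "norm x = sqrt (inner x x)" by (rule norm_l2_def)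
  show "inner x x = 0 \<longleftrightarrow> x = 0"
  proof
    assume "inner x x = 0"
    then have "inner (Rep_l2 x i) (Rep_l2 x i) = 0" for i
      using nonneg_infsum_le_0D[of "\<lambda>i. inner (Rep_l2 x i) (Rep_l2 x i)" UNIV i]
      by (simp add: inner_l2_def inner_l2_summable)
    then have "Rep_l2 x = Rep_l2 0" by (auto simp: zero_l2.rep_eq fun_eq_iff)
    then show "x = 0" by (simp add: Rep_l2_inject)
  qed (simp add: inner_l2_def zero_l2.rep_eq)
qed

end

lemma norm_l2_sum_le:
  fixes f :: "('i, 'h::complex_hilbert) l2"
  assumes "finite F"
  shows "(\<Sum>i\<in>F. (norm (Rep_l2 f i))\<^sup>2) \<le> (norm f)\<^sup>2"
  using finite_sum_le_infsum[OF inner_l2_summable[of f f] assms]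
  by (simp add: power2_norm_eq_inner inner_l2_def)

lemma norm_l2_component_le: "norm (Rep_l2 f i) \<le> norm f" for f :: "('i, 'h::complex_hilbert) l2"
  using norm_l2_sum_le[of "{i}" f] by (simp add: power2_le_iff_abs_le)

instance l2 :: (type, complex_hilbert) complete_space
proof
  fix X :: "nat \<Rightarrow> ('a, 'b) l2"
  assume X: "Cauchy X"
  have "Cauchy (\<lambda>n. Rep_l2 (X n) i)" for i
  proof (rule metric_CauchyI)
    fix e :: real assume "0 < e"
    then obtain N where N: "\<forall>m\<ge>N. \<forall>n\<ge>N. dist (X m) (X n) < e"
      using X metric_CauchyD by blast
    have "dist (Rep_l2 (X m) i) (Rep_l2 (X n) i) \<le> dist (X m) (X n)" for m n
      using norm_l2_component_le[of "X m - X n" i] by (simp add: dist_norm minus_l2.rep_eq)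
    then show "\<exists>N. \<forall>m\<ge>N. \<forall>n\<ge>N. dist (Rep_l2 (X m) i) (Rep_l2 (X n) i) < e"
      using N by (meson le_less_trans)
  qed
  then have "\<exists>l. (\<lambda>n. Rep_l2 (X n) i) \<longlonglongrightarrow> l" for i
    using Cauchy_convergent convergent_def by blast
  then obtain L where L: "\<And>i. (\<lambda>n. Rep_l2 (X n) i) \<longlonglongrightarrow> L i" by metis
  have tail: "\<exists>N. \<forall>m\<ge>N. \<forall>F. finite F \<longrightarrow> (\<Sum>i\<in>F. (norm (Rep_l2 (X m) i - L i))\<^sup>2) \<le> e\<^sup>2"
    if e: "0 < e" for e :: real
  proof -
    obtain N where N: "\<forall>m\<ge>N. \<forall>n\<ge>N. dist (X m) (X n) < e"
      using metric_CauchyD[OF X e] by blast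
    have "(\<Sum>i\<in>F. (norm (Rep_l2 (X m) i - L i))\<^sup>2) \<le> e\<^sup>2" if m: "m \<ge> N" and F: "finite F" for m F
    proof (rule LIMSEQ_le_const2)
      show "(\<lambda>n. \<Sum>i\<in>F. (norm (Rep_l2 (X m) i - Rep_l2 (X n) i))\<^sup>2)
          \<longlonglongrightarrow> (\<Sum>i\<in>F. (norm (Rep_l2 (X m) i - L i))\<^sup>2)"
        by (intro tendsto_intros L)
      have "(\<Sum>i\<in>F. (norm (Rep_l2 (X m) i - Rep_l2 (X n) i))\<^sup>2) \<le> e\<^sup>2" if "n \<ge> N" for n
      proof -
        have "(\<Sum>i\<in>F. (norm (Rep_l2 (X m) i - Rep_l2 (X n) i))\<^sup>2) \<le> (norm (X m - X n))\<^sup>2"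
          using norm_l2_sum_le[OF F, of "X m - X n"] by (simp add: minus_l2.rep_eq)
        also have "\<dots> \<le> e\<^sup>2"
          using N m that by (intro power_mono) (auto simp: dist_norm less_imp_le)
        finally show ?thesis .
      qed
      then show "\<exists>M. \<forall>n\<ge>M. (\<Sum>i\<in>F. (norm (Rep_l2 (X m) i - Rep_l2 (X n) i))\<^sup>2) \<le> e\<^sup>2" by blast
    qed
    then show ?thesis by blast
  qed
  have sum_diff: "(\<lambda>i. (norm (Rep_l2 (X m) i - L i))\<^sup>2) summable_on UNIV"
    if "\<forall>F. finite F \<longrightarrow> (\<Sum>i\<in>F. (norm (Rep_l2 (X m) i - L i))\<^sup>2) \<le> e\<^sup>2" for m e
    using that by (intro nonneg_bdd_above_summable_on) (auto simp: bdd_above_def)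
  obtain M where M: "\<forall>F. finite F \<longrightarrow> (\<Sum>i\<in>F. (norm (Rep_l2 (X M) i - L i))\<^sup>2) \<le> 1\<^sup>2"
    using tail[of 1] by auto
  have "(\<lambda>i. (norm (Rep_l2 (X M) i - (Rep_l2 (X M) i - L i)))\<^sup>2) summable_on UNIV"
    by (rule l2_summable_minus) (use Rep_l2[of "X M"] sum_diff[OF M] in auto)
  then have Lmem: "L \<in> {f. (\<lambda>i. (norm (f i))\<^sup>2) summable_on UNIV}" by simp
  have "X \<longlonglongrightarrow> Abs_l2 L"
  proof (rule metric_LIMSEQ_I)
    fix e :: real assume e: "0 < e"
    then obtain N where N: "\<forall>m\<ge>N. \<forall>F. finite F \<longrightarrow>
        (\<Sum>i\<in>F. (norm (Rep_l2 (X m) i - L i))\<^sup>2) \<le> (e/2)\<^sup>2"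
      using tail[of "e/2"] by auto
    have "dist (X m) (Abs_l2 L) < e" if "m \<ge> N" for m
    proof -
      have rep: "Rep_l2 (X m - Abs_l2 L) i = Rep_l2 (X m) i - L i" for i
        using Lmem by (simp add: minus_l2.rep_eq Abs_l2_inverse)
      have "(norm (X m - Abs_l2 L))\<^sup>2 = (\<Sum>\<^sub>\<infinity>i. (norm (Rep_l2 (X m) i - L i))\<^sup>2)"
        by (simp add: power2_norm_eq_inner inner_l2_def rep)
      also have "\<dots> \<le> (e/2)\<^sup>2"
        using N that sum_diff[of m "e/2"] by (intro infsum_le_finite_sums) auto
      finally have "norm (X m - Abs_l2 L) \<le> e/2"
        using e by (simp add: power2_le_iff_abs_le)
      then show ?thesis using e by (simp add: dist_norm)
    qed
    then show "\<exists>N. \<forall>m\<ge>N. dist (X m) (Abs_l2 L) < e" by blast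
  qed
  then show "convergent X" by (auto simp: convergent_def)
qed

instantiation l2 :: (type, complex_hilbert) complex_hilbert
begin

lift_definition scaleC_l2 :: "complex \<Rightarrow> ('a, 'b) l2 \<Rightarrow> ('a, 'b) l2"
  is "\<lambda>c f i. c *\<^sub>C f i" by (rule l2_summable_scaleC)

definition cinner_l2 :: "('a, 'b) l2 \<Rightarrow> ('a, 'b) l2 \<Rightarrow> complex"
  where "cinner_l2 f g = (\<Sum>\<^sub>\<infinity>i. cinner (Rep_l2 f i) (Rep_l2 g i))"

lemma cinner_l2_summable:
  "(\<lambda>i. cinner (Rep_l2 f i) (Rep_l2 g i)) summable_on UNIV" for f g :: "('a, 'b) l2"
  using Rep_l2[of f] Rep_l2[of g] by (intro l2_summable_cinner) simp_all

instance
proof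
  fix x y z :: "('a, 'b) l2" and c d :: complex and r :: real
  show "c *\<^sub>C (x + y) = c *\<^sub>C x + c *\<^sub>C y" by transfer (simp add: scaleC_add_right)
  show "(c + d) *\<^sub>C x = c *\<^sub>C x + d *\<^sub>C x" by transfer (simp add: scaleC_add_left)
  show "c *\<^sub>C d *\<^sub>C x = (c * d) *\<^sub>C x" by transfer (simp add: scaleC_scaleC)
  show "r *\<^sub>R x = complex_of_real r *\<^sub>C x" by transfer (simp add: scaleR_scaleC)
  show "cinner (x + y) z = cinner x z + cinner y z"
    by (simp add: cinner_l2_def plus_l2.rep_eq cinner_add_left infsum_add cinner_l2_summable)
  show "cinner (c *\<^sub>C x) y = c * cinner x y"
    by (simp add: cinner_l2_def scaleC_l2.rep_eq cinner_scaleC_left infsum_cmult_right')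
  show "cinner y x = cnj (cinner x y)"
    by (simp add: cinner_l2_def infsum_cnj[symmetric] cinner_commute[symmetric])
  have "Re (\<Sum>\<^sub>\<infinity>i. cinner (Rep_l2 x i) (Rep_l2 y i)) = (\<Sum>\<^sub>\<infinity>i. Re (cinner (Rep_l2 x i) (Rep_l2 y i)))"
    by (rule infsum_Re[symmetric]) (rule cinner_l2_summable)
  then show "inner x y = Re (cinner x y)"
    by (simp add: inner_l2_def cinner_l2_def inner_eq_Re_cinner)
qed

end


section \<open>Subspaces and operators\<close>

definition csubspace :: "'a::complex_hilbert set \<Rightarrow> bool"
  where "csubspace M \<longleftrightarrow>
    0 \<in> M \<and> (\<forall>x\<in>M. \<forall>y\<in>M. x + y \<in> M) \<and> (\<forall>c. \<forall>x\<in>M. c *\<^sub>C x \<in> M)"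

definition closed_csubspace :: "'a::complex_hilbert set \<Rightarrow> bool"
  where "closed_csubspace M \<longleftrightarrow> csubspace M \<and> closed M"

definition closed_cspan :: "'a::complex_hilbert set \<Rightarrow> 'a set"
  where "closed_cspan S = closure (csubspace hull S)"

definition orth_compl :: "'a::complex_hilbert set \<Rightarrow> 'a set"
  where "orth_compl M = {x. \<forall>y\<in>M. cinner x y = 0}"

definition proj :: "'a::complex_hilbert set \<Rightarrow> 'a \<Rightarrow> 'a"
  where "proj M x = (THE y. y \<in> M \<and> x - y \<in> orth_compl M)"

definition bounded_clinear :: "('a::complex_hilbert \<Rightarrow> 'b::complex_hilbert) \<Rightarrow> bool"
  where "bounded_clinear X \<longleftrightarrow> bounded_linear X \<and> (\<forall>c x. X (c *\<^sub>C x) = c *\<^sub>C X x)"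

definition cadjoint :: "('a::complex_hilbert \<Rightarrow> 'b::complex_hilbert) \<Rightarrow> 'b \<Rightarrow> 'a"
  where "cadjoint X = (THE Y. \<forall>x y. cinner (X x) y = cinner x (Y y))"

text \<open>
  \<open>B(M)\<close> for a closed subspace \<open>M\<close>. An operator on \<open>M\<close> is extended by \<open>0\<close> to the orthogonal
  complement of \<open>M\<close>, so that sums, scalar multiples, products, adjoints (by \<open>cadjoint\<close>) and
  norms (by \<open>onorm\<close>) are computed in the ambient space and \<open>proj M\<close> is the identity of
  \<open>B(M)\<close>. In particular \<open>bops UNIV\<close> consists of all bounded operators.
\<close>

definition bops :: "'a::complex_hilbert set \<Rightarrow> ('a \<Rightarrow> 'a) set"
  where "bops M = {X. bounded_clinear X \<and> range X \<subseteq> M \<and> (\<forall>x\<in>orth_compl M. X x = 0)}"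

definition compact_op :: "('a::complex_hilbert \<Rightarrow> 'b::complex_hilbert) \<Rightarrow> bool"
  where "compact_op X \<longleftrightarrow> bounded_clinear X \<and> compact (closure (X ` cball 0 1))"

definition pos_op :: "('a::complex_hilbert \<Rightarrow> 'a) \<Rightarrow> bool"
  where "pos_op X \<longleftrightarrow> bounded_clinear X \<and> (\<forall>x. cinner (X x) x \<in> \<real>\<^sub>\<ge>\<^sub>0)"

definition sqrt_op :: "('a::complex_hilbert \<Rightarrow> 'a) \<Rightarrow> 'a \<Rightarrow> 'a"
  where "sqrt_op X = (THE Y. pos_op Y \<and> Y \<circ> Y = X)"

definition subalgebra :: "('a::complex_hilbert \<Rightarrow> 'a) set \<Rightarrow> bool"
  where "subalgebra A \<longleftrightarrow>
    (\<forall>X\<in>A. \<forall>Y\<in>A. (\<lambda>x. X x + Y x) \<in> A) \<and>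
    (\<forall>c. \<forall>X\<in>A. (\<lambda>x. c *\<^sub>C X x) \<in> A) \<and>
    (\<forall>X\<in>A. \<forall>Y\<in>A. X \<circ> Y \<in> A)"

text \<open>
  The coarsest topology on the bounded operators for which all coefficients \<open>X \<mapsto> \<langle>X x, y\<rangle>\<close> are
  continuous; \<open>euclidean\<close> is here the product topology on functions.
\<close>

definition wot :: "('a::complex_hilbert \<Rightarrow> 'a) topology"
  where "wot = pullback_topology (bops UNIV) (\<lambda>X (x, y). cinner (X x) y) euclidean"


section \<open>C*-algebras of operators and their representations\<close>

definition cstar_subalgebra :: "'a::complex_hilbert set \<Rightarrow> ('a \<Rightarrow> 'a) set \<Rightarrow> bool"
  where "cstar_subalgebra M A \<longleftrightarrow>
    A \<subseteq> bops M \<and> subalgebra A \<and> proj M \<in> A \<and> (\<forall>X\<in>A. cadjoint X \<in> A) \<and>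
    (\<forall>X\<in>bops M. (\<forall>e>0. \<exists>Y\<in>A. onorm (\<lambda>x. X x - Y x) < e) \<longrightarrow> X \<in> A)"

definition cstar_generated :: "'a::complex_hilbert set \<Rightarrow> ('a \<Rightarrow> 'a) set \<Rightarrow> ('a \<Rightarrow> 'a) set"
  where "cstar_generated M G = \<Inter>{A. cstar_subalgebra M A \<and> G \<subseteq> A}"

text \<open>
  A representation is not required to be unital. It is so, \<open>\<pi> I = I\<close>, as soon as
  \<open>\<Sum>\<^sub>i \<pi> B\<^sub>i (\<pi> B\<^sub>i)\<^sup>* = I\<close> holds for some elements \<open>B\<^sub>i\<close> of the algebra.
\<close>

definition star_representation ::
    "('a::complex_hilbert \<Rightarrow> 'a) set \<Rightarrow> 'b::complex_hilbert set
      \<Rightarrow> (('a \<Rightarrow> 'a) \<Rightarrow> 'b \<Rightarrow> 'b) \<Rightarrow> bool"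
  where "star_representation A K \<pi> \<longleftrightarrow>
    (\<forall>X\<in>A. \<pi> X \<in> bops K) \<and>
    (\<forall>X\<in>A. \<forall>Y\<in>A. \<pi> (\<lambda>x. X x + Y x) = (\<lambda>k. \<pi> X k + \<pi> Y k)) \<and>
    (\<forall>c. \<forall>X\<in>A. \<pi> (\<lambda>x. c *\<^sub>C X x) = (\<lambda>k. c *\<^sub>C \<pi> X k)) \<and>
    (\<forall>X\<in>A. \<forall>Y\<in>A. \<pi> (X \<circ> Y) = \<pi> X \<circ> \<pi> Y) \<and>
    (\<forall>X\<in>A. \<pi> (cadjoint X) = cadjoint (\<pi> X))"


section \<open>Tensor products\<close>

text \<open>
  The Hilbert space tensor product of \<open>\<ell>\<^sup>2(I)\<close> and \<open>H\<close> is realised as \<open>\<ell>\<^sup>2(I; H)\<close>.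
\<close>

lift_definition tensor :: "('i, complex) l2 \<Rightarrow> 'h::complex_hilbert \<Rightarrow> ('i, 'h) l2"
    (infixl \<open>\<otimes>\<^sub>v\<close> 70)
  is "\<lambda>f h i. f i *\<^sub>C h"
proof -
  fix f :: "'i \<Rightarrow> complex" and h :: 'h
  assume "(\<lambda>i. (norm (f i))\<^sup>2) summable_on UNIV"
  then have "(\<lambda>i. (norm (f i))\<^sup>2 * (norm h)\<^sup>2) summable_on UNIV"
    by (rule summable_on_cmult_left)
  then show "(\<lambda>i. (norm (f i *\<^sub>C h))\<^sup>2) summable_on UNIV"
    by (simp add: norm_scaleC power_mult_distrib)
qed

lemma cinner_tensor: "cinner (f \<otimes>\<^sub>v h) (g \<otimes>\<^sub>v k) = cinner f g * cinner h k"
proof -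
  have "cinner (f \<otimes>\<^sub>v h) (g \<otimes>\<^sub>v k)
      = (\<Sum>\<^sub>\<infinity>i. cinner (Rep_l2 f i) (Rep_l2 g i) * cinner h k)"
    by (simp add: cinner_l2_def tensor.rep_eq cinner_scaleC_left cinner_scaleC_right
        cinner_complex_def mult_ac)
  then show ?thesis by (simp add: infsum_cmult_left' cinner_l2_def)
qed

definition tensor_space :: "('i, complex) l2 set \<Rightarrow> 'h::complex_hilbert set \<Rightarrow> ('i, 'h) l2 set"
  where "tensor_space M D = closed_cspan {f \<otimes>\<^sub>v h |f h. f \<in> M \<and> h \<in> D}"

text \<open>
  \<open>X \<otimes> Y\<close> for \<open>X \<in> B(M)\<close> and \<open>Y \<in> B(D)\<close>, extended by \<open>0\<close> like all operators on subspaces.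
\<close>

definition tensor_op ::
    "('i, complex) l2 set \<Rightarrow> 'h::complex_hilbert set
      \<Rightarrow> (('i, complex) l2 \<Rightarrow> ('i, complex) l2) \<Rightarrow> ('h \<Rightarrow> 'h) \<Rightarrow> ('i, 'h) l2 \<Rightarrow> ('i, 'h) l2"
  where "tensor_op M D X Y = (THE Z. Z \<in> bops (tensor_space M D) \<and>
    (\<forall>f\<in>M. \<forall>h\<in>D. Z (f \<otimes>\<^sub>v h) = X f \<otimes>\<^sub>v Y h))"


section \<open>Full Fock space and noncommutative analytic Toeplitz algebra\<close>

text \<open>
  The number \<open>n\<close> of generators is the cardinality of the finite index type \<open>'n\<close>. The tensors
  \<open>e\<^bsub>i\<^sub>1\<^esub> \<otimes> \<dots> \<otimes> e\<^bsub>i\<^sub>k\<^esub>\<close> over the words of length \<open>k\<close> form an orthonormal basis of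
  \<open>H\<^sub>n\<^sup>\<otimes>\<^sup>k\<close>; the full Fock space is therefore the space of square-summable families of coefficients
  indexed by all words, the empty word corresponding to the vacuum vector.
\<close>

type_synonym 'n fock = "('n list, complex) l2"

definition creation_coeff :: "'n \<Rightarrow> ('n list \<Rightarrow> complex) \<Rightarrow> 'n list \<Rightarrow> complex"
  where "creation_coeff i f w = (case w of [] \<Rightarrow> 0 | j # v \<Rightarrow> if j = i then f v else 0)"

lift_definition creation :: "'n \<Rightarrow> 'n fock \<Rightarrow> 'n fock"
  is "creation_coeff"
proof -
  fix i :: 'n and f :: "'n list \<Rightarrow> complex"
  assume "(\<lambda>w. (norm (f w))\<^sup>2) summable_on UNIV"
  then have "((\<lambda>w. (norm (creation_coeff i f w))\<^sup>2) \<circ> (#) i) summable_on UNIV"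
    by (simp add: o_def creation_coeff_def)
  then have "(\<lambda>w. (norm (creation_coeff i f w))\<^sup>2) summable_on range ((#) i)"
    by (subst summable_on_reindex) (auto simp: inj_on_def)
  moreover have "(\<lambda>w. (norm (creation_coeff i f w))\<^sup>2) summable_on range ((#) i) \<longleftrightarrow>
      (\<lambda>w. (norm (creation_coeff i f w))\<^sup>2) summable_on UNIV"
    by (rule summable_on_cong_neutral)
       (auto simp: creation_coeff_def image_iff split: list.splits)
  ultimately show "(\<lambda>w. (norm (creation_coeff i f w))\<^sup>2) summable_on UNIV" by simp
qed

definition analytic_toeplitz :: "('n fock \<Rightarrow> 'n fock) set"
  where "analytic_toeplitz = \<Inter>{A. A \<subseteq> bops UNIV \<and> closedin wot A \<and> subalgebra A \<and>
    id \<in> A \<and> range creation \<subseteq> A}"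

definition wot_ideal :: "('n fock \<Rightarrow> 'n fock) set \<Rightarrow> bool"
  where "wot_ideal J \<longleftrightarrow> J \<subseteq> analytic_toeplitz \<and> closedin wot J \<and> (\<lambda>_. 0) \<in> J \<and>
    (\<forall>X\<in>J. \<forall>Y\<in>J. (\<lambda>x. X x + Y x) \<in> J) \<and>
    (\<forall>X\<in>J. \<forall>A\<in>analytic_toeplitz. A \<circ> X \<in> J \<and> X \<circ> A \<in> J)"

definition wot_ideal_generated :: "('n fock \<Rightarrow> 'n fock) set \<Rightarrow> ('n fock \<Rightarrow> 'n fock) set"
  where "wot_ideal_generated G = \<Inter>{J. wot_ideal J \<and> G \<subseteq> J}"

text \<open>
  Polynomials in the noncommuting indeterminates indexed by \<open>'n\<close> are finitely supported functions
  on words.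
\<close>

type_synonym 'n ncpoly = "'n list \<Rightarrow>\<^sub>0 complex"

definition homogeneous :: "'n ncpoly \<Rightarrow> bool"
  where "homogeneous p \<longleftrightarrow> (\<exists>k. \<forall>w\<in>Poly_Mapping.keys p. length w = k)"

fun word_op :: "('n \<Rightarrow> 'a \<Rightarrow> 'a) \<Rightarrow> 'n list \<Rightarrow> 'a \<Rightarrow> 'a"
  where
    "word_op T [] = id"
  | "word_op T (i # w) = T i \<circ> word_op T w"

definition ncpoly_eval :: "'n ncpoly \<Rightarrow> ('n \<Rightarrow> 'a::complex_hilbert \<Rightarrow> 'a) \<Rightarrow> 'a \<Rightarrow> 'a"
  where "ncpoly_eval p T x =
    (\<Sum>w\<in>Poly_Mapping.keys p. Poly_Mapping.lookup p w *\<^sub>C word_op T w x)"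

definition variety_space :: "('n fock \<Rightarrow> 'n fock) set \<Rightarrow> 'n fock set"
  where "variety_space J = orth_compl (closed_cspan {X f |X f. X \<in> J})"

text \<open>
  The compression of \<open>creation i\<close> to \<open>variety_space J\<close>; the inner projection extends it by \<open>0\<close>.
\<close>

definition constrained_shift :: "('n fock \<Rightarrow> 'n fock) set \<Rightarrow> 'n \<Rightarrow> 'n fock \<Rightarrow> 'n fock"
  where "constrained_shift J i =
    proj (variety_space J) \<circ> creation i \<circ> proj (variety_space J)"

definition variety_cstar :: "('n fock \<Rightarrow> 'n fock) set \<Rightarrow> ('n fock \<Rightarrow> 'n fock) set"
  where "variety_cstar J = cstar_generated (variety_space J) (range (constrained_shift J))"


section \<open>Row contractions and dilations\<close>

definition defect_square :: "('n::finite \<Rightarrow> 'h::complex_hilbert \<Rightarrow> 'h) \<Rightarrow> 'h \<Rightarrow> 'h"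
  where "defect_square T x = x - (\<Sum>i\<in>UNIV. T i (cadjoint (T i) x))"

definition row_contraction :: "('n::finite \<Rightarrow> 'h::complex_hilbert \<Rightarrow> 'h) \<Rightarrow> bool"
  where "row_contraction T \<longleftrightarrow> (\<forall>i. bounded_clinear (T i)) \<and> pos_op (defect_square T)"

definition defect_space :: "('n::finite \<Rightarrow> 'h::complex_hilbert \<Rightarrow> 'h) \<Rightarrow> 'h set"
  where "defect_space T = closure (range (sqrt_op (defect_square T)))"

definition coinvariant :: "('n \<Rightarrow> 'a::complex_hilbert \<Rightarrow> 'a) \<Rightarrow> 'a set \<Rightarrow> bool"
  where "coinvariant V E \<longleftrightarrow> (\<forall>i. cadjoint (V i) ` E \<subseteq> E)"

definition reducing :: "('n \<Rightarrow> 'a::complex_hilbert \<Rightarrow> 'a) \<Rightarrow> 'a set \<Rightarrow> bool"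
  where "reducing V E \<longleftrightarrow> (\<forall>i. V i ` E \<subseteq> E \<and> cadjoint (V i) ` E \<subseteq> E)"

text \<open>
  \<open>V\<close> is a family in \<open>B(K)\<close> and \<open>E\<close> a subspace of \<open>K\<close>.
\<close>

definition star_cyclic :: "'a::complex_hilbert set \<Rightarrow> ('n \<Rightarrow> 'a \<Rightarrow> 'a) \<Rightarrow> 'a set \<Rightarrow> bool"
  where "star_cyclic K V E \<longleftrightarrow>
    \<Inter>{M. closed_csubspace M \<and> E \<subseteq> M \<and> M \<subseteq> K \<and> reducing V M} = K"

definition direct_sum_op :: "('a \<Rightarrow> 'a) \<Rightarrow> ('b \<Rightarrow> 'b) \<Rightarrow> 'a \<times> 'b \<Rightarrow> 'a \<times> 'b"
  where "direct_sum_op X Y = (\<lambda>(x, y). (X x, Y y))"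

definition linear_isometry :: "('a::complex_hilbert \<Rightarrow> 'b::complex_hilbert) \<Rightarrow> bool"
  where "linear_isometry U \<longleftrightarrow> bounded_clinear U \<and> (\<forall>x. norm (U x) = norm x)"

end

(*
  Two pieces are constructed directly, which avoids Arveson's extension theorem.  The Poisson kernel
  h |-> (Delta T_w* h)_w maps H into N tensor D, intertwines the adjoints, and loses exactly the mass
  q(h) = lim_k of the sums of |T_w* h|^2 over the words w of length k.  The lost mass is recovered
  by the maps V_m h = m^(-1/2) sum of T_w* h tensor e_w over m <= |w| < 2m: homogeneity of the
  polynomials puts their values into the constrained Fock space, they intertwine the adjoints up to
  O(m^(-1/2)), |V_m h|^2 tends to q(h), and their supports move to infinity, so that compact operators
  annihilate them in the limit.  The GNS construction for X |-> lim V_m* (X tensor I) V_m therefore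
  gives the representation pi, and I - sum B_i B_i* being the vacuum projection yields both
  sum pi(B_i) pi(B_i)* = I and *-cyclicity.
*)

theory Submission
  imports Defs
begin

section \<open>Hilbert space geometry\<close>

text \<open>The GNS space must lie in the fixed type \<open>(nat, complex) l2\<close>, so it cannot
  be an abstract quotient or an ultraproduct. Instead the vectors (X tensor I) V_m h, for X a
  monomial and h in a dense sequence, are written in Gram-Schmidt coordinates: the a-th vector has
  no coordinate beyond a, so along a subsequence with convergent coordinates the vectors converge in
  norm. Any limit point serves, since the properties needed of it hold along the whole sequence. A
  single level |w| = l already has mass tending to q(h), but annihilation moves level l of h to
  level l - 1 of T_i^* h, which is orthogonal to level l. Averaging over many levels makes the two
  windows overlap up to their ends, and m^(-1/2) is the factor that turns m orthogonal levels into
  an average of masses. Homogeneity enters twice. Weights depending only on |w| factor out of each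
  relation p(T) = 0; and a homogeneous p with a constant term is a scalar, so J being proper puts
  the vacuum into the constrained Fock space, as the formula for I - sum B_i B_i^* requires.\<close>

lemma scaleC_zero_left [simp]: "0 *\<^sub>C x = 0"
  using scaleR_scaleC[of 0 x] by simp

lemma scaleC_zero_right [simp]: "c *\<^sub>C 0 = 0"
  using norm_scaleC[of c 0] by simp

lemma scaleC_minus_one: "(- 1) *\<^sub>C x = - x"
  using scaleR_scaleC[of "-1" x] by simp

lemma scaleC_minus_right: "c *\<^sub>C (- x) = - (c *\<^sub>C x)"
  using scaleC_add_right[of c x "- x"] by (simp add: eq_neg_iff_add_eq_0 add.commute)

lemma scaleC_diff_right: "c *\<^sub>C (x - y) = c *\<^sub>C x - c *\<^sub>C y"
  using scaleC_add_right[of c x "- y"] by (simp add: scaleC_minus_right)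

lemma scaleC_sum_right: "c *\<^sub>C sum f S = (\<Sum>i\<in>S. c *\<^sub>C f i)"
  by (induction S rule: infinite_finite_induct) (simp_all add: scaleC_add_right)

lemma cinner_zero_left [simp]: "cinner 0 x = 0"
  using cinner_scaleC_left[of 0 0 x] by simp

lemma cinner_zero_right [simp]: "cinner x 0 = 0"
  using cinner_scaleC_right[of x 0 0] by simp

lemma cinner_minus_left: "cinner (- x) y = - cinner x y"
  using cinner_scaleC_left[of "-1" x y] by (simp add: scaleC_minus_one)

lemma cinner_minus_right: "cinner x (- y) = - cinner x y"
  using cinner_scaleC_right[of x "-1" y] by (simp add: scaleC_minus_one)

lemma cinner_diff_left: "cinner (x - y) z = cinner x z - cinner y z"
  using cinner_add_left[of x "- y" z] by (simp add: cinner_minus_left)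

lemma cinner_diff_right: "cinner x (y - z) = cinner x y - cinner x z"
  using cinner_add_right[of x y "- z"] by (simp add: cinner_minus_right)

lemma cinner_sum_left: "cinner (sum f S) y = (\<Sum>i\<in>S. cinner (f i) y)"
  by (induction S rule: infinite_finite_induct) (simp_all add: cinner_add_left)

lemma cinner_sum_right: "cinner x (sum f S) = (\<Sum>i\<in>S. cinner x (f i))"
  by (induction S rule: infinite_finite_induct) (simp_all add: cinner_add_right)

lemma cinner_self_eq_0 [simp]: "cinner x x = 0 \<longleftrightarrow> x = 0"
  by (simp add: cinner_self)

lemma cinner_ext:
  assumes "\<And>z. cinner z x = cinner z y"
  shows "x = y"
  using assms[of "x - y"] cinner_self_eq_0[of "x - y"] by (simp add: cinner_diff_right)

lemma cinner_eq_0_commute: "cinner x y = 0 \<longleftrightarrow> cinner y x = 0"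
  by (metis cinner_commute complex_cnj_zero)

lemma bounded_bilinear_cinner: "bounded_bilinear (cinner :: 'a::complex_hilbert \<Rightarrow> 'a \<Rightarrow> complex)"
proof
  show "\<exists>K. \<forall>a b::'a. norm (cinner a b) \<le> norm a * norm b * K"
    by (rule exI[of _ 1]) (simp add: cmod_cinner_le)
qed (simp_all add: cinner_add_left cinner_add_right scaleR_scaleC cinner_scaleC_left
      cinner_scaleC_right scaleC_complex_def)

lemmas tendsto_cinner [tendsto_intros] = bounded_bilinear.tendsto[OF bounded_bilinear_cinner]
lemmas continuous_on_cinner [continuous_intros] =
  bounded_bilinear.continuous_on[OF bounded_bilinear_cinner]

lemma bounded_linear_scaleC: "bounded_linear (\<lambda>x. c *\<^sub>C x)"
  by (rule bounded_linear_intro[of _ "cmod c"])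
     (simp_all add: scaleC_add_right scaleR_scaleC scaleC_scaleC norm_scaleC mult.commute)

lemmas tendsto_scaleC = bounded_linear.tendsto[OF bounded_linear_scaleC]

lemma tendsto_scaleC_left:
  assumes "(f \<longlongrightarrow> c) F"
  shows "((\<lambda>n. f n *\<^sub>C x) \<longlongrightarrow> c *\<^sub>C x) F"
proof -
  have "bounded_linear (\<lambda>c. c *\<^sub>C x)"
    by (rule bounded_linear_intro[of _ "norm x"])
       (simp_all add: scaleC_add_left scaleR_scaleC scaleC_scaleC norm_scaleC scaleC_complex_def)
  from bounded_linear.tendsto[OF this assms] show ?thesis .
qed

section \<open>Complex subspaces, closed spans and orthogonal complements\<close>

lemma csubspace_0: "csubspace M \<Longrightarrow> 0 \<in> M"
  and csubspace_add: "csubspace M \<Longrightarrow> x \<in> M \<Longrightarrow> y \<in> M \<Longrightarrow> x + y \<in> M"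
  and csubspace_scaleC: "csubspace M \<Longrightarrow> x \<in> M \<Longrightarrow> c *\<^sub>C x \<in> M"
  by (auto simp: csubspace_def)

lemma csubspace_scaleR: "csubspace M \<Longrightarrow> x \<in> M \<Longrightarrow> r *\<^sub>R x \<in> M"
  by (simp add: scaleR_scaleC csubspace_scaleC)

lemma csubspace_diff: "csubspace M \<Longrightarrow> x \<in> M \<Longrightarrow> y \<in> M \<Longrightarrow> x - y \<in> M"
  using csubspace_add[of M x "(- 1) *\<^sub>C y"] csubspace_scaleC[of M y "- 1"]
  by (simp add: scaleC_minus_one)

lemma csubspace_sum: "csubspace M \<Longrightarrow> (\<And>i. i \<in> I \<Longrightarrow> f i \<in> M) \<Longrightarrow> sum f I \<in> M"
  by (induction I rule: infinite_finite_induct) (auto simp: csubspace_0 csubspace_add)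

lemma closed_csubspaceD: "closed_csubspace M \<Longrightarrow> csubspace M"
  by (simp add: closed_csubspace_def)

lemma closed_csubspace_Times:
  "closed_csubspace M \<Longrightarrow> closed_csubspace L \<Longrightarrow> closed_csubspace (M \<times> L)"
  by (auto simp: closed_csubspace_def csubspace_def scaleC_prod_def closed_Times zero_prod_def)

lemma csubspace_closure:
  assumes M: "csubspace M"
  shows "csubspace (closure M)"
  unfolding csubspace_def
proof (intro conjI ballI allI)
  show "0 \<in> closure M" using csubspace_0[OF M] closure_subset by blast
next
  fix x y assume "x \<in> closure M" "y \<in> closure M"
  then obtain f g where "\<And>n. f n \<in> M" "f \<longlonglongrightarrow> x" "\<And>n. g n \<in> M" "g \<longlonglongrightarrow> y"
    by (auto simp: closure_sequential)
  then show "x + y \<in> closure M"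
    unfolding closure_sequential
    by (intro exI[of _ "\<lambda>n. f n + g n"]) (auto intro: tendsto_add csubspace_add[OF M])
next
  fix c x assume "x \<in> closure M"
  then obtain f where "\<And>n. f n \<in> M" "f \<longlonglongrightarrow> x" by (auto simp: closure_sequential)
  then show "c *\<^sub>C x \<in> closure M"
    unfolding closure_sequential
    by (intro exI[of _ "\<lambda>n. c *\<^sub>C f n"]) (auto intro: tendsto_scaleC csubspace_scaleC[OF M])
qed

lemma csubspace_hull: "csubspace (csubspace hull S)"
  by (rule hull_in) (auto simp: csubspace_def)

lemma closed_csubspace_closed_cspan [simp]: "closed_csubspace (closed_cspan S)"
  by (simp add: closed_csubspace_def closed_cspan_def csubspace_closure csubspace_hull)

lemma closed_cspan_superset: "S \<subseteq> closed_cspan S"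
  unfolding closed_cspan_def by (meson closure_subset hull_subset order_trans)

lemma closed_cspan_base: "x \<in> S \<Longrightarrow> x \<in> closed_cspan S"
  using closed_cspan_superset by blast

lemma closed_cspan_minimal: "S \<subseteq> M \<Longrightarrow> closed_csubspace M \<Longrightarrow> closed_cspan S \<subseteq> M"
  unfolding closed_cspan_def closed_csubspace_def
  by (simp add: closure_minimal hull_minimal)

lemma closed_cspan_mono: "S \<subseteq> S' \<Longrightarrow> closed_cspan S \<subseteq> closed_cspan S'"
  by (rule closed_cspan_minimal) (use closed_cspan_superset in blast, simp)

lemma closed_csubspace_orth_compl [simp]: "closed_csubspace (orth_compl M)"
proof -
  have "closed (\<Inter>y\<in>M. {x. cinner x y = 0})"
    by (intro closed_INT ballI closed_Collect_eq continuous_intros)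
  moreover have "orth_compl M = (\<Inter>y\<in>M. {x. cinner x y = 0})" by (auto simp: orth_compl_def)
  ultimately show ?thesis
    by (auto simp: closed_csubspace_def csubspace_def orth_compl_def cinner_add_left
        cinner_scaleC_left)
qed

lemma orth_compl_cspan: "orth_compl (closed_cspan S) = orth_compl S"
proof
  show "orth_compl (closed_cspan S) \<subseteq> orth_compl S"
    using closed_cspan_superset by (auto simp: orth_compl_def)
  show "orth_compl S \<subseteq> orth_compl (closed_cspan S)"
  proof
    fix x assume x: "x \<in> orth_compl S"
    have "S \<subseteq> orth_compl {x}"
      using x cinner_eq_0_commute[of x] by (auto simp: orth_compl_def)
    then have "closed_cspan S \<subseteq> orth_compl {x}" by (rule closed_cspan_minimal) simp
    then show "x \<in> orth_compl (closed_cspan S)"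
      using cinner_eq_0_commute[of x] by (auto simp: orth_compl_def)
  qed
qed

section \<open>Orthogonal projections onto closed subspaces\<close>

lemma orthogonal_of_minimal_norm:
  fixes u z :: "'a::real_inner"
  assumes "\<And>t. (norm u)\<^sup>2 \<le> (norm (u - t *\<^sub>R z))\<^sup>2"
  shows "inner u z = 0"
proof (cases "z = 0")
  case False
  define a where "a = inner u z"
  have "(norm (u - t *\<^sub>R z))\<^sup>2 = (norm u)\<^sup>2 - 2 * t * a + t\<^sup>2 * (norm z)\<^sup>2" for t
    unfolding power2_norm_eq_inner
    by (simp add: inner_diff_left inner_diff_right a_def inner_commute power2_eq_square algebra_simps)
  \<comment> \<open>t = a / |z|^2 is the vertex of the quadratic; it would lower |u|^2 by a^2 /
    |z|^2.\<close>
  then have "(norm (u - (a / (norm z)\<^sup>2) *\<^sub>R z))\<^sup>2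
      = (norm u)\<^sup>2 - 2 * (a / (norm z)\<^sup>2) * a + (a / (norm z)\<^sup>2)\<^sup>2 * (norm z)\<^sup>2"
    by blast
  also have "\<dots> = (norm u)\<^sup>2 - a\<^sup>2 / (norm z)\<^sup>2"
    using False by (simp add: field_simps power2_eq_square)
  finally have "a\<^sup>2 / (norm z)\<^sup>2 \<le> 0" using assms[of "a / (norm z)\<^sup>2"] by simp
  then have "a = 0" using False by (simp add: divide_le_0_iff)
  then show ?thesis by (simp add: a_def)
qed simp

text \<open>A minimising sequence for the distance from x to M is Cauchy by the parallelogram law;
  its limit is a nearest point, and minimality along every line through it makes the remainder
  orthogonal to M.\<close>

lemma proj_exists:
  fixes x :: "'a::complex_hilbert"
  assumes M: "closed_csubspace M"
  shows "\<exists>y\<in>M. x - y \<in> orth_compl M"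
proof -
  have sub: "csubspace M" and cl: "closed M" using M by (auto simp: closed_csubspace_def)
  define S where "S = (\<lambda>y. (norm (x - y))\<^sup>2) ` M"
  define d where "d = Inf S"
  have ne: "S \<noteq> {}" using csubspace_0[OF sub] by (auto simp: S_def)
  have bdd: "bdd_below S" by (auto simp: S_def bdd_below_def intro!: exI[of _ 0])
  have d_le: "d \<le> (norm (x - y))\<^sup>2" if "y \<in> M" for y
    unfolding d_def by (rule cInf_lower[OF _ bdd]) (use that in \<open>auto simp: S_def\<close>)
  have "\<exists>y\<in>M. (norm (x - y))\<^sup>2 < d + 1 / real (Suc n)" for n
    using cInf_lessD[OF ne, of "d + 1 / real (Suc n)"] by (auto simp: d_def S_def)
  then obtain y where yM: "\<And>n. y n \<in> M" and yd: "\<And>n. (norm (x - y n))\<^sup>2 < d + 1 / real (Suc n)"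
    by metis
  \<comment> \<open>Parallelogram law for x - y n and x - y m: their sum is twice the vector from a
    midpoint in M to x, so its squared norm is at least 4 d and little is left for the
    difference.\<close>
  have par: "(norm (y n - y m))\<^sup>2 \<le> 2 / real (Suc n) + 2 / real (Suc m)" for n m
  proof -
    have "(1/2) *\<^sub>R (y n + y m) \<in> M"
      using yM sub by (simp add: csubspace_add csubspace_scaleR)
    from d_le[OF this] have "4 * d \<le> (norm (2 *\<^sub>R (x - (1/2) *\<^sub>R (y n + y m))))\<^sup>2"
      by (simp add: power_mult_distrib)
    also have "2 *\<^sub>R (x - (1/2) *\<^sub>R (y n + y m)) = (x - y n) + (x - y m)"
      by (simp add: scaleR_diff_right scaleR_2)
    finally have "4 * d \<le> (norm ((x - y n) + (x - y m)))\<^sup>2" .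
    moreover have "(norm (y n - y m))\<^sup>2 + (norm ((x - y n) + (x - y m)))\<^sup>2
        = 2 * (norm (x - y n))\<^sup>2 + 2 * (norm (x - y m))\<^sup>2"
      by (simp add: power2_norm_eq_inner inner_diff_left inner_diff_right inner_add_left
          inner_add_right inner_commute)
    moreover have "2 / real (Suc n) = 2 * (1 / real (Suc n))" "2 / real (Suc m) = 2 * (1 / real (Suc m))"
      by simp_all
    ultimately show ?thesis using yd[of n] yd[of m] by linarith
  qed
  have "Cauchy y"
  proof (rule metric_CauchyI)
    fix e :: real assume e: "0 < e"
    then obtain N where N: "inverse (real (Suc N)) < e\<^sup>2 / 4"
      using reals_Archimedean[of "e\<^sup>2 / 4"] by auto
    have "dist (y m) (y n) < e" if "m \<ge> N" "n \<ge> N" for m n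
    proof -
      have "2 / real (Suc m) + 2 / real (Suc n) \<le> 2 / real (Suc N) + 2 / real (Suc N)"
        using that by (intro add_mono divide_left_mono) auto
      also have "\<dots> = 4 * inverse (real (Suc N))" by (simp add: divide_inverse del: of_nat_Suc)
      also have "\<dots> < e\<^sup>2" using N by simp
      finally have "(norm (y m - y n))\<^sup>2 < e\<^sup>2" using par[of m n] by linarith
      then show ?thesis using e by (simp add: dist_norm power_less_imp_less_base)
    qed
    then show "\<exists>N. \<forall>m\<ge>N. \<forall>n\<ge>N. dist (y m) (y n) < e" by blast
  qed
  then obtain l where l: "y \<longlonglongrightarrow> l" using Cauchy_convergent convergent_def by blast
  have lM: "l \<in> M" using closed_sequentially[OF cl _ l] yM by blast
  have "(\<lambda>n. d + 1 / real (Suc n)) \<longlonglongrightarrow> d + 0"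
    by (intro tendsto_add tendsto_const LIMSEQ_Suc[OF lim_1_over_n])
  moreover have "(\<lambda>n. (norm (x - y n))\<^sup>2) \<longlonglongrightarrow> (norm (x - l))\<^sup>2"
    by (intro tendsto_intros l)
  ultimately have ld: "(norm (x - l))\<^sup>2 \<le> d"
    using yd by (auto intro: LIMSEQ_le less_imp_le)
  have re: "inner (x - l) z = 0" if z: "z \<in> M" for z
  proof (rule orthogonal_of_minimal_norm)
    fix t
    have d: "d \<le> (norm (x - (l + t *\<^sub>R z)))\<^sup>2"
      using d_le lM z sub by (simp add: csubspace_add csubspace_scaleR)
    then show "(norm (x - l))\<^sup>2 \<le> (norm (x - l - t *\<^sub>R z))\<^sup>2"
      using order_trans[OF ld d] by (simp only: diff_diff_add)
  qed
  have "cinner (x - l) z = 0" if z: "z \<in> M" for z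
  proof (rule complex_eqI)
    show "Re (cinner (x - l) z) = Re 0" using re[OF z] by (simp add: inner_eq_Re_cinner)
    \<comment> \<open>The real inner product sees only real parts; testing against i z recovers the
      imaginary part.\<close>
    have "\<i> *\<^sub>C z \<in> M" using csubspace_scaleC[OF sub z] .
    from re[OF this] show "Im (cinner (x - l) z) = Im 0"
      by (simp add: inner_eq_Re_cinner cinner_scaleC_right)
  qed
  then show ?thesis using lM by (auto simp: orth_compl_def)
qed

lemma proj_eqI:
  assumes "closed_csubspace M" "y \<in> M" "x - y \<in> orth_compl M"
  shows "proj M x = y"
  unfolding proj_def
proof (rule the_equality)
  fix y' assume y': "y' \<in> M \<and> x - y' \<in> orth_compl M"
  have "y' - y \<in> M" using assms y' by (simp add: closed_csubspaceD csubspace_diff)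
  moreover have "(x - y) - (x - y') \<in> orth_compl M"
    using assms(3) y' by (blast intro: csubspace_diff closed_csubspaceD closed_csubspace_orth_compl)
  ultimately have "cinner (y' - y) (y' - y) = 0" by (simp add: orth_compl_def)
  then show "y' = y" by simp
qed (use assms in blast)

lemma proj_props:
  assumes M: "closed_csubspace M"
  shows proj_in: "proj M x \<in> M" and proj_orth: "x - proj M x \<in> orth_compl M"
  using proj_exists[OF M, of x] proj_eqI[OF M, of _ x] by auto

lemma proj_id: "closed_csubspace M \<Longrightarrow> x \<in> M \<Longrightarrow> proj M x = x"
  by (rule proj_eqI) (auto simp: orth_compl_def)

lemma proj_orth_zero: "closed_csubspace M \<Longrightarrow> x \<in> orth_compl M \<Longrightarrow> proj M x = 0"
  by (rule proj_eqI) (auto simp: csubspace_0 closed_csubspaceD)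

lemma cinner_orth: "x \<in> orth_compl M \<Longrightarrow> y \<in> M \<Longrightarrow> cinner x y = 0"
  "x \<in> orth_compl M \<Longrightarrow> y \<in> M \<Longrightarrow> cinner y x = 0"
  using cinner_eq_0_commute[of x] by (auto simp: orth_compl_def)

lemma cinner_proj:
  assumes M: "closed_csubspace M"
  shows "cinner (proj M x) y = cinner x (proj M y)"
proof -
  have "cinner (proj M x) (y - proj M y) = 0" "cinner (x - proj M x) (proj M y) = 0"
    using cinner_orth proj_props[OF M] by blast+
  then show ?thesis by (simp add: cinner_diff_left cinner_diff_right)
qed

lemma orth_compl_orth_compl:
  assumes M: "closed_csubspace M"
  shows "orth_compl (orth_compl M) = M"
proof
  show "orth_compl (orth_compl M) \<subseteq> M"
  proof
    fix x assume x: "x \<in> orth_compl (orth_compl M)"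
    have "cinner (x - proj M x) (x - proj M x) = 0"
      using cinner_orth(2)[OF proj_orth[OF M] proj_in[OF M], of x x]
        cinner_orth(1)[OF x proj_orth[OF M, of x]]
      by (simp add: cinner_diff_left)
    then show "x \<in> M" using proj_in[OF M, of x] by simp
  qed
  show "M \<subseteq> orth_compl (orth_compl M)" using cinner_orth(2) by (auto simp: orth_compl_def[of "orth_compl M"])
qed

lemma closed_cspan_eq_UNIV:
  assumes "\<And>x. (\<And>s. s \<in> S \<Longrightarrow> cinner x s = 0) \<Longrightarrow> x = 0"
  shows "closed_cspan S = UNIV"
proof -
  have "orth_compl (closed_cspan S) \<subseteq> {0}"
    unfolding orth_compl_cspan using assms by (auto simp: orth_compl_def)
  then have "orth_compl (orth_compl (closed_cspan S)) = UNIV"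
    by (auto simp: orth_compl_def)
  then show ?thesis by (simp add: orth_compl_orth_compl)
qed

section \<open>Bounded operators and adjoints\<close>

lemma bounded_clinearI:
  assumes "\<And>x y. X (x + y) = X x + X y" "\<And>c x. X (c *\<^sub>C x) = c *\<^sub>C X x"
    and "\<And>x. norm (X x) \<le> C * norm x"
  shows "bounded_clinear X"
  unfolding bounded_clinear_def
proof
  show "bounded_linear X"
    by (rule bounded_linear_intro[of _ C]) (use assms in \<open>simp_all add: scaleR_scaleC mult.commute\<close>)
qed (use assms in blast)

lemma clinear_bounded_linear: "bounded_clinear X \<Longrightarrow> bounded_linear X"
  and bounded_clinear_scaleC: "bounded_clinear X \<Longrightarrow> X (c *\<^sub>C x) = c *\<^sub>C X x"
  by (auto simp: bounded_clinear_def)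

lemmas clinear_simps =
  bounded_clinear_scaleC
  linear_simps(1)[OF clinear_bounded_linear]
  linear_simps(2)[OF clinear_bounded_linear]
  linear_simps(3)[OF clinear_bounded_linear]
  linear_simps(4)[OF clinear_bounded_linear]

lemma bounded_clinear_sum: "bounded_clinear X \<Longrightarrow> X (sum f S) = (\<Sum>i\<in>S. X (f i))"
  using linear_sum bounded_linear.linear clinear_bounded_linear by blast

lemma bounded_clinear_tendsto:
  "bounded_clinear X \<Longrightarrow> (f \<longlongrightarrow> a) F \<Longrightarrow> ((\<lambda>n. X (f n)) \<longlongrightarrow> X a) F"
  using bounded_linear.tendsto clinear_bounded_linear by blast

lemma bounded_clinear_onorm: "bounded_clinear X \<Longrightarrow> norm (X x) \<le> onorm X * norm x"
  by (rule onorm[OF clinear_bounded_linear])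

lemma clinear_onorm_nonneg: "bounded_clinear X \<Longrightarrow> 0 \<le> onorm X"
  by (rule onorm_pos_le[OF clinear_bounded_linear])

lemma bounded_clinear_zero: "bounded_clinear (\<lambda>_. 0)"
  by (rule bounded_clinearI[of _ 0]) simp_all

lemma bounded_clinear_id: "bounded_clinear id"
  by (rule bounded_clinearI[of _ 1]) simp_all

lemma bounded_clinear_compose: "bounded_clinear X \<Longrightarrow> bounded_clinear Y \<Longrightarrow> bounded_clinear (X \<circ> Y)"
  unfolding bounded_clinear_def o_def by (simp add: bounded_linear_compose)

lemma bounded_clinear_add:
  "bounded_clinear X \<Longrightarrow> bounded_clinear Y \<Longrightarrow> bounded_clinear (\<lambda>x. X x + Y x)"
  unfolding bounded_clinear_def by (simp add: bounded_linear_add scaleC_add_right)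

lemma bounded_clinear_diff:
  "bounded_clinear X \<Longrightarrow> bounded_clinear Y \<Longrightarrow> bounded_clinear (\<lambda>x. X x - Y x)"
  unfolding bounded_clinear_def by (simp add: bounded_linear_sub scaleC_diff_right)

lemma bounded_clinear_scale: "bounded_clinear X \<Longrightarrow> bounded_clinear (\<lambda>x. c *\<^sub>C X x)"
  unfolding bounded_clinear_def
  by (simp add: bounded_linear_compose[OF bounded_linear_scaleC] scaleC_scaleC mult.commute)

lemma bounded_clinear_setsum:
  "(\<And>i. i \<in> I \<Longrightarrow> bounded_clinear (X i)) \<Longrightarrow> bounded_clinear (\<lambda>x. \<Sum>i\<in>I. X i x)"
  unfolding bounded_clinear_def by (simp add: bounded_linear_sum scaleC_sum_right)

lemma bounded_clinear_limit:
  assumes X: "\<And>n::nat. bounded_clinear (X n)" and C: "\<And>n x. norm (X n x) \<le> C * norm x"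
    and Y: "\<And>x. (\<lambda>n. X n x) \<longlonglongrightarrow> Y x"
  shows "bounded_clinear Y"
proof (rule bounded_clinearI)
  show "Y (x + y) = Y x + Y y" for x y
    using Y[of "x + y"] tendsto_add[OF Y[of x] Y[of y]]
    by (simp add: clinear_simps[OF X] LIMSEQ_unique)
  show "Y (c *\<^sub>C x) = c *\<^sub>C Y x" for c x
    using Y[of "c *\<^sub>C x"] tendsto_scaleC[OF Y[of x], of c]
    by (simp add: clinear_simps[OF X] LIMSEQ_unique)
  show "norm (Y x) \<le> C * norm x" for x
    by (rule LIMSEQ_le_const2[OF tendsto_norm[OF Y]]) (use C in blast)
qed

lemma bounded_clinear_cinner_left: "bounded_clinear (\<lambda>x. cinner x y)"
  by (rule bounded_clinearI[of _ "norm y"])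
     (simp_all add: cinner_add_left cinner_scaleC_left scaleC_complex_def cmod_cinner_le
       mult.commute[of "norm y"])

lemma closed_csubspace_vimage:
  assumes X: "bounded_clinear X" and M: "closed_csubspace M"
  shows "closed_csubspace {x. X x \<in> M}"
proof -
  have "closed (X -` M)"
    using M continuous_closed_vimage[of M X] linear_continuous_at[OF clinear_bounded_linear[OF X]]
    by (simp add: closed_csubspace_def)
  then show ?thesis using M X
    by (auto simp: closed_csubspace_def csubspace_def clinear_simps vimage_def)
qed

lemma closed_csubspace_0: "closed_csubspace {0}"
  by (simp add: closed_csubspace_def csubspace_def)

lemma closed_csubspace_eq:
  assumes X: "bounded_clinear X" and Y: "bounded_clinear Y"
  shows "closed_csubspace {x. X x = Y x}"
  using closed_csubspace_vimage[OF bounded_clinear_diff[OF X Y] closed_csubspace_0] by simp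

lemma bounded_clinear_eq_on_cspan:
  assumes "bounded_clinear X" "bounded_clinear Y" "\<And>x. x \<in> S \<Longrightarrow> X x = Y x" "x \<in> closed_cspan S"
  shows "X x = Y x"
  using closed_cspan_minimal[of S, OF _ closed_csubspace_eq[OF assms(1,2)]] assms(3,4) by auto

section \<open>Riesz representation and adjoints\<close>

lemma riesz:
  fixes \<phi> :: "'a::complex_hilbert \<Rightarrow> complex"
  assumes \<phi>: "bounded_clinear \<phi>"
  shows "\<exists>z. \<forall>x. \<phi> x = cinner x z"
proof (cases "\<forall>x. \<phi> x = 0")
  case True
  then show ?thesis by (intro exI[of _ 0]) simp
next
  case False
  then obtain x where x: "\<phi> x \<noteq> 0" by blast
  define M where "M = {x. \<phi> x = 0}"
  have M: "closed_csubspace M"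
    unfolding M_def using closed_csubspace_eq[OF \<phi> bounded_clinear_zero] .
  define u where "u = x - proj M x"
  have u: "u \<in> orth_compl M" unfolding u_def by (rule proj_orth[OF M])
  have "\<phi> (proj M x) = 0" using proj_in[OF M, of x] by (simp add: M_def)
  then have \<phi>u: "\<phi> u \<noteq> 0" using x by (simp add: u_def clinear_simps[OF \<phi>])
  then have u0: "u \<noteq> 0" using clinear_simps[OF \<phi>] by auto
  have "\<phi> y = cinner y ((cnj (\<phi> u) / (norm u)\<^sup>2) *\<^sub>C u)" for y
  proof -
    \<comment> \<open>The kernel has codimension one: removing this multiple of u lands in the
      kernel, to which u is orthogonal.\<close>
    have "y - (\<phi> y / \<phi> u) *\<^sub>C u \<in> M"
      using \<phi>u by (simp add: M_def clinear_simps[OF \<phi>] scaleC_complex_def)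
    from cinner_orth(2)[OF u this] have "cinner y u = \<phi> y / \<phi> u * (norm u)\<^sup>2"
      by (simp add: cinner_diff_left cinner_scaleC_left cinner_self)
    then show ?thesis using \<phi>u u0 by (simp add: cinner_scaleC_right)
  qed
  then show ?thesis by blast
qed

text \<open>Inner products separate points, so the adjoint relation alone pins down the description
  in \<open>cadjoint\<close>. Concrete adjoints below are found by exhibiting a candidate.\<close>

lemma cadjointI:
  assumes "\<And>x y. cinner (X x) y = cinner x (Y y)"
  shows "cadjoint X = Y"
  unfolding cadjoint_def
proof (rule the_equality)
  fix Y' assume "\<forall>x y. cinner (X x) y = cinner x (Y' y)"
  then have "cinner x (Y' y) = cinner x (Y y)" for x y by (metis assms)
  then show "Y' = Y" by (blast intro: cinner_ext)
qed (use assms in blast)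

lemma cinner_cadjoint:
  assumes X: "bounded_clinear X"
  shows "cinner (X x) y = cinner x (cadjoint X y)"
proof -
  have "\<exists>z. \<forall>x. cinner (X x) y = cinner x z" for y
    using riesz[OF bounded_clinear_compose[OF bounded_clinear_cinner_left[of y] X]] by simp
  then obtain Y where Y: "\<And>x y. cinner (X x) y = cinner x (Y y)" by metis
  then show ?thesis using cadjointI[of X Y] by simp
qed

lemma cinner_cadjoint':
  assumes X: "bounded_clinear X"
  shows "cinner (cadjoint X x) y = cinner x (X y)"
  by (metis X cinner_cadjoint cinner_commute)

lemma norm_cadjoint_le:
  assumes X: "bounded_clinear X" and C: "\<And>x. norm (X x) \<le> C * norm x" and "0 \<le> C"
  shows "norm (cadjoint X y) \<le> C * norm y"
proof (cases "cadjoint X y = 0")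
  case True
  then show ?thesis using \<open>0 \<le> C\<close> by simp
next
  case False
  let ?z = "cadjoint X y"
  have "(norm ?z)\<^sup>2 = cmod (cinner (X ?z) y)"
    by (simp add: cinner_cadjoint[OF X] cinner_self norm_power)
  also have "\<dots> \<le> norm (X ?z) * norm y" by (rule cmod_cinner_le)
  also have "\<dots> \<le> C * norm ?z * norm y" by (intro mult_right_mono C) simp
  finally have "norm ?z * norm ?z \<le> norm ?z * (C * norm y)" by (simp add: power2_eq_square mult_ac)
  then show ?thesis using False by simp
qed

lemma bounded_clinear_cadjoint:
  assumes X: "bounded_clinear X"
  shows "bounded_clinear (cadjoint X)"
proof (rule bounded_clinearI)
  show "norm (cadjoint X x) \<le> onorm X * norm x" for x
    by (rule norm_cadjoint_le[OF X bounded_clinear_onorm[OF X] clinear_onorm_nonneg[OF X]])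
qed (rule cinner_ext, simp add: cinner_add_right cinner_scaleC_right flip: cinner_cadjoint[OF X])+

lemma cadjoint_cadjoint: "bounded_clinear X \<Longrightarrow> cadjoint (cadjoint X) = X"
  by (rule cadjointI) (rule cinner_cadjoint')

lemma cadjoint_compose:
  "bounded_clinear X \<Longrightarrow> bounded_clinear Y \<Longrightarrow> cadjoint (X \<circ> Y) = cadjoint Y \<circ> cadjoint X"
  by (rule cadjointI) (simp add: cinner_cadjoint)

lemma cadjoint_add:
  "bounded_clinear X \<Longrightarrow> bounded_clinear Y \<Longrightarrow>
    cadjoint (\<lambda>x. X x + Y x) = (\<lambda>x. cadjoint X x + cadjoint Y x)"
  by (rule cadjointI) (simp add: cinner_cadjoint cinner_add_left cinner_add_right)

lemma cadjoint_scale: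
  "bounded_clinear X \<Longrightarrow> cadjoint (\<lambda>x. c *\<^sub>C X x) = (\<lambda>x. cnj c *\<^sub>C cadjoint X x)"
  by (rule cadjointI) (simp add: cinner_cadjoint cinner_scaleC_left cinner_scaleC_right)

lemma cadjoint_id: "cadjoint id = id"
  by (rule cadjointI) simp

lemma cadjoint_proj: "closed_csubspace M \<Longrightarrow> cadjoint (proj M) = proj M"
  by (rule cadjointI) (rule cinner_proj)

lemma norm_proj_le:
  assumes M: "closed_csubspace M"
  shows "norm (proj M x) \<le> norm x"
proof -
  have "(norm (proj M x))\<^sup>2 = cmod (cinner x (proj M x))"
    using cinner_proj[OF M, of x "proj M x"] proj_id[OF M proj_in[OF M, of x]]
    by (metis cinner_self norm_of_real abs_of_nonneg zero_le_power2)
  also have "\<dots> \<le> norm x * norm (proj M x)" by (rule cmod_cinner_le)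
  finally have "norm (proj M x) * norm (proj M x) \<le> norm x * norm (proj M x)"
    by (simp add: power2_eq_square)
  then show ?thesis by (cases "proj M x = 0") auto
qed

lemma bounded_clinear_proj:
  assumes M: "closed_csubspace M"
  shows "bounded_clinear (proj M)"
proof (rule bounded_clinearI[of _ 1])
  have s: "csubspace M" "csubspace (orth_compl M)" using M by (simp_all add: closed_csubspaceD)
  show "proj M (x + y) = proj M x + proj M y" for x y
    by (rule proj_eqI[OF M])
       (use proj_props[OF M] csubspace_add[OF s(2) proj_orth[OF M, of x] proj_orth[OF M, of y]] s
         in \<open>auto simp: csubspace_add algebra_simps\<close>)
  show "proj M (c *\<^sub>C x) = c *\<^sub>C proj M x" for c x
    by (rule proj_eqI[OF M])
       (use proj_props[OF M] csubspace_scaleC[OF s(2) proj_orth[OF M, of x], of c] s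
         in \<open>auto simp: csubspace_scaleC scaleC_diff_right\<close>)
qed (simp add: norm_proj_le[OF M])

section \<open>Square roots of positive operators\<close>

lemma pos_op_bounded: "pos_op X \<Longrightarrow> bounded_clinear X"
  by (simp add: pos_op_def)

lemma pos_op_Re: "pos_op X \<Longrightarrow> 0 \<le> Re (cinner (X x) x)"
  and pos_op_Im: "pos_op X \<Longrightarrow> Im (cinner (X x) x) = 0"
  by (simp_all add: pos_op_def complex_nonneg_Reals_iff)

lemma pos_opI:
  assumes "bounded_clinear X" "\<And>x y. cinner (X x) y = cinner x (X y)"
    and "\<And>x. 0 \<le> Re (cinner (X x) x)"
  shows "pos_op X"
proof -
  have "Im (cinner (X x) x) = 0" for x
    using arg_cong[OF cinner_commute[of x "X x"], of Im] assms(2)[of x x] by simp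
  then show ?thesis using assms by (simp add: pos_op_def complex_nonneg_Reals_iff)
qed

text \<open>Polarisation: the real diagonal at x + y makes the imaginary parts of <X x, y> and <X y,
  x> opposite, and the same with i x in place of x makes their real parts equal.\<close>

lemma pos_op_selfadjoint:
  assumes X: "pos_op X"
  shows "cinner (X x) y = cinner x (X y)"
proof -
  note lin = clinear_simps[OF pos_op_bounded[OF X]]
  have re: "Im (cinner (X x) y) + Im (cinner (X y) x) = 0" for x y
    using pos_op_Im[OF X, of "x + y"] pos_op_Im[OF X, of x] pos_op_Im[OF X, of y]
    by (simp add: lin cinner_add_left cinner_add_right)
  have "cinner (X x) y = cnj (cinner (X y) x)"
    using re[of x y] re[of "\<i> *\<^sub>C x" y]
    by (intro complex_eqI) (simp_all add: lin cinner_scaleC_left cinner_scaleC_right)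
  then show ?thesis by (simp flip: cinner_commute)
qed

text \<open>Moving from u a distance t in the direction -X u changes the form by -2 t |X u|^2 to
  first order, which positivity forbids unless X u = 0. Uniqueness of the square root rests on
  this.\<close>

lemma pos_op_eq_0:
  assumes X: "pos_op X" and u: "cinner (X u) u = 0"
  shows "X u = 0"
proof -
  note lin = clinear_simps[OF pos_op_bounded[OF X]]
  define c n where "c = Re (cinner (X (X u)) (X u))" and "n = (norm (X u))\<^sup>2"
  have c: "0 \<le> c" unfolding c_def by (rule pos_op_Re[OF X])
  have quad: "0 \<le> 2 * t * n + t\<^sup>2 * c" for t
  proof -
    have "cinner (X (X u)) u = cinner (X u) (X u)" by (rule pos_op_selfadjoint[OF X])
    then have "Re (cinner (X (u + complex_of_real t *\<^sub>C X u)) (u + complex_of_real t *\<^sub>C X u))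
        = 2 * t * n + t\<^sup>2 * c"
      by (simp add: lin cinner_add_left cinner_add_right cinner_scaleC_left cinner_scaleC_right u
          cinner_self c_def n_def power2_eq_square algebra_simps)
    then show ?thesis using pos_op_Re[OF X] by metis
  qed
  have "n = 0"
  proof (rule ccontr)
    assume "n \<noteq> 0"
    then have n: "0 < n" by (simp add: n_def)
    \<comment> \<open>A step small enough for the linear term to win, with a positive denominator
      even if c = 0. The quadratic at -s equals -s^2 (c + 2).\<close>
    define s where "s = n / (c + 1)"
    have "n = s * (c + 1)" using c by (simp add: s_def)
    then have "2 * (- s) * n + (- s)\<^sup>2 * c = - (s\<^sup>2 * (c + 2))"
      by (simp add: power2_eq_square algebra_simps)
    moreover have "0 < s\<^sup>2 * (c + 2)" using n c by (simp add: s_def)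
    ultimately show False using quad[of "- s"] by linarith
  qed
  then show ?thesis by (simp add: n_def)
qed

text \<open>
  With \<open>X = I - A\<close>, the iterates \<open>Y\<^sub>n\<^sub>+\<^sub>1 = (A + Y\<^sub>n\<^sup>2) / 2\<close> converge to \<open>Z\<close> with \<open>(I - Z)\<^sup>2 = X\<close>. Their
  increments are dominated by those of the scalar iteration \<open>t\<^sub>n\<^sub>+\<^sub>1 = (1 + t\<^sub>n\<^sup>2) / 2\<close>, because all
  iterates are polynomials in \<open>A\<close> and hence commute.
\<close>

primrec sqrt_iter :: "('a::complex_hilbert \<Rightarrow> 'a) \<Rightarrow> nat \<Rightarrow> 'a \<Rightarrow> 'a"
  where
    "sqrt_iter A 0 = (\<lambda>_. 0)"
  | "sqrt_iter A (Suc n) = (\<lambda>x. (1/2) *\<^sub>C (A x + sqrt_iter A n (sqrt_iter A n x)))"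

primrec sqrt_iter_bound :: "nat \<Rightarrow> real"
  where
    "sqrt_iter_bound 0 = 0"
  | "sqrt_iter_bound (Suc n) = (1 + (sqrt_iter_bound n)\<^sup>2) / 2"

lemma sqrt_iter_bound_range: "0 \<le> sqrt_iter_bound n \<and> sqrt_iter_bound n \<le> 1"
  by (induction n) (auto simp: power_le_one)

lemma sqrt_iter_bound_mono: "sqrt_iter_bound n \<le> sqrt_iter_bound (Suc n)"
  using sum_squares_bound[of "sqrt_iter_bound n" 1] by simp

lemma bounded_clinear_sqrt_iter:
  "bounded_clinear A \<Longrightarrow> bounded_clinear (sqrt_iter A n)"
  by (induction n)
     (simp_all add: bounded_clinear_zero bounded_clinear_scale bounded_clinear_add
       bounded_clinear_compose[unfolded o_def])

text \<open>Stated for the whole commutant of A and not only for the iterates among themselves,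
  because any competing square root will be such a C.\<close>

lemma sqrt_iter_commute:
  assumes "bounded_clinear C" "\<And>x. C (A x) = A (C x)"
  shows "C (sqrt_iter A n x) = sqrt_iter A n (C x)"
  by (induction n arbitrary: x) (simp_all add: clinear_simps[OF assms(1)] assms(2))

lemma norm_sqrt_iter_le:
  assumes "\<And>x. norm (A x) \<le> norm x"
  shows "norm (sqrt_iter A n x) \<le> sqrt_iter_bound n * norm x"
proof (induction n arbitrary: x)
  case (Suc n)
  have "norm (sqrt_iter A n (sqrt_iter A n x)) \<le> sqrt_iter_bound n * (sqrt_iter_bound n * norm x)"
    using Suc[of "sqrt_iter A n x"] Suc[of x] sqrt_iter_bound_range[of n]
    by (meson mult_left_mono order_trans)
  then have "norm (A x + sqrt_iter A n (sqrt_iter A n x)) \<le> norm x + (sqrt_iter_bound n)\<^sup>2 * norm x"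
    using assms[of x] norm_triangle_ineq[of "A x"] by (simp add: power2_eq_square mult.assoc) (smt (verit))
  then show ?case by (simp add: norm_scaleC norm_divide algebra_simps)
qed simp

text \<open>Commuting iterates let the difference of squares factor as (Y' - Y)(Y' + Y), just as
  t'^2 - t^2 does for scalars, so the operator and scalar recursions match term by term.\<close>

lemma norm_sqrt_iter_Suc_diff:
  assumes A: "bounded_clinear A" "\<And>x. norm (A x) \<le> norm x"
  shows "norm (sqrt_iter A (Suc n) x - sqrt_iter A n x)
    \<le> (sqrt_iter_bound (Suc n) - sqrt_iter_bound n) * norm x"
proof (induction n arbitrary: x)
  case 0
  then show ?case using A(2) by (simp add: norm_scaleC norm_divide)
next
  case (Suc n)
  let ?Y = "sqrt_iter A n" and ?Y' = "sqrt_iter A (Suc n)"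
  let ?t = "sqrt_iter_bound n" and ?t' = "sqrt_iter_bound (Suc n)"
  have lin: "bounded_clinear ?Y" "bounded_clinear ?Y'"
    using bounded_clinear_sqrt_iter[OF A(1)] by blast+
  have "?Y (A x) = A (?Y x)" for x using sqrt_iter_commute[OF A(1)] by metis
  then have comm: "?Y (?Y' x) = ?Y' (?Y x)" for x by (rule sqrt_iter_commute[OF lin(1)])
  have "sqrt_iter A (Suc (Suc n)) x - ?Y' x = (1/2) *\<^sub>C (?Y' (?Y' x) - ?Y (?Y x))"
    by (simp flip: scaleC_diff_right)
  also have "?Y' (?Y' x) - ?Y (?Y x) = ?Y' (?Y' x + ?Y x) - ?Y (?Y' x + ?Y x)"
    using comm[of x] by (simp add: clinear_simps[OF lin(1)] clinear_simps[OF lin(2)]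
        del: sqrt_iter.simps)
  finally have "norm (sqrt_iter A (Suc (Suc n)) x - ?Y' x)
      = norm (?Y' (?Y' x + ?Y x) - ?Y (?Y' x + ?Y x)) / 2"
    by (simp add: norm_scaleC norm_divide del: sqrt_iter.simps)
  also have "\<dots> \<le> (?t' - ?t) * norm (?Y' x + ?Y x) / 2"
    by (intro divide_right_mono Suc) simp
  also have "\<dots> \<le> (?t' - ?t) * (?t' * norm x + ?t * norm x) / 2"
  proof (intro divide_right_mono mult_left_mono)
    show "norm (?Y' x + ?Y x) \<le> ?t' * norm x + ?t * norm x"
      using norm_sqrt_iter_le[of A, OF A(2)] norm_triangle_ineq by (meson add_mono order_trans)
    show "0 \<le> ?t' - ?t" using sqrt_iter_bound_mono[of n] by simp
  qed simp
  also have "\<dots> = (sqrt_iter_bound (Suc (Suc n)) - ?t') * norm x"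
    by (simp add: field_simps power2_eq_square)
  finally show ?case .
qed

text \<open>The commutant clause prepares uniqueness: a competing root commutes with A and must then
  commute with R.\<close>

lemma pos_sqrt_exists:
  assumes A: "bounded_clinear A" "\<And>x. norm (A x) \<le> norm x"
    and sa: "\<And>x y. cinner (A x) y = cinner x (A y)"
  shows "\<exists>R. pos_op R \<and> (\<forall>x. R (R x) = x - A x) \<and>
    (\<forall>C. bounded_clinear C \<longrightarrow> (\<forall>x. C (A x) = A (C x)) \<longrightarrow> (\<forall>x. C (R x) = R (C x)))"
proof -
  let ?Y = "sqrt_iter A" and ?t = sqrt_iter_bound
  note Ylin = bounded_clinear_sqrt_iter[OF A(1)]
  have Yle: "norm (?Y n x) \<le> norm x" for n x
    using norm_sqrt_iter_le[of A, OF A(2), of n x] sqrt_iter_bound_range[of n]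
    by (meson mult_left_le_one_le norm_ge_zero order_trans)
  have "incseq ?t" using sqrt_iter_bound_mono by (rule incseq_SucI)
  then have "convergent ?t"
    using sqrt_iter_bound_range by (metis Bseq_monoseq_convergent Bseq_eq_bounded incseq_bounded
        decseq_bounded monoseq_iff BseqI' real_norm_def abs_of_nonneg)
  then have Ct: "Cauchy ?t" by (rule convergent_Cauchy)
  have diff: "norm (?Y m x - ?Y n x) \<le> (?t m - ?t n) * norm x" if "n \<le> m" for n m x
    using that
  proof (induction m rule: dec_induct)
    case (step m)
    have "norm (?Y (Suc m) x - ?Y n x) \<le> norm (?Y (Suc m) x - ?Y m x) + norm (?Y m x - ?Y n x)"
      by (metis diff_add_cancel add_diff_eq norm_triangle_ineq)
    also have "\<dots> \<le> (?t (Suc m) - ?t m) * norm x + (?t m - ?t n) * norm x"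
      by (intro add_mono norm_sqrt_iter_Suc_diff A step)
    finally show ?case by (simp add: algebra_simps)
  qed simp
  have "Cauchy (\<lambda>n. ?Y n x)" for x
  proof (rule CauchyI)
    fix e :: real assume e: "0 < e"
    then have "0 < e / (norm x + 1)" by (simp add: add_nonneg_pos)
    then obtain M where M: "\<And>m n. m \<ge> M \<Longrightarrow> n \<ge> M \<Longrightarrow> norm (?t m - ?t n) < e / (norm x + 1)"
      using CauchyD[OF Ct] by blast
    have le: "norm (?Y m x - ?Y n x) < e" if "m \<ge> n" "n \<ge> M" for m n
    proof -
      have "norm (?Y m x - ?Y n x) \<le> (?t m - ?t n) * norm x" by (rule diff[OF that(1)])
      also have "\<dots> \<le> (e / (norm x + 1)) * norm x"
        using M[of m n] that by (intro mult_right_mono) auto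
      also have "\<dots> < e"
      proof -
        have "0 < norm x + 1" by (simp add: add_nonneg_pos)
        then show ?thesis using e by (simp add: pos_divide_less_eq)
      qed
      finally show ?thesis .
    qed
    then show "\<exists>M. \<forall>m\<ge>M. \<forall>n\<ge>M. norm (?Y m x - ?Y n x) < e"
      by (metis linorder_linear norm_minus_commute)
  qed
  then have "\<exists>l. (\<lambda>n. ?Y n x) \<longlonglongrightarrow> l" for x using Cauchy_convergent convergent_def by blast
  then obtain Z where Z: "\<And>x. (\<lambda>n. ?Y n x) \<longlonglongrightarrow> Z x" by metis
  have Zle: "norm (Z x) \<le> norm x" for x
    by (rule LIMSEQ_le_const2[OF tendsto_norm[OF Z]]) (use Yle in blast)
  have Zlin: "bounded_clinear Z"
    by (rule bounded_clinear_limit[OF Ylin _ Z, of 1]) (simp add: Yle)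
  have Ysa: "cinner (?Y n x) y = cinner x (?Y n y)" for n x y
    by (induction n arbitrary: x y)
       (simp_all add: cinner_scaleC_left cinner_scaleC_right cinner_add_left cinner_add_right sa)
  have Zsa: "cinner (Z x) y = cinner x (Z y)" for x y
    using tendsto_cinner[OF Z[of x] tendsto_const[of y]] tendsto_cinner[OF tendsto_const[of x] Z[of y]]
    by (simp add: Ysa LIMSEQ_unique)
  \<comment> \<open>Operator and argument both move with n; contractivity of all Y_n absorbs the
    error Y_n x - Z x.\<close>
  have "(\<lambda>n. ?Y n (?Y n x)) \<longlonglongrightarrow> Z (Z x)" for x
  proof -
    have "(\<lambda>n. ?Y n (?Y n x - Z x)) \<longlonglongrightarrow> 0"
    proof (rule Lim_null_comparison)
      show "(\<lambda>n. norm (?Y n x - Z x)) \<longlonglongrightarrow> 0"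
        using Z[of x] by (simp add: LIM_zero tendsto_norm_zero)
    qed (simp add: Yle)
    from tendsto_add[OF this Z[of "Z x"]] show ?thesis by (simp add: clinear_simps[OF Ylin])
  qed
  then have "(\<lambda>n. ?Y (Suc n) x) \<longlonglongrightarrow> (1/2) *\<^sub>C (A x + Z (Z x))" for x
    by (simp add: tendsto_scaleC tendsto_add)
  then have Zeq: "Z x = (1/2) *\<^sub>C (A x + Z (Z x))" for x
    using LIMSEQ_Suc[OF Z[of x]] LIMSEQ_unique by blast
  define R where "R x = x - Z x" for x
  have Rlin: "bounded_clinear R"
    unfolding R_def using bounded_clinear_diff[OF bounded_clinear_id Zlin] by simp
  have "pos_op R"
  proof (rule pos_opI[OF Rlin])
    show "cinner (R x) y = cinner x (R y)" for x y
      by (simp add: R_def cinner_diff_left cinner_diff_right Zsa)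
    show "0 \<le> Re (cinner (R x) x)" for x
    proof -
      have "Re (cinner (Z x) x) \<le> norm (Z x) * norm x"
        using cmod_cinner_le[of "Z x" x] complex_Re_le_cmod order_trans by blast
      also have "\<dots> \<le> norm x * norm x" by (intro mult_right_mono Zle) simp
      finally show ?thesis
        by (simp add: R_def cinner_diff_left cinner_self power2_eq_square)
    qed
  qed
  moreover have "R (R x) = x - A x" for x
  proof -
    \<comment> \<open>The fixed point equation 2 Z = A + Z^2 is (I - Z)^2 = I - A
      rearranged.\<close>
    have "2 *\<^sub>C Z x = A x + Z (Z x)" using arg_cong[OF Zeq[of x], of "\<lambda>z. 2 *\<^sub>C z"]
      by (simp add: scaleC_scaleC)
    moreover have "2 *\<^sub>C Z x = Z x + Z x" using scaleC_add_left[of 1 1 "Z x"] by simp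
    ultimately show ?thesis by (simp add: R_def clinear_simps[OF Zlin] algebra_simps)
  qed
  moreover have "C (R x) = R (C x)" if C: "bounded_clinear C" "\<And>x. C (A x) = A (C x)" for C x
  proof -
    have "(\<lambda>n. C (?Y n x)) \<longlonglongrightarrow> C (Z x)" by (rule bounded_clinear_tendsto[OF C(1) Z])
    moreover have "(\<lambda>n. C (?Y n x)) \<longlonglongrightarrow> Z (C x)"
      using Z[of "C x"] by (simp add: sqrt_iter_commute[of C A, OF C])
    ultimately have "C (Z x) = Z (C x)" by (rule LIMSEQ_unique)
    then show ?thesis by (simp add: R_def clinear_simps[OF C(1)])
  qed
  ultimately show ?thesis by blast
qed

text \<open>\<open>sqrt_op\<close> is a definite description, so uniqueness is required as well.
  Another positive root Q commutes with X and hence with R, so (R + Q)(R - Q) x = 0; positivity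
  makes both R and Q vanish on u = (R - Q) x, and |u|^2 = <x, (R - Q) u> = 0.\<close>

lemma sqrt_op_props:
  assumes X: "pos_op X" and le: "\<And>x. norm (x - X x) \<le> norm x"
  shows "pos_op (sqrt_op X)" "sqrt_op X (sqrt_op X x) = X x"
proof -
  define A where "A x = x - X x" for x
  have "bounded_clinear A"
    unfolding A_def using bounded_clinear_diff[OF bounded_clinear_id pos_op_bounded[OF X]] by simp
  moreover have "cinner (A x) y = cinner x (A y)" for x y
    by (simp add: A_def cinner_diff_left cinner_diff_right pos_op_selfadjoint[OF X])
  ultimately obtain R where R: "pos_op R" "\<And>x. R (R x) = x - A x"
    and comm: "\<And>C x. bounded_clinear C \<Longrightarrow> (\<And>x. C (A x) = A (C x)) \<Longrightarrow> C (R x) = R (C x)"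
    using pos_sqrt_exists[of A] le by (auto simp: A_def)
  have RX: "R (R x) = X x" for x using R(2) by (simp add: A_def)
  have "Q = R" if Q: "pos_op Q \<and> Q \<circ> Q = X" for Q
  proof
    fix x
    have QX: "Q (Q x) = X x" for x using Q by (metis comp_apply)
    have Qlin: "bounded_clinear Q" and Rlin: "bounded_clinear R"
      using Q R pos_op_bounded by blast+
    note simps = clinear_simps[OF Qlin] clinear_simps[OF Rlin]
    have "Q (A x) = A (Q x)" for x by (simp add: A_def simps flip: QX)
    then have QR: "Q (R x) = R (Q x)" for x using comm[OF Qlin] by blast
    define u where "u = R x - Q x"
    have "R u + Q u = 0" by (simp add: u_def simps QR RX QX)
    then have sum0: "cinner (R u) u + cinner (Q u) u = 0" by (simp flip: cinner_add_left)
    have "Re (cinner (R u) u) = 0" "Re (cinner (Q u) u) = 0"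
      using arg_cong[OF sum0, of Re] pos_op_Re[OF R(1), of u] pos_op_Re[of Q u] Q by auto
    then have "cinner (R u) u = 0" "cinner (Q u) u = 0"
      using pos_op_Im[OF R(1), of u] pos_op_Im[of Q u] Q by (auto intro: complex_eqI)
    then have "R u = 0" "Q u = 0" using pos_op_eq_0 R(1) Q by blast+
    moreover have "cinner u u = cinner (R x) u - cinner (Q x) u"
      by (simp add: u_def cinner_diff_left)
    then have "cinner u u = cinner x (R u) - cinner x (Q u)"
      using pos_op_selfadjoint[OF R(1), of x u] pos_op_selfadjoint[of Q x u] Q by simp
    ultimately have "u = 0" by simp
    then show "Q x = R x" by (simp add: u_def)
  qed
  then have "sqrt_op X = R"
    unfolding sqrt_op_def using R(1) RX by (intro the_equality) (auto simp: fun_eq_iff)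
  then show "pos_op (sqrt_op X)" "sqrt_op X (sqrt_op X x) = X x" using R(1) RX by simp_all
qed

section \<open>Coordinates and ampliations\<close>

lemma Abs_l2_inverse': "(\<lambda>i. (norm (f i))\<^sup>2) summable_on UNIV \<Longrightarrow> Rep_l2 (Abs_l2 f) = f"
  by (simp add: Abs_l2_inverse)

lemma l2_eqI: "(\<And>i. Rep_l2 f i = Rep_l2 g i) \<Longrightarrow> f = g"
  by (simp add: Rep_l2_inject[symmetric] fun_eq_iff)

lemma Rep_l2_summable: "(\<lambda>i. (norm (Rep_l2 f i))\<^sup>2) summable_on UNIV"
  using Rep_l2[of f] by simp

lemma norm_l2_eq: "(norm f)\<^sup>2 = (\<Sum>\<^sub>\<infinity>i. (norm (Rep_l2 f i))\<^sup>2)" for f :: "('i, 'h::complex_hilbert) l2"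
  by (simp add: power2_norm_eq_inner inner_l2_def)

lemmas rep_l2_simps [simp] = zero_l2.rep_eq plus_l2.rep_eq minus_l2.rep_eq scaleC_l2.rep_eq

lemma Rep_l2_sum: "Rep_l2 (sum f S) i = (\<Sum>j\<in>S. Rep_l2 (f j) i)"
  by (induction S rule: infinite_finite_induct) simp_all

lemma bounded_clinear_Rep_l2: "bounded_clinear (\<lambda>f. Rep_l2 f i)"
  by (rule bounded_clinearI[of _ 1]) (simp_all add: norm_l2_component_le)

lemma infsum_single:
  fixes f :: "'i \<Rightarrow> 'a::{comm_monoid_add,t2_space}"
  assumes "\<And>j. j \<noteq> i \<Longrightarrow> f j = 0"
  shows "(\<Sum>\<^sub>\<infinity>j. f j) = f i"
proof -
  have "(\<Sum>\<^sub>\<infinity>j. f j) = (\<Sum>\<^sub>\<infinity>j\<in>{i}. f j)"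
    by (rule infsum_cong_neutral) (use assms in auto)
  then show ?thesis by simp
qed

lift_definition l2_basis :: "'i \<Rightarrow> ('i, complex) l2" is "\<lambda>i j. if j = i then 1 else 0"
proof -
  fix i :: 'i
  have "(\<lambda>j. (norm (if j = i then 1 else 0 :: complex))\<^sup>2) summable_on {i}" by simp
  then show "(\<lambda>j. (norm (if j = i then 1 else 0 :: complex))\<^sup>2) summable_on UNIV"
    by (rule summable_on_cong_neutral[THEN iffD1, rotated -1]) auto
qed

lemma cinner_l2_basis: "cinner f (l2_basis i) = Rep_l2 f i"
  unfolding cinner_l2_def
  by (subst infsum_single[of i]) (auto simp: l2_basis.rep_eq cinner_complex_def)

lemma cinner_l2_basis': "cinner (l2_basis i) f = cnj (Rep_l2 f i)"
  by (metis cinner_commute cinner_l2_basis)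

lemma norm_l2_basis [simp]: "norm (l2_basis i) = 1"
proof -
  have "(norm (l2_basis i))\<^sup>2 = 1"
    unfolding norm_l2_eq by (subst infsum_single[of i]) (auto simp: l2_basis.rep_eq)
  then show ?thesis using norm_ge_zero[of "l2_basis i"] by (simp add: power2_eq_1_iff)
qed

lemma closed_cspan_l2_basis: "closed_cspan (range l2_basis) = UNIV"
proof (rule closed_cspan_eq_UNIV)
  fix x :: "('a, complex) l2"
  assume "\<And>s. s \<in> range l2_basis \<Longrightarrow> cinner x s = 0"
  then have "Rep_l2 x i = 0" for i by (metis cinner_l2_basis rangeI)
  then show "x = 0" by (intro l2_eqI) simp
qed

text \<open>A vector depending on its predecessors yields e n = 0, through \<open>sgn\<close>,
  instead of being skipped. The indices of e and xs stay aligned, which the triangular shape in the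
  last clause relies on.\<close>

lemma gram_schmidt:
  fixes xs :: "nat \<Rightarrow> 'a::complex_hilbert"
  shows "\<exists>e. (\<forall>n. norm (e n) = 1 \<or> e n = 0) \<and> (\<forall>m n. m \<noteq> n \<longrightarrow> cinner (e m) (e n) = 0) \<and>
    range xs \<subseteq> closed_cspan (range e) \<and> (\<forall>a n. a < n \<longrightarrow> cinner (xs a) (e n) = 0)"
proof -
  define S where "S n = closed_cspan (xs ` {..<n})" for n
  define r where "r n = xs n - proj (S n) (xs n)" for n
  define e where "e n = sgn (r n)" for n
  have S: "closed_csubspace (S n)" "csubspace (S n)" for n
    by (simp_all add: S_def closed_csubspaceD)
  have xS: "xs a \<in> S n" if "a < n" for a n
    unfolding S_def using that by (intro closed_cspan_base) auto
  have mono: "S m \<subseteq> S n" if "m \<le> n" for m n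
    unfolding S_def by (rule closed_cspan_mono) (use that in auto)
  have e_orth: "e n \<in> orth_compl (S n)" for n
    unfolding e_def sgn_div_norm r_def
    by (rule csubspace_scaleR[OF _ proj_orth[OF S(1)]]) (simp add: closed_csubspaceD)
  have e_in: "e n \<in> S (Suc n)" for n
    unfolding e_def sgn_div_norm r_def
    using xS[of n "Suc n"] mono[of n "Suc n"] proj_in[OF S(1)[of n], of "xs n"] S(2)[of "Suc n"]
    by (intro csubspace_scaleR csubspace_diff) auto
  have less: "cinner (e m) (e n) = 0 \<and> cinner (e n) (e m) = 0" if "m < n" for m n
    using cinner_orth[OF e_orth[of n]] e_in[of m] mono[of "Suc m" n] that by (auto simp: Suc_le_eq)
  have span: "xs n \<in> closed_cspan (range e)" for n
  proof (induction n rule: less_induct)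
    case (less n)
    have cs: "csubspace (closed_cspan (range e))" by (simp add: closed_csubspaceD)
    have "S n \<subseteq> closed_cspan (range e)"
      unfolding S_def by (rule closed_cspan_minimal) (use less in auto)
    then have "proj (S n) (xs n) \<in> closed_cspan (range e)" using proj_in[OF S(1)] by blast
    moreover have "norm (r n) *\<^sub>R e n \<in> closed_cspan (range e)"
      by (intro csubspace_scaleR[OF cs] closed_cspan_base) simp
    ultimately have "norm (r n) *\<^sub>R e n + proj (S n) (xs n) \<in> closed_cspan (range e)"
      by (rule csubspace_add[OF cs, rotated])
    moreover have "norm (r n) *\<^sub>R e n = r n"
      by (cases "r n = 0") (simp_all add: e_def sgn_div_norm)
    ultimately show ?case by (simp add: r_def)
  qed
  show ?thesis
  proof (intro exI[of _ e] conjI allI impI)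
    show "norm (e n) = 1 \<or> e n = 0" for n by (simp add: e_def norm_sgn sgn_zero_iff)
    show "cinner (e m) (e n) = 0" if "m \<noteq> n" for m n
      using less[of m n] less[of n m] that by (cases "m < n") auto
    show "range xs \<subseteq> closed_cspan (range e)" using span by blast
    show "cinner (xs a) (e n) = 0" if "a < n" for a n
      using cinner_orth(2)[OF e_orth xS[OF that]] .
  qed
qed

text \<open>
  The coordinates are triangular: the \<open>a\<close>-th vector only has coordinates up to \<open>a\<close>. Hence
  coordinatewise convergence of such vectors is convergence in norm.
\<close>

lemma triangular_coordinates:
  fixes xs :: "nat \<Rightarrow> 'a::complex_hilbert"
  shows "\<exists>U :: 'a \<Rightarrow> (nat, complex) l2. bounded_clinear U \<and> (\<forall>x. norm (U x) \<le> norm x) \<and>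
    (\<forall>x\<in>closed_cspan (range xs). \<forall>y. cinner (U x) (U y) = cinner x y) \<and>
    (\<forall>a n. a < n \<longrightarrow> Rep_l2 (U (xs a)) n = 0)"
proof -
  obtain e where e1: "\<And>n. norm (e n) = 1 \<or> e n = 0"
    and orth: "\<And>m n. m \<noteq> n \<Longrightarrow> cinner (e m) (e n) = 0"
    and span: "range xs \<subseteq> closed_cspan (range e)"
    and tri: "\<And>a n. a < n \<Longrightarrow> cinner (xs a) (e n) = 0"
    using gram_schmidt[of xs] by blast
  have ee: "cinner (e n) (e n) * c = c" if "e n = 0 \<Longrightarrow> c = 0" for n c
    using e1[of n] that by (auto simp: cinner_self)
  have bessel: "(\<Sum>n\<in>F. (cmod (cinner x (e n)))\<^sup>2) \<le> (norm x)\<^sup>2" if F: "finite F" for F x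
  proof -
    define z where "z = (\<Sum>n\<in>F. cinner x (e n) *\<^sub>C e n)"
    define s where "s = (\<Sum>n\<in>F. (cmod (cinner x (e n)))\<^sup>2)"
    have s: "complex_of_real s = (\<Sum>n\<in>F. cinner x (e n) * cnj (cinner x (e n)))"
      unfolding s_def of_real_sum complex_norm_square ..
    have xz: "cinner x z = s"
      by (simp add: z_def s cinner_sum_right cinner_scaleC_right mult.commute)
    have ez: "cinner (e n) z = cnj (cinner x (e n))" if "n \<in> F" for n
    proof -
      have "cinner (e n) z = (\<Sum>m\<in>F. if m = n then cnj (cinner x (e m)) else 0)"
        unfolding z_def cinner_sum_right cinner_scaleC_right
        by (intro sum.cong refl) (use ee orth in \<open>auto simp: mult.commute\<close>)
      then show ?thesis using that F by simp
    qed
    have zz: "cinner z z = s"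
      by (subst (1) z_def) (simp add: cinner_sum_left cinner_scaleC_left ez s)
    have "cinner (x - z) (x - z) = cinner x x - s"
      using xz zz cinner_commute[of z x] by (simp add: cinner_diff_left cinner_diff_right)
    then have "complex_of_real ((norm (x - z))\<^sup>2) = complex_of_real ((norm x)\<^sup>2 - s)"
      by (simp add: cinner_self)
    then have "(norm (x - z))\<^sup>2 = (norm x)\<^sup>2 - s" using of_real_eq_iff by blast
    then show ?thesis using zero_le_power2[of "norm (x - z)"] by (simp add: s_def)
  qed
  define U :: "'a \<Rightarrow> (nat, complex) l2" where "U x = Abs_l2 (\<lambda>n. cinner x (e n))" for x
  have summ: "(\<lambda>n. (norm (cinner x (e n)))\<^sup>2) summable_on UNIV" for x
    by (rule nonneg_bdd_above_summable_on) (use bessel in \<open>auto simp: bdd_above_def\<close>)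
  have Rep: "Rep_l2 (U x) n = cinner x (e n)" for x n
    using Abs_l2_inverse'[OF summ[of x]] by (simp add: U_def)
  have le: "norm (U x) \<le> norm x" for x
  proof -
    have "(norm (U x))\<^sup>2 \<le> (norm x)\<^sup>2"
      unfolding norm_l2_eq Rep by (rule infsum_le_finite_sums[OF summ]) (use bessel in auto)
    then show ?thesis by (simp add: power2_le_iff_abs_le)
  qed
  have lin: "bounded_clinear U"
  proof (rule bounded_clinearI[of _ 1])
    show "U (x + y) = U x + U y" for x y
      by (rule l2_eqI) (simp add: Rep cinner_add_left)
    show "U (c *\<^sub>C x) = c *\<^sub>C U x" for c x
      by (rule l2_eqI) (simp add: Rep cinner_scaleC_left scaleC_complex_def)
  qed (simp add: le)
  \<comment> \<open>Parseval on the orthonormal system; linearity and continuity in the first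
    argument extend it to the closed span, with y arbitrary.\<close>
  have iso_e: "cinner (U (e n)) (U y) = cinner (e n) y" for n y
  proof -
    have "cinner (U (e n)) (U y) = cinner (e n) (e n) * cnj (cinner y (e n))"
      unfolding cinner_l2_def Rep
      by (subst infsum_single[of n]) (auto simp: cinner_complex_def orth)
    also have "\<dots> = cnj (cinner y (e n))" by (rule ee) simp
    finally show ?thesis by (simp flip: cinner_commute)
  qed
  have "cinner (U x) (U y) = cinner x y" if "x \<in> closed_cspan (range xs)" for x y
  proof (rule bounded_clinear_eq_on_cspan[where S = "range e" and Y = "\<lambda>x. cinner x y"])
    show "bounded_clinear (\<lambda>x. cinner (U x) (U y))"
      using bounded_clinear_compose[OF bounded_clinear_cinner_left lin] by (simp add: o_def)
    show "x \<in> closed_cspan (range e)"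
      using closed_cspan_minimal[OF span] that by auto
  qed (auto simp: iso_e bounded_clinear_cinner_left)
  then show ?thesis using lin le tri by (intro exI[of _ U]) (simp add: Rep)
qed

lemma separable_dense_sequence:
  assumes "separable_space (euclidean :: 'h::complex_hilbert topology)"
  shows "\<exists>d :: nat \<Rightarrow> 'h. closure (range d) = UNIV"
proof -
  obtain C :: "'h set" where C: "countable C" "closure C = UNIV"
    using assms by (auto simp: separable_space_def)
  then have "C \<noteq> {}" by auto
  then have "range (from_nat_into C) = C" using C by (simp add: range_from_nat_into)
  then show ?thesis using C by metis
qed

lemma closure_subset_closed_cspan: "closure S \<subseteq> closed_cspan S"
  by (rule closure_minimal) (use closed_cspan_superset in \<open>auto simp: closed_cspan_def\<close>)

text \<open>Turns H into a space of sequences, so that a Fock vector with values in H becomes a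
  sequence of scalar Fock vectors.\<close>

lemma separable_isometry:
  assumes "separable_space (euclidean :: 'h::complex_hilbert topology)"
  shows "\<exists>G :: 'h \<Rightarrow> (nat, complex) l2. bounded_clinear G \<and> (\<forall>x y. cinner (G x) (G y) = cinner x y)"
proof -
  obtain d :: "nat \<Rightarrow> 'h" where "closure (range d) = UNIV"
    using separable_dense_sequence[OF assms] by blast
  then have "closed_cspan (range d) = UNIV" using closure_subset_closed_cspan by blast
  then show ?thesis using triangular_coordinates[of d] by auto
qed

text \<open>The ampliation X tensor I of infinite multiplicity, as the direct sum of countably many
  copies of X.\<close>

definition amp :: "('a \<Rightarrow> 'a) \<Rightarrow> (nat, 'a::complex_hilbert) l2 \<Rightarrow> (nat, 'a) l2"
  where "amp X f = Abs_l2 (\<lambda>k. X (Rep_l2 f k))"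

context
  fixes X :: "'a::complex_hilbert \<Rightarrow> 'a"
  assumes X: "bounded_clinear X"
begin

lemma amp_summable: "(\<lambda>k. (norm (X (Rep_l2 f k)))\<^sup>2) summable_on UNIV"
proof (rule summable_on_comparison_test)
  show "(\<lambda>k. (onorm X)\<^sup>2 * (norm (Rep_l2 f k))\<^sup>2) summable_on UNIV"
    by (intro summable_on_cmult_right Rep_l2_summable)
  show "(norm (X (Rep_l2 f k)))\<^sup>2 \<le> (onorm X)\<^sup>2 * (norm (Rep_l2 f k))\<^sup>2" for k
    using power_mono[OF bounded_clinear_onorm[OF X, of "Rep_l2 f k"], of 2]
    by (simp add: power_mult_distrib)
qed simp

lemma Rep_amp [simp]: "Rep_l2 (amp X f) k = X (Rep_l2 f k)"
  using Abs_l2_inverse'[OF amp_summable[of f]] by (simp add: amp_def)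

text \<open>The bound is asked for only on the coordinates of f, because a compact operator is small
  on vectors supported far out but not in norm.\<close>

lemma norm_amp_le_on:
  assumes "\<And>k. norm (X (Rep_l2 f k)) \<le> C * norm (Rep_l2 f k)" and "0 \<le> C"
  shows "norm (amp X f) \<le> C * norm f"
proof -
  have "(norm (amp X f))\<^sup>2 \<le> (\<Sum>\<^sub>\<infinity>k. C\<^sup>2 * (norm (Rep_l2 f k))\<^sup>2)"
    unfolding norm_l2_eq Rep_amp
  proof (rule infsum_mono)
    show "(norm (X (Rep_l2 f k)))\<^sup>2 \<le> C\<^sup>2 * (norm (Rep_l2 f k))\<^sup>2" for k
      using power_mono[OF assms(1)[of k], of 2] by (simp add: power_mult_distrib)
  qed (intro amp_summable summable_on_cmult_right Rep_l2_summable)+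
  also have "\<dots> = (C * norm f)\<^sup>2"
    by (simp add: infsum_cmult_right' norm_l2_eq power_mult_distrib)
  finally show ?thesis using assms(2) by (simp add: power2_le_iff_abs_le)
qed

lemma norm_amp_le: "norm (amp X f) \<le> onorm X * norm f"
  by (rule norm_amp_le_on) (simp_all add: bounded_clinear_onorm[OF X] clinear_onorm_nonneg[OF X])

lemma bounded_clinear_amp: "bounded_clinear (amp X)"
  by (rule bounded_clinearI[of _ "onorm X"])
     (auto intro!: l2_eqI simp: clinear_simps[OF X] norm_amp_le)

lemma amp_tensor: "amp X (a \<otimes>\<^sub>v f) = a \<otimes>\<^sub>v X f"
  by (rule l2_eqI) (simp add: tensor.rep_eq clinear_simps[OF X])

end

lemma amp_compose:
  "bounded_clinear X \<Longrightarrow> bounded_clinear Y \<Longrightarrow> amp (X \<circ> Y) f = amp X (amp Y f)"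
  by (rule l2_eqI) (simp add: bounded_clinear_compose)

lemma amp_add:
  "bounded_clinear X \<Longrightarrow> bounded_clinear Y \<Longrightarrow> amp (\<lambda>x. X x + Y x) f = amp X f + amp Y f"
  by (rule l2_eqI) (simp add: bounded_clinear_add)

lemma amp_diff:
  "bounded_clinear X \<Longrightarrow> bounded_clinear Y \<Longrightarrow> amp (\<lambda>x. X x - Y x) f = amp X f - amp Y f"
  by (rule l2_eqI) (simp add: bounded_clinear_diff)

lemma amp_scale: "bounded_clinear X \<Longrightarrow> amp (\<lambda>x. c *\<^sub>C X x) f = c *\<^sub>C amp X f"
  by (rule l2_eqI) (simp add: bounded_clinear_scale)

lemma cinner_amp:
  assumes X: "bounded_clinear X"
  shows "cinner (amp X f) g = cinner f (amp (cadjoint X) g)"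
  unfolding cinner_l2_def Rep_amp[OF X] Rep_amp[OF bounded_clinear_cadjoint[OF X]]
  by (simp add: cinner_cadjoint[OF X])

section \<open>Operators on a subspace and generated C*-algebras\<close>

lemma bops_bounded: "X \<in> bops M \<Longrightarrow> bounded_clinear X"
  and bops_range: "X \<in> bops M \<Longrightarrow> X x \<in> M"
  and bops_orth: "X \<in> bops M \<Longrightarrow> x \<in> orth_compl M \<Longrightarrow> X x = 0"
  by (auto simp: bops_def)

lemma bopsI:
  assumes "bounded_clinear X" "\<And>x. X x \<in> M" "\<And>x. x \<in> orth_compl M \<Longrightarrow> X x = 0"
  shows "X \<in> bops M"
  using assms by (auto simp: bops_def)

lemma bops_UNIV: "bops UNIV = Collect bounded_clinear"
proof -
  have 0: "x \<in> orth_compl UNIV \<Longrightarrow> x = 0" for x :: 'a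
    using cinner_self_eq_0[of x] by (auto simp: orth_compl_def)
  then have "X x = 0" if "bounded_clinear X" "x \<in> orth_compl UNIV" for X :: "'a \<Rightarrow> 'a" and x
    using 0[OF that(2)] clinear_simps(4)[OF that(1)] by simp
  then show ?thesis by (auto simp: bops_def)
qed

context
  fixes M :: "'a::complex_hilbert set"
  assumes M: "closed_csubspace M"
begin

lemma bops_add: "X \<in> bops M \<Longrightarrow> Y \<in> bops M \<Longrightarrow> (\<lambda>x. X x + Y x) \<in> bops M"
  using M by (auto intro!: bopsI simp: bops_bounded bops_range bops_orth bounded_clinear_add
      csubspace_add closed_csubspaceD)

lemma bops_scale: "X \<in> bops M \<Longrightarrow> (\<lambda>x. c *\<^sub>C X x) \<in> bops M"
  using M by (auto intro!: bopsI simp: bops_bounded bops_range bops_orth bounded_clinear_scale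
      csubspace_scaleC closed_csubspaceD)

lemma bops_compose: "X \<in> bops M \<Longrightarrow> Y \<in> bops M \<Longrightarrow> X \<circ> Y \<in> bops M"
  by (auto intro!: bopsI bounded_clinear_compose
      simp: bops_bounded bops_range bops_orth clinear_simps)

lemma bops_cadjoint:
  assumes X: "X \<in> bops M"
  shows "cadjoint X \<in> bops M"
proof (rule bopsI)
  note bX = bops_bounded[OF X]
  show "bounded_clinear (cadjoint X)" by (rule bounded_clinear_cadjoint[OF bX])
  show "cadjoint X x \<in> M" for x
  proof -
    have "cadjoint X x \<in> orth_compl (orth_compl M)"
      by (auto simp: orth_compl_def[of "orth_compl M"] cinner_cadjoint'[OF bX] bops_orth[OF X])
    then show ?thesis by (simp add: orth_compl_orth_compl[OF M])
  qed
  show "cadjoint X x = 0" if "x \<in> orth_compl M" for x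
    by (rule cinner_ext)
       (simp add: cinner_orth(2)[OF that bops_range[OF X]] flip: cinner_cadjoint[OF bX])
qed

lemma bops_proj: "proj M \<in> bops M"
  by (rule bopsI) (simp_all add: M bounded_clinear_proj proj_in proj_orth_zero)

lemma compression_bops: "bounded_clinear X \<Longrightarrow> proj M \<circ> X \<circ> proj M \<in> bops M"
  by (rule bopsI)
     (simp_all add: bounded_clinear_compose bounded_clinear_proj M proj_in proj_orth_zero
       clinear_simps(4))

lemma bops_proj_left: "X \<in> bops M \<Longrightarrow> proj M \<circ> X = X"
  by (auto simp: fun_eq_iff proj_id[OF M] bops_range)

lemma bops_proj_apply:
  assumes X: "X \<in> bops M"
  shows "X (proj M x) = X x"
  using bops_orth[OF X proj_orth[OF M, of x]] by (simp add: clinear_simps[OF bops_bounded[OF X]])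

lemma bops_proj_right: "X \<in> bops M \<Longrightarrow> X \<circ> proj M = X"
  by (auto simp: fun_eq_iff bops_proj_apply)

text \<open>Extension by zero fixes the values on the complement, so equality in B(M) can be tested
  on any set spanning M.\<close>

lemma bops_eqI:
  assumes X: "X \<in> bops M" and Y: "Y \<in> bops M" and S: "closed_cspan S = M"
    and eq: "\<And>x. x \<in> S \<Longrightarrow> X x = Y x"
  shows "X = Y"
proof
  fix x
  have "X (proj M x) = Y (proj M x)"
    by (rule bounded_clinear_eq_on_cspan[where S = S])
       (use X Y eq S proj_in[OF M] in \<open>auto simp: bops_bounded\<close>)
  then show "X x = Y x" by (simp add: bops_proj_apply X Y)
qed

end

text \<open>Norm-closed linear subspaces of B(M): \<open>cstar_subalgebra\<close> without unit,
  products and adjoints, hence easy targets for an induction.\<close>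

definition closed_op_space :: "'a::complex_hilbert set \<Rightarrow> ('a \<Rightarrow> 'a) set \<Rightarrow> bool"
  where "closed_op_space M S \<longleftrightarrow> S \<subseteq> bops M \<and>
    (\<forall>X\<in>S. \<forall>Y\<in>S. (\<lambda>x. X x + Y x) \<in> S) \<and> (\<forall>c. \<forall>X\<in>S. (\<lambda>x. c *\<^sub>C X x) \<in> S) \<and>
    (\<forall>X\<in>bops M. (\<forall>e>0. \<exists>Y\<in>S. onorm (\<lambda>x. X x - Y x) < e) \<longrightarrow> X \<in> S)"

text \<open>Linear norm-closed conditions pull back along bounded maps. The scalar c' may differ
  from c, so that the conjugate-linear adjoint is covered together with left and right
  multiplication.\<close>

lemma closed_op_space_vimage:
  assumes M: "closed_csubspace M" and H: "closed_op_space M H"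
    and \<Phi>: "\<And>X. X \<in> bops M \<Longrightarrow> \<Phi> X \<in> bops M"
    and add: "\<And>X Y. X \<in> bops M \<Longrightarrow> Y \<in> bops M \<Longrightarrow> \<Phi> (\<lambda>x. X x + Y x) = (\<lambda>x. \<Phi> X x + \<Phi> Y x)"
    and scale: "\<And>c. \<exists>c'. \<forall>X\<in>bops M. \<Phi> (\<lambda>x. c *\<^sub>C X x) = (\<lambda>x. c' *\<^sub>C \<Phi> X x)"
    and bdd: "\<And>X Y. X \<in> bops M \<Longrightarrow> Y \<in> bops M \<Longrightarrow>
      onorm (\<lambda>x. \<Phi> X x - \<Phi> Y x) \<le> C * onorm (\<lambda>x. X x - Y x)"
  shows "closed_op_space M {X \<in> bops M. \<Phi> X \<in> H}"
  unfolding closed_op_space_def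
proof (intro conjI ballI allI impI)
  fix X Y assume "X \<in> {X \<in> bops M. \<Phi> X \<in> H}" "Y \<in> {X \<in> bops M. \<Phi> X \<in> H}"
  then show "(\<lambda>x. X x + Y x) \<in> {X \<in> bops M. \<Phi> X \<in> H}"
    using H by (auto simp: add bops_add[OF M] closed_op_space_def)
next
  fix c X assume X: "X \<in> {X \<in> bops M. \<Phi> X \<in> H}"
  obtain c' where "\<And>X. X \<in> bops M \<Longrightarrow> \<Phi> (\<lambda>x. c *\<^sub>C X x) = (\<lambda>x. c' *\<^sub>C \<Phi> X x)"
    using scale by blast
  then show "(\<lambda>x. c *\<^sub>C X x) \<in> {X \<in> bops M. \<Phi> X \<in> H}"
    using H X by (auto simp: bops_scale[OF M] closed_op_space_def)
next
  fix X assume X: "X \<in> bops M"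
    and lim: "\<forall>e>0. \<exists>Y\<in>{X \<in> bops M. \<Phi> X \<in> H}. onorm (\<lambda>x. X x - Y x) < e"
  have "\<exists>Z\<in>H. onorm (\<lambda>x. \<Phi> X x - Z x) < e" if e: "0 < e" for e
  proof -
    have "0 < e / (\<bar>C\<bar> + 1)" using e by (simp add: add_nonneg_pos)
    then obtain Y where Y: "Y \<in> bops M" "\<Phi> Y \<in> H" "onorm (\<lambda>x. X x - Y x) < e / (\<bar>C\<bar> + 1)"
      using lim by blast
    have nn: "0 \<le> onorm (\<lambda>x. X x - Y x)"
      by (intro clinear_onorm_nonneg bounded_clinear_diff) (use X Y bops_bounded in auto)
    have "onorm (\<lambda>x. \<Phi> X x - \<Phi> Y x) \<le> C * onorm (\<lambda>x. X x - Y x)" by (rule bdd[OF X Y(1)])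
    also have "\<dots> \<le> (\<bar>C\<bar> + 1) * onorm (\<lambda>x. X x - Y x)" using nn by (intro mult_right_mono) auto
    also have "\<dots> < e" using Y(3) by (simp add: pos_less_divide_eq mult.commute add_nonneg_pos)
    finally show ?thesis using Y(2) by blast
  qed
  then have "\<Phi> X \<in> H" using H \<Phi>[OF X] unfolding closed_op_space_def by blast
  then show "X \<in> {X \<in> bops M. \<Phi> X \<in> H}" using X by simp
qed auto

lemma onorm_cadjoint_le:
  assumes "bounded_clinear X"
  shows "onorm (cadjoint X) \<le> onorm X"
  by (rule onorm_bound)
     (simp_all add: assms clinear_onorm_nonneg norm_cadjoint_le bounded_clinear_onorm)

text \<open>The flag marks the adjoint. The empty word is \<open>proj M\<close>, the unit of B(M),
  since \<open>id\<close> would not vanish on the complement of M.\<close>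

fun star_word :: "'a::complex_hilbert set \<Rightarrow> ('n \<Rightarrow> 'a \<Rightarrow> 'a) \<Rightarrow> ('n \<times> bool) list \<Rightarrow> 'a \<Rightarrow> 'a"
  where
    "star_word M B [] = proj M"
  | "star_word M B ((i, s) # w) = (if s then cadjoint (B i) else B i) \<circ> star_word M B w"

locale operator_family =
  fixes M :: "'a::complex_hilbert set" and B :: "'n \<Rightarrow> 'a \<Rightarrow> 'a"
  assumes M: "closed_csubspace M" and B: "\<And>i. B i \<in> bops M"
begin

abbreviation "W \<equiv> star_word M B"
abbreviation "A \<equiv> cstar_generated M (range B)"

lemma letter_bops: "(if s then cadjoint (B i) else B i) \<in> bops M"
  by (simp add: B bops_cadjoint[OF M])

lemma word_Cons: "W ((i, s) # w) = (if s then cadjoint (B i) else B i) \<circ> W w"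
  by simp

lemma word_bops: "W w \<in> bops M"
proof (induction w)
  case (Cons l w)
  then show ?case
    by (cases l) (simp only: word_Cons bops_compose[OF M] letter_bops)
qed (simp add: bops_proj[OF M])

lemma word_append: "W (u @ v) = W u \<circ> W v"
proof (induction u)
  case (Cons l u)
  then show ?case by (cases l) (simp only: word_Cons append_Cons comp_assoc)
qed (simp add: bops_proj_left[OF M word_bops])

lemma word_adjoint: "cadjoint (W w) = W (rev (map (\<lambda>(i, s). (i, \<not> s)) w))"
proof (induction w)
  case (Cons l w)
  obtain i s where l: "l = (i, s)" by fastforce
  let ?L = "if s then cadjoint (B i) else B i"
  have "cadjoint (W (l # w)) = cadjoint (W w) \<circ> cadjoint ?L"
    by (simp only: l word_Cons cadjoint_compose[OF bops_bounded[OF letter_bops] bops_bounded[OF word_bops]])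
  also have "cadjoint ?L = W [(i, \<not> s)]"
    by (simp add: cadjoint_cadjoint bops_bounded[OF B] bops_proj_right[OF M] B bops_cadjoint[OF M])
  finally show ?case using Cons by (simp add: l word_append del: star_word.simps)
qed (simp add: cadjoint_proj[OF M])

lemma cstar_bops: "cstar_subalgebra M (bops M)"
  by (auto simp: cstar_subalgebra_def subalgebra_def M bops_add bops_scale bops_compose bops_proj
      bops_cadjoint)

lemma cstar_A: "cstar_subalgebra M A"
proof -
  have "A \<subseteq> bops M" unfolding cstar_generated_def using cstar_bops B by auto
  then show ?thesis
    unfolding cstar_subalgebra_def[of M A] subalgebra_def
  proof (intro conjI ballI allI impI)
    fix X assume X: "X \<in> bops M" "\<forall>e>0. \<exists>Y\<in>A. onorm (\<lambda>x. X x - Y x) < e"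
    show "X \<in> A" unfolding cstar_generated_def
    proof (intro InterI)
      fix A' assume A': "A' \<in> {A. cstar_subalgebra M A \<and> range B \<subseteq> A}"
      then have "A \<subseteq> A'" unfolding cstar_generated_def by blast
      then have "\<forall>e>0. \<exists>Y\<in>A'. onorm (\<lambda>x. X x - Y x) < e" using X(2) by blast
      then show "X \<in> A'" using A' X(1) by (auto simp: cstar_subalgebra_def)
    qed
  qed (auto simp: cstar_generated_def cstar_subalgebra_def subalgebra_def)
qed

lemma A_bops: "X \<in> A \<Longrightarrow> X \<in> bops M"
  and A_bounded: "X \<in> A \<Longrightarrow> bounded_clinear X"
  and A_add: "X \<in> A \<Longrightarrow> Y \<in> A \<Longrightarrow> (\<lambda>x. X x + Y x) \<in> A"
  and A_scale: "X \<in> A \<Longrightarrow> (\<lambda>x. c *\<^sub>C X x) \<in> A"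
  and A_compose: "X \<in> A \<Longrightarrow> Y \<in> A \<Longrightarrow> X \<circ> Y \<in> A"
  and A_adjoint: "X \<in> A \<Longrightarrow> cadjoint X \<in> A"
  and A_proj: "proj M \<in> A"
  using cstar_A by (auto simp: cstar_subalgebra_def subalgebra_def intro: bops_bounded)

lemma B_in_A: "B i \<in> A"
  by (auto simp: cstar_generated_def)

lemma word_in_A: "W w \<in> A"
proof (induction w)
  case (Cons l w)
  have "(if s then cadjoint (B i) else B i) \<in> A" for i s by (simp add: A_adjoint B_in_A)
  then show ?case using Cons by (cases l) (simp only: word_Cons A_compose)
qed (simp add: A_proj)

text \<open>
  The closed linear span of the monomials in the \<open>B\<^sub>i\<close> and their adjoints is already a C*-algebra.
\<close>

lemma A_subset:
  assumes S: "closed_op_space M S" and WS: "range W \<subseteq> S"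
  shows "A \<subseteq> S"
proof -
  define H where "H = \<Inter>{S. closed_op_space M S \<and> range W \<subseteq> S}"
  have "closed_op_space M (bops M)"
    by (auto simp: closed_op_space_def M bops_add bops_scale)
  then have "H \<subseteq> bops M" unfolding H_def using word_bops by blast
  then have H: "closed_op_space M H"
    unfolding closed_op_space_def[of M H]
  proof (intro conjI ballI allI impI)
    fix X assume X: "X \<in> bops M" "\<forall>e>0. \<exists>Y\<in>H. onorm (\<lambda>x. X x - Y x) < e"
    show "X \<in> H" unfolding H_def
    proof (intro InterI)
      fix S' assume S': "S' \<in> {S. closed_op_space M S \<and> range W \<subseteq> S}"
      then have "H \<subseteq> S'" unfolding H_def by blast
      then have "\<forall>e>0. \<exists>Y\<in>S'. onorm (\<lambda>x. X x - Y x) < e" using X(2) by blast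
      then show "X \<in> S'" using S' X(1) by (auto simp: closed_op_space_def)
    qed
  qed (auto simp: H_def closed_op_space_def)
  have HI: "H \<subseteq> S'" if "closed_op_space M S'" "range W \<subseteq> S'" for S'
    unfolding H_def using that by blast
  have WH: "W w \<in> H" for w unfolding H_def by blast
  have Hb: "X \<in> bops M" if "X \<in> H" for X using H that by (auto simp: closed_op_space_def)
  have left: "closed_op_space M {Y \<in> bops M. X \<circ> Y \<in> H}" if X: "X \<in> bops M" for X
  proof (rule closed_op_space_vimage[OF M H, where C = "onorm X"])
    note lX = clinear_simps[OF bops_bounded[OF X]]
    fix Y Z assume YZ: "Y \<in> bops M" "Z \<in> bops M"
    have "(\<lambda>x. (X \<circ> Y) x - (X \<circ> Z) x) = X \<circ> (\<lambda>x. Y x - Z x)" by (simp add: fun_eq_iff lX)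
    moreover have "bounded_clinear (\<lambda>x. Y x - Z x)"
      by (intro bounded_clinear_diff bops_bounded[of _ M] YZ)
    ultimately show "onorm (\<lambda>x. (X \<circ> Y) x - (X \<circ> Z) x) \<le> onorm X * onorm (\<lambda>x. Y x - Z x)"
      using onorm_compose[of X "\<lambda>x. Y x - Z x"] bops_bounded[OF X]
      by (simp add: clinear_bounded_linear)
  next
    show "\<exists>c'. \<forall>Y\<in>bops M. X \<circ> (\<lambda>x. c *\<^sub>C Y x) = (\<lambda>x. c' *\<^sub>C (X \<circ> Y) x)" for c
      by (rule exI[of _ c]) (simp add: fun_eq_iff clinear_simps[OF bops_bounded[OF X]])
  qed (use X in \<open>auto simp: fun_eq_iff clinear_simps[OF bops_bounded[OF X]] intro: bops_compose[OF M]\<close>)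
  have right: "closed_op_space M {Y \<in> bops M. Y \<circ> X \<in> H}" if X: "X \<in> bops M" for X
  proof (rule closed_op_space_vimage[OF M H, where C = "onorm X"])
    fix Y Z assume YZ: "Y \<in> bops M" "Z \<in> bops M"
    have "(\<lambda>x. (Y \<circ> X) x - (Z \<circ> X) x) = (\<lambda>x. Y x - Z x) \<circ> X" by (simp add: fun_eq_iff)
    moreover have "bounded_clinear (\<lambda>x. Y x - Z x)"
      by (intro bounded_clinear_diff bops_bounded[of _ M] YZ)
    ultimately show "onorm (\<lambda>x. (Y \<circ> X) x - (Z \<circ> X) x) \<le> onorm X * onorm (\<lambda>x. Y x - Z x)"
      using onorm_compose[of "\<lambda>x. Y x - Z x" X] bops_bounded[OF X]
      by (simp add: clinear_bounded_linear mult.commute)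
  qed (use X in \<open>auto simp: fun_eq_iff intro: bops_compose[OF M]\<close>)
  have adj: "closed_op_space M {Y \<in> bops M. cadjoint Y \<in> H}"
  proof (rule closed_op_space_vimage[OF M H, where C = 1])
    fix Y Z assume YZ: "Y \<in> bops M" "Z \<in> bops M"
    have YZ': "bounded_clinear Y" "bounded_clinear Z" using YZ bops_bounded by auto
    have "(\<lambda>x. cadjoint Y x - cadjoint Z x) = cadjoint (\<lambda>x. Y x - Z x)"
      by (rule cadjointI[symmetric])
         (simp add: cinner_cadjoint YZ' cinner_diff_left cinner_diff_right)
    then show "onorm (\<lambda>x. cadjoint Y x - cadjoint Z x) \<le> 1 * onorm (\<lambda>x. Y x - Z x)"
      using onorm_cadjoint_le[OF bounded_clinear_diff[OF YZ']] by simp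
  next
    show "\<exists>c'. \<forall>Y\<in>bops M. cadjoint (\<lambda>x. c *\<^sub>C Y x) = (\<lambda>x. c' *\<^sub>C cadjoint Y x)" for c
      by (rule exI[of _ "cnj c"]) (simp add: cadjoint_scale bops_bounded)
  qed (auto simp: cadjoint_add bops_bounded bops_cadjoint[OF M])
  \<comment> \<open>Products are treated one factor at a time: with a monomial fixed on the left,
    the condition on Y is linear and closed; then, with Y fixed, so is the condition on X.\<close>
  have word_comp: "W w \<circ> Y \<in> H" if "Y \<in> H" for w Y
  proof -
    have "range W \<subseteq> {Y \<in> bops M. W w \<circ> Y \<in> H}"
      using WH word_bops by (auto simp only: word_append[symmetric])
    from HI[OF left[OF word_bops] this] show ?thesis using that by blast
  qed
  have comp: "X \<circ> Y \<in> H" if "X \<in> H" "Y \<in> H" for X Y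
  proof -
    have "range W \<subseteq> {X \<in> bops M. X \<circ> Y \<in> H}" using word_comp[OF that(2)] word_bops by blast
    from HI[OF right[OF Hb[OF that(2)]] this] show ?thesis using that by blast
  qed
  have cadj: "cadjoint X \<in> H" if "X \<in> H" for X
  proof -
    have "range W \<subseteq> {X \<in> bops M. cadjoint X \<in> H}"
      using WH word_bops by (auto simp only: word_adjoint)
    from HI[OF adj this] show ?thesis using that by blast
  qed
  have "cstar_subalgebra M H"
    using H comp cadj WH[of "[]"] unfolding cstar_subalgebra_def closed_op_space_def subalgebra_def
    by auto
  moreover have "B i \<in> H" for i
    using WH[of "[(i, False)]"] by (simp add: bops_proj_right[OF M B])
  ultimately have "A \<subseteq> H" unfolding cstar_generated_def by blast
  then show ?thesis using HI[OF S WS] by blast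
qed

text \<open>Products and adjoints are absorbed by the monomials and need no cases. This matters
  because properties such as convergence of (X tensor I) V_N h are linear and norm-closed in X but
  do not visibly pass to products.\<close>

lemma A_induct [consumes 1, case_names word add scale limit]:
  assumes X: "X \<in> A" and word: "\<And>w. P (W w)"
    and add: "\<And>X Y. X \<in> A \<Longrightarrow> Y \<in> A \<Longrightarrow> P X \<Longrightarrow> P Y \<Longrightarrow> P (\<lambda>x. X x + Y x)"
    and scale: "\<And>c X. X \<in> A \<Longrightarrow> P X \<Longrightarrow> P (\<lambda>x. c *\<^sub>C X x)"
    and limit: "\<And>X. X \<in> A \<Longrightarrow> (\<And>e. 0 < e \<Longrightarrow> \<exists>Y\<in>A. P Y \<and> onorm (\<lambda>x. X x - Y x) < e) \<Longrightarrow> P X"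
  shows "P X"
proof -
  have cl: "X \<in> A" if "X \<in> bops M" "\<forall>e>0. \<exists>Y\<in>A. onorm (\<lambda>x. X x - Y x) < e" for X
    using cstar_A that unfolding cstar_subalgebra_def by blast
  have "closed_op_space M {X \<in> A. P X}"
    unfolding closed_op_space_def
  proof (intro conjI ballI allI impI)
    fix X assume X: "X \<in> bops M" and lim: "\<forall>e>0. \<exists>Y\<in>{X \<in> A. P X}. onorm (\<lambda>x. X x - Y x) < e"
    have "X \<in> A" using cl[OF X] lim by blast
    then show "X \<in> {X \<in> A. P X}" using lim limit by blast
  qed (auto simp: A_bops A_add A_scale add scale)
  then have "A \<subseteq> {X \<in> A. P X}" by (rule A_subset) (auto simp: word word_in_A)
  then show ?thesis using X by blast
qed

end

section \<open>Representations obtained as limits of compressions\<close>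

text \<open>A countable product of discs is compact by Tychonoff and metrisable, hence sequentially
  compact; this replaces the usual diagonal extraction.\<close>

lemma bounded_diagonal:
  fixes z :: "nat \<Rightarrow> nat \<Rightarrow> complex"
  assumes "\<And>N a. cmod (z N a) \<le> C a"
  shows "\<exists>s. strict_mono s \<and> (\<forall>a. convergent (\<lambda>N. z (s N) a))"
proof -
  let ?P = "PiE UNIV (\<lambda>a. cball (0::complex) (C a))"
  have "compactin (product_topology (\<lambda>_::nat. euclidean) UNIV) ?P"
    by (simp add: compactin_PiE)
  then have "compact ?P" by (simp add: euclidean_product_topology)
  then have "seq_compact ?P" by (rule compact_imp_seq_compact)
  moreover have "\<forall>N. z N \<in> ?P" using assms by (simp add: PiE_UNIV_domain)
  ultimately obtain l s where s: "strict_mono (s :: nat \<Rightarrow> nat)" "(z \<circ> s) \<longlonglongrightarrow> l"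
    unfolding seq_compact_def by blast
  have "(\<lambda>N. z (s N) a) \<longlonglongrightarrow> l a" for a
    using continuous_on_tendsto_compose[OF continuous_on_product_coordinates[of a] s(2)] by simp
  then show ?thesis using s(1) by (auto simp: convergent_def)
qed

text \<open>Uniform limits of Cauchy sequences are Cauchy; this carries convergence through the
  limit case of an induction.\<close>

lemma convergent_approx:
  fixes X :: "nat \<Rightarrow> 'a::{real_normed_vector, complete_space}"
  assumes "\<And>e. 0 < e \<Longrightarrow> \<exists>Y. convergent Y \<and> (\<forall>n. norm (X n - Y n) \<le> e)"
  shows "convergent X"
proof -
  have "Cauchy X"
  proof (rule CauchyI)
    fix e :: real assume e: "0 < e"
    obtain Y where Y: "convergent Y" "\<And>n. norm (X n - Y n) \<le> e / 4"
      using assms[of "e / 4"] e by auto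
    obtain N where N: "\<And>m n. m \<ge> N \<Longrightarrow> n \<ge> N \<Longrightarrow> norm (Y m - Y n) < e / 4"
      using CauchyD[OF convergent_Cauchy[OF Y(1)], of "e / 4"] e by auto
    have "norm (X m - X n) < e" if "m \<ge> N" "n \<ge> N" for m n
    proof -
      have "X m - X n = (X m - Y m) + (Y m - Y n) - (X n - Y n)" by simp
      then have "norm (X m - X n) \<le> norm (X m - Y m) + norm (Y m - Y n) + norm (X n - Y n)"
        using norm_triangle_ineq[of "X m - Y m" "Y m - Y n"]
          norm_triangle_ineq4[of "(X m - Y m) + (Y m - Y n)" "X n - Y n"] by (smt (verit))
      then show ?thesis using Y(2)[of m] Y(2)[of n] N[OF that] e by simp
    qed
    then show "\<exists>N. \<forall>m\<ge>N. \<forall>n\<ge>N. norm (X m - X n) < e" by blast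
  qed
  then show ?thesis by (rule Cauchy_convergent)
qed

lemma convergent_scaleC: "convergent f \<Longrightarrow> convergent (\<lambda>n. c *\<^sub>C f n)"
  by (auto simp: convergent_def intro: tendsto_scaleC)

text \<open>Uniform boundedness makes the set of points of convergence closed, so convergence need
  only be checked on a spanning set.\<close>

lemma closed_csubspace_convergent:
  fixes Z :: "nat \<Rightarrow> 'a::complex_hilbert \<Rightarrow> 'b::complex_hilbert"
  assumes Z: "\<And>N. bounded_clinear (Z N)" and C: "\<And>N x. norm (Z N x) \<le> C * norm x" and "0 \<le> C"
  shows "closed_csubspace {x. convergent (\<lambda>N. Z N x)}"
proof -
  let ?S = "{x. convergent (\<lambda>N. Z N x)}"
  have "x \<in> ?S" if x: "x \<in> closure ?S" for x
  proof -
    have "convergent (\<lambda>N. Z N x)"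
    proof (rule convergent_approx)
      fix e :: real assume e: "0 < e"
      then have "0 < e / (C + 1)" using \<open>0 \<le> C\<close> by simp
      then obtain y where y: "y \<in> ?S" "dist y x < e / (C + 1)"
        using x closure_approachable by blast
      have "norm (Z N x - Z N y) \<le> e" for N
      proof -
        have "norm (Z N x - Z N y) \<le> C * norm (x - y)"
          using C[of N "x - y"] by (simp add: clinear_simps[OF Z])
        also have "\<dots> \<le> (C + 1) * (e / (C + 1))"
          using y(2) \<open>0 \<le> C\<close> by (intro mult_mono) (auto simp: dist_norm norm_minus_commute)
        finally show ?thesis using \<open>0 \<le> C\<close> by simp
      qed
      then show "\<exists>Y. convergent Y \<and> (\<forall>n. norm (Z n x - Y n) \<le> e)" using y(1) by blast
    qed
    then show ?thesis by simp
  qed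
  then have "closed ?S" using closure_subset_eq by blast
  then show ?thesis
    by (auto simp: closed_csubspace_def csubspace_def clinear_simps[OF Z]
        convergent_const convergent_add convergent_scaleC)
qed

lemma (in operator_family) norm_amp_diff_le:
  assumes "X \<in> A" "Y \<in> A" "norm f \<le> c"
  shows "norm (amp X f - amp Y f) \<le> onorm (\<lambda>x. X x - Y x) * c"
proof -
  have b: "bounded_clinear (\<lambda>x. X x - Y x)" using assms by (intro bounded_clinear_diff A_bounded)
  have "norm (amp X f - amp Y f) \<le> onorm (\<lambda>x. X x - Y x) * norm f"
    using norm_amp_le[OF b, of f] assms by (simp add: amp_diff A_bounded)
  also have "\<dots> \<le> onorm (\<lambda>x. X x - Y x) * c"
    using assms by (intro mult_left_mono clinear_onorm_nonneg b)
  finally show ?thesis .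
qed

text \<open>Dividing the tolerance by |h| + 1 rather than |h| covers h = 0.\<close>

lemma (in operator_family) approx_mult:
  assumes X: "X \<in> A" and lim: "\<And>e. 0 < e \<Longrightarrow> \<exists>Y\<in>A. P Y \<and> onorm (\<lambda>x. X x - Y x) < e" and e: "0 < e"
  obtains Y where "Y \<in> A" "P Y" "onorm (\<lambda>x. X x - Y x) * norm h < e"
proof -
  have "0 < e / (norm h + 1)" using e by (simp add: add_nonneg_pos)
  then obtain Y where Y: "Y \<in> A" "P Y" "onorm (\<lambda>x. X x - Y x) < e / (norm h + 1)"
    using lim by blast
  have "onorm (\<lambda>x. X x - Y x) * norm h \<le> onorm (\<lambda>x. X x - Y x) * (norm h + 1)"
    using X Y by (intro mult_left_mono clinear_onorm_nonneg bounded_clinear_diff A_bounded) auto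
  also have "\<dots> < e" using Y(3) by (simp add: pos_less_divide_eq add_nonneg_pos)
  finally show ?thesis using that Y by blast
qed

text \<open>
  The Stinespring space of the completely positive map \<open>X \<mapsto> lim V\<^sub>N\<^sup>* (X \<otimes> I) V\<^sub>N\<close>. The vectors
  \<open>(X \<otimes> I) V\<^sub>N h\<close>, with \<open>X\<close> a monomial and \<open>h\<close> in a dense sequence, are transported to
  \<open>\<ell>\<^sup>2\<close> by triangular coordinates \<open>U\<^sub>N\<close>, where they converge along a subsequence.
\<close>

theorem (in operator_family) limit_representation:
  fixes V :: "nat \<Rightarrow> 'h::complex_hilbert \<Rightarrow> (nat, 'a) l2"
  assumes countable: "countable (UNIV :: 'n set)"
    and separable: "separable_space (euclidean :: 'h topology)"
    and V: "\<And>N. bounded_clinear (V N)" and V_le: "\<And>N h. norm (V N h) \<le> norm h"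
  obtains s K \<pi> R where "strict_mono (s :: nat \<Rightarrow> nat)" "closed_csubspace (K :: (nat, complex) l2 set)"
    "star_representation A K \<pi>" "bounded_clinear R" "\<And>h. R h \<in> K"
    "\<And>X Y h k. X \<in> A \<Longrightarrow> Y \<in> A \<Longrightarrow>
      (\<lambda>N. cinner (amp X (V (s N) h)) (amp Y (V (s N) k))) \<longlonglongrightarrow> cinner (\<pi> X (R h)) (\<pi> Y (R k))"
    "K = closed_cspan {\<pi> (W w) (R h) |w h. True}" "\<And>h. \<pi> (proj M) (R h) = R h"
proof -
  obtain d :: "nat \<Rightarrow> 'h" where d: "closure (range d) = UNIV"
    using separable_dense_sequence[OF separable] by blast
  have "countable (UNIV :: ('n \<times> bool) list set)"
  proof -
    have "countable (UNIV :: ('n \<times> bool) set)"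
      using countable_SIGMA[OF countable, of "\<lambda>_. UNIV :: bool set"]
      by (simp add: countable_finite)
    then show ?thesis using countable_lists[of "UNIV :: ('n \<times> bool) set"] by simp
  qed
  then have g: "range (from_nat_into UNIV) = (UNIV :: ('n \<times> bool) list set)"
    by (simp add: range_from_nat_into)
  define g :: "nat \<Rightarrow> ('n \<times> bool) list" where "g = from_nat_into UNIV"
  have g: "range g = UNIV" unfolding g_def by (rule g)
  \<comment> \<open>All pairs of a monomial and a vector of the dense sequence, coded by one number,
    because triangular coordinates need a single sequence.\<close>
  define x where "x N a = amp (W (g (fst (prod_decode a)))) (V N (d (snd (prod_decode a))))" for N a
  have x_enc: "x N (prod_encode (i, j)) = amp (W (g i)) (V N (d j))" for N i j
    by (simp add: x_def)
  note amp_A = bounded_clinear_amp[OF A_bounded]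
  have "\<forall>N. \<exists>U :: (nat, 'a) l2 \<Rightarrow> (nat, complex) l2. bounded_clinear U \<and> (\<forall>f. norm (U f) \<le> norm f) \<and>
      (\<forall>f\<in>closed_cspan (range (x N)). \<forall>y. cinner (U f) (U y) = cinner f y) \<and>
      (\<forall>a n. a < n \<longrightarrow> Rep_l2 (U (x N a)) n = 0)"
    using triangular_coordinates by blast
  then obtain U :: "nat \<Rightarrow> (nat, 'a) l2 \<Rightarrow> (nat, complex) l2"
    where U: "\<And>N. bounded_clinear (U N)" and U_le: "\<And>N f. norm (U N f) \<le> norm f"
      and U_iso: "\<And>N f y. f \<in> closed_cspan (range (x N)) \<Longrightarrow> cinner (U N f) (U N y) = cinner f y"
      and U_tri: "\<And>N a n. a < n \<Longrightarrow> Rep_l2 (U N (x N a)) n = 0"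
    by metis
  obtain s where s: "strict_mono (s :: nat \<Rightarrow> nat)"
    and conv_coord: "\<And>a n. convergent (\<lambda>N. Rep_l2 (U (s N) (x (s N) a)) n)"
  proof -
    \<comment> \<open>p codes a vector index and a coordinate index; the bound \<open>C p\<close>
      does not depend on N, as compactness of the product requires.\<close>
    define z where "z N p = Rep_l2 (U N (x N (fst (prod_decode p)))) (snd (prod_decode p))" for N p
    define C where "C p = onorm (W (g (fst (prod_decode (fst (prod_decode p))))))
      * norm (d (snd (prod_decode (fst (prod_decode p)))))" for p
    have "cmod (z N p) \<le> C p" for N p
    proof -
      let ?a = "fst (prod_decode p)"
      have "cmod (z N p) \<le> norm (U N (x N ?a))" unfolding z_def by (rule norm_l2_component_le)
      also have "\<dots> \<le> norm (x N ?a)" by (rule U_le)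
      also have "\<dots> \<le> onorm (W (g (fst (prod_decode ?a)))) * norm (V N (d (snd (prod_decode ?a))))"
        unfolding x_def by (rule norm_amp_le[OF bops_bounded[OF word_bops]])
      also have "\<dots> \<le> C p" unfolding C_def
        by (intro mult_left_mono V_le clinear_onorm_nonneg bops_bounded[OF word_bops])
      finally show ?thesis .
    qed
    then obtain s where s: "strict_mono (s :: nat \<Rightarrow> nat)" "\<And>p. convergent (\<lambda>N. z (s N) p)"
      using bounded_diagonal[of z C] by blast
    show ?thesis
      by (rule that[OF s(1)]) (use s(2)[of "prod_encode (_, _)"] in \<open>simp add: z_def\<close>)
  qed
  define u where "u N = U (s N)" for N
  define v where "v N = V (s N)" for N
  define F where "F N = closed_cspan (range (x (s N)))" for N
  have u: "bounded_clinear (u N)" and u_le: "norm (u N f) \<le> norm f"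
    and v: "bounded_clinear (v N)" and v_le: "norm (v N h) \<le> norm h" for N f h
    by (simp_all add: u_def v_def U U_le V V_le)
  note lu = clinear_simps[OF u] and lv = clinear_simps[OF v]
  have F: "closed_csubspace (F N)" "csubspace (F N)" for N
    by (simp_all add: F_def closed_csubspaceD)
  have conv_x: "convergent (\<lambda>N. u N (x (s N) a))" for a
  proof -
    have eq: "u N (x (s N) a) = (\<Sum>n\<le>a. Rep_l2 (u N (x (s N) a)) n *\<^sub>C l2_basis n)" for N
    proof (rule l2_eqI)
      fix m
      have "Rep_l2 (\<Sum>n\<le>a. Rep_l2 (u N (x (s N) a)) n *\<^sub>C l2_basis n) m
          = (\<Sum>n\<le>a. if n = m then Rep_l2 (u N (x (s N) a)) n else 0)"
        unfolding Rep_l2_sum by (intro sum.cong) (auto simp: l2_basis.rep_eq scaleC_complex_def)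
      then show "Rep_l2 (u N (x (s N) a)) m
          = Rep_l2 (\<Sum>n\<le>a. Rep_l2 (u N (x (s N) a)) n *\<^sub>C l2_basis n) m"
        using U_tri[of a m "s N"] by (auto simp: u_def)
    qed
    obtain l where "\<And>n. (\<lambda>N. Rep_l2 (u N (x (s N) a)) n) \<longlonglongrightarrow> l n"
      using conv_coord[of a] unfolding convergent_def u_def by metis
    then have "(\<lambda>N. \<Sum>n\<le>a. Rep_l2 (u N (x (s N) a)) n *\<^sub>C l2_basis n) \<longlonglongrightarrow> (\<Sum>n\<le>a. l n *\<^sub>C l2_basis n)"
      by (intro tendsto_sum tendsto_scaleC_left)
    then show ?thesis by (auto simp: convergent_def simp flip: eq)
  qed
  have dense: "h \<in> S" if "range d \<subseteq> S" "closed S" for S h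
    using closure_minimal[OF that] d by auto
  have amp_v: "bounded_clinear (\<lambda>h. amp X (v N h))" if "X \<in> A" for X N
    using bounded_clinear_compose[OF amp_A[OF that] v[of N]] by (simp add: o_def)
  have amp_v_le: "norm (amp X (v N h)) \<le> onorm X * norm h" if "X \<in> A" for X N h
  proof -
    have "norm (amp X (v N h)) \<le> onorm X * norm (v N h)" by (rule norm_amp_le[OF A_bounded[OF that]])
    also have "\<dots> \<le> onorm X * norm h"
      by (intro mult_left_mono v_le clinear_onorm_nonneg A_bounded that)
    finally show ?thesis .
  qed
  \<comment> \<open>The coordinates preserve inner products only when one argument lies in F N, so
    the vectors to be compared have to be placed there.\<close>
  have in_F: "amp X (v N h) \<in> F N" if "X \<in> A" for X N h
    using that
  proof (induction X arbitrary: h rule: A_induct)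
    case (word w)
    have "closed_csubspace {h. amp (W w) (v N h) \<in> F N}"
      by (rule closed_csubspace_vimage[OF amp_v[OF word_in_A] F(1)])
    moreover have "range d \<subseteq> {h. amp (W w) (v N h) \<in> F N}"
    proof clarsimp
      fix j
      obtain i where "w = g i" using g by (metis rangeE UNIV_I)
      then have "amp (W w) (v N (d j)) = x (s N) (prod_encode (i, j))" by (simp add: x_enc v_def)
      then show "amp (W w) (v N (d j)) \<in> F N" by (simp add: F_def closed_cspan_base)
    qed
    ultimately show ?case using dense unfolding closed_csubspace_def by blast
  next
    case (limit X)
    have "amp X (v N h) \<in> closure (F N)"
      unfolding closure_approachable
    proof (intro allI impI)
      fix e :: real assume e: "0 < e"
      then obtain Y where Y: "Y \<in> A" "\<And>h. amp Y (v N h) \<in> F N" "onorm (\<lambda>x. X x - Y x) * norm h < e"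
        using approx_mult[OF limit] by blast
      have "norm (amp X (v N h) - amp Y (v N h)) \<le> onorm (\<lambda>x. X x - Y x) * norm h"
        by (rule norm_amp_diff_le[OF limit(1) Y(1) v_le])
      also have "\<dots> < e" by (rule Y(3))
      finally show "\<exists>y\<in>F N. dist y (amp X (v N h)) < e"
        using Y(2) by (metis dist_norm norm_minus_commute)
    qed
    then show ?case using F(1)[of N] by (simp add: closed_csubspace_def)
  qed (simp_all add: amp_add amp_scale A_bounded csubspace_add csubspace_scaleC F)
  have conv: "convergent (\<lambda>N. u N (amp X (v N h)))" if "X \<in> A" for X h
    using that
  proof (induction X arbitrary: h rule: A_induct)
    case (word w)
    have "closed_csubspace {h. convergent (\<lambda>N. u N (amp (W w) (v N h)))}"
    proof (rule closed_csubspace_convergent)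
      show "bounded_clinear (\<lambda>h. u N (amp (W w) (v N h)))" for N
        using bounded_clinear_compose[OF u amp_v[OF word_in_A]] by (simp add: o_def)
      show "norm (u N (amp (W w) (v N h))) \<le> onorm (W w) * norm h" for N h
        using u_le amp_v_le[OF word_in_A] order_trans by blast
      show "0 \<le> onorm (W w)" by (rule clinear_onorm_nonneg[OF A_bounded[OF word_in_A]])
    qed
    moreover have "range d \<subseteq> {h. convergent (\<lambda>N. u N (amp (W w) (v N h)))}"
    proof clarsimp
      fix j
      obtain i where "w = g i" using g by (metis rangeE UNIV_I)
      then show "convergent (\<lambda>N. u N (amp (W w) (v N (d j))))"
        using conv_x[of "prod_encode (i, j)"] by (simp add: x_enc v_def)
    qed
    ultimately show ?case using dense unfolding closed_csubspace_def by blast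
  next
    case (limit X)
    show ?case
    proof (rule convergent_approx)
      fix e :: real assume e: "0 < e"
      then obtain Y where Y: "Y \<in> A" "\<And>h. convergent (\<lambda>N. u N (amp Y (v N h)))"
        "onorm (\<lambda>x. X x - Y x) * norm h < e"
        using approx_mult[OF limit] by blast
      have "norm (u N (amp X (v N h)) - u N (amp Y (v N h))) \<le> e" for N
      proof -
        have "norm (u N (amp X (v N h)) - u N (amp Y (v N h))) \<le> norm (amp X (v N h) - amp Y (v N h))"
          using u_le[of N "amp X (v N h) - amp Y (v N h)"] by (simp add: lu)
        also have "\<dots> \<le> onorm (\<lambda>x. X x - Y x) * norm h"
          by (rule norm_amp_diff_le[OF limit(1) Y(1) v_le])
        also have "\<dots> \<le> e" using Y(3) by simp
        finally show ?thesis .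
      qed
      then show "\<exists>Z. convergent Z \<and> (\<forall>N. norm (u N (amp X (v N h)) - Z N) \<le> e)" using Y(2) by blast
    qed
  qed (simp_all add: amp_add amp_scale A_bounded lu convergent_add convergent_scaleC)
  define L where "L X h = lim (\<lambda>N. u N (amp X (v N h)))" for X h
  have L: "(\<lambda>N. u N (amp X (v N h))) \<longlonglongrightarrow> L X h" if "X \<in> A" for X h
    using conv[OF that] by (simp add: L_def convergent_LIMSEQ_iff)
  define K where "K = closed_cspan {L (W w) h |w h. True}"
  have K: "closed_csubspace K" "csubspace K" by (simp_all add: K_def closed_csubspaceD)
  have u_iso: "cinner (u N f) (u N y) = cinner f y" if "f \<in> F N" for N f y
    using U_iso that by (simp add: u_def F_def)
  \<comment> \<open>Preserving inner products on F N against arbitrary second arguments says exactly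
    that the adjoint inverts u there.\<close>
  have uu: "cadjoint (u N) (u N f) = f" if "f \<in> F N" for N f
    by (rule cinner_ext) (metis (no_types) cinner_cadjoint[OF u] cinner_commute u_iso[OF that])
  have L_inner: "(\<lambda>N. cinner (amp X (v N h)) (amp Y (v N k))) \<longlonglongrightarrow> cinner (L X h) (L Y k)"
    if "X \<in> A" "Y \<in> A" for X Y h k
    using tendsto_cinner[OF L[OF that(1), of h] L[OF that(2), of k]] u_iso[OF in_F[OF that(1)]] by simp
  have L_lim: "norm (L X h - L Y h) \<le> onorm (\<lambda>x. X x - Y x) * norm h" if "X \<in> A" "Y \<in> A" for X Y h
  proof (rule LIMSEQ_le_const2[OF tendsto_norm[OF tendsto_diff[OF L[OF that(1)] L[OF that(2)]]]])
    have "norm (u N (amp X (v N h)) - u N (amp Y (v N h))) \<le> onorm (\<lambda>x. X x - Y x) * norm h" for N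
      using u_le[of N "amp X (v N h) - amp Y (v N h)"] norm_amp_diff_le[OF that v_le, of N h]
      by (simp add: lu)
    then show "\<exists>N0. \<forall>N\<ge>N0. norm (u N (amp X (v N h)) - u N (amp Y (v N h)))
        \<le> onorm (\<lambda>x. X x - Y x) * norm h" by blast
  qed
  have L_K: "L X h \<in> K" if "X \<in> A" for X h
    using that
  proof (induction X rule: A_induct)
    case (word w)
    show ?case unfolding K_def by (rule closed_cspan_base) blast
  next
    case (add X Y)
    have "L (\<lambda>x. X x + Y x) h = L X h + L Y h"
      using L[OF A_add[OF add(1,2)], of h] tendsto_add[OF L[OF add(1), of h] L[OF add(2), of h]]
      by (simp add: amp_add A_bounded add lu LIMSEQ_unique)
    then show ?case using add csubspace_add[OF K(2)] by simp
  next
    case (scale c X)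
    have "L (\<lambda>x. c *\<^sub>C X x) h = c *\<^sub>C L X h"
      using L[OF A_scale[OF scale(1)], of c h] tendsto_scaleC[OF L[OF scale(1), of h], of c]
      by (simp add: amp_scale A_bounded scale lu LIMSEQ_unique)
    then show ?case using scale csubspace_scaleC[OF K(2)] by simp
  next
    case (limit X)
    have "L X h \<in> closure K"
      unfolding closure_approachable
    proof (intro allI impI)
      fix e :: real assume e: "0 < e"
      then obtain Y where Y: "Y \<in> A" "L Y h \<in> K" "onorm (\<lambda>x. X x - Y x) * norm h < e"
        using approx_mult[OF limit] by blast
      have "norm (L X h - L Y h) \<le> onorm (\<lambda>x. X x - Y x) * norm h" by (rule L_lim[OF limit(1) Y(1)])
      also have "\<dots> < e" by (rule Y(3))
      finally show "\<exists>y\<in>K. dist y (L X h) < e"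
        using Y(2) by (metis dist_norm norm_minus_commute)
    qed
    then show ?case using K by (simp add: closed_csubspace_def)
  qed
  \<comment> \<open>The ampliation seen through the coordinates at stage N; the representation will
    be its pointwise limit on K.\<close>
  define Z where "Z X N y = u N (amp X (cadjoint (u N) y))" for X N y
  have Z: "bounded_clinear (Z X N)" if "X \<in> A" for X N
    using bounded_clinear_compose[OF u bounded_clinear_compose[OF amp_A[OF that] bounded_clinear_cadjoint[OF u]]]
    unfolding Z_def by (simp add: o_def)
  have Z_le: "norm (Z X N y) \<le> onorm X * norm y" if "X \<in> A" for X N y
  proof -
    have "norm (Z X N y) \<le> onorm X * norm (cadjoint (u N) y)"
      unfolding Z_def using u_le norm_amp_le[OF A_bounded[OF that]] order_trans by blast
    also have "\<dots> \<le> onorm X * (1 * norm y)"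
      by (intro mult_left_mono norm_cadjoint_le[OF u] clinear_onorm_nonneg A_bounded that)
         (simp_all add: u_le)
    finally show ?thesis by simp
  qed
  have Z_L: "(\<lambda>N. Z X N (L Y h)) \<longlonglongrightarrow> L (X \<circ> Y) h" if "X \<in> A" "Y \<in> A" for X Y h
  proof -
    \<comment> \<open>L Y h is replaced by its own approximants, on which Z X N acts exactly;
      uniform boundedness absorbs the error.\<close>
    have "(\<lambda>N. Z X N (L Y h - u N (amp Y (v N h)))) \<longlonglongrightarrow> 0"
    proof (rule Lim_null_comparison)
      show "(\<lambda>N. onorm X * norm (L Y h - u N (amp Y (v N h)))) \<longlonglongrightarrow> 0"
        using tendsto_mult_left[OF tendsto_norm[OF tendsto_diff[OF tendsto_const[of "L Y h"] L[OF that(2), of h]]], of "onorm X"]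
        by simp
    qed (simp add: Z_le[OF that(1)])
    moreover have "Z X N (u N (amp Y (v N h))) = u N (amp (X \<circ> Y) (v N h))" for N
      by (simp add: Z_def uu[OF in_F[OF that(2)]] amp_compose A_bounded that)
    then have "(\<lambda>N. Z X N (u N (amp Y (v N h)))) \<longlonglongrightarrow> L (X \<circ> Y) h"
      using L[OF A_compose[OF that], of h] by simp
    ultimately have "(\<lambda>N. Z X N (L Y h - u N (amp Y (v N h))) + Z X N (u N (amp Y (v N h))))
        \<longlonglongrightarrow> 0 + L (X \<circ> Y) h" by (rule tendsto_add)
    then show ?thesis by (simp add: clinear_simps[OF Z[OF that(1)]])
  qed
  have Z_conv: "convergent (\<lambda>N. Z X N y)" if "X \<in> A" "y \<in> K" for X y
  proof -
    have "K \<subseteq> {y. convergent (\<lambda>N. Z X N y)}"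
      unfolding K_def
    proof (rule closed_cspan_minimal)
      show "{L (W w) h |w h. True} \<subseteq> {y. convergent (\<lambda>N. Z X N y)}"
        using Z_L[OF that(1) word_in_A] by (auto simp: convergent_def)
      show "closed_csubspace {y. convergent (\<lambda>N. Z X N y)}"
        by (rule closed_csubspace_convergent[OF Z[OF that(1)] Z_le[OF that(1)]
              clinear_onorm_nonneg[OF A_bounded[OF that(1)]]])
    qed
    then show ?thesis using that(2) by blast
  qed
  \<comment> \<open>Convergence is known on K only. Projecting first makes the limit exist
    everywhere and yields the extension by 0 demanded by \<open>bops K\<close>.\<close>
  define \<pi> where "\<pi> X y = lim (\<lambda>N. Z X N (proj K y))" for X y
  have \<pi>: "(\<lambda>N. Z X N (proj K y)) \<longlonglongrightarrow> \<pi> X y" if "X \<in> A" for X y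
    using Z_conv[OF that proj_in[OF K(1)]] by (simp add: \<pi>_def convergent_LIMSEQ_iff)
  have \<pi>_L: "\<pi> X (L Y h) = L (X \<circ> Y) h" if "X \<in> A" "Y \<in> A" for X Y h
    using \<pi>[OF that(1), of "L Y h"] Z_L[OF that, of h]
    by (simp add: proj_id[OF K(1) L_K[OF that(2)]] LIMSEQ_unique)
  have \<pi>_lin: "bounded_clinear (\<pi> X)" if X: "X \<in> A" for X
  proof (rule bounded_clinear_limit[OF _ _ \<pi>[OF X]])
    show "bounded_clinear (\<lambda>y. Z X N (proj K y))" for N
      using bounded_clinear_compose[OF Z[OF X] bounded_clinear_proj[OF K(1)]] by (simp add: o_def)
    show "norm (Z X N (proj K y)) \<le> onorm X * norm y" for N y
      by (rule order_trans[OF Z_le[OF X]])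
         (intro mult_left_mono norm_proj_le K clinear_onorm_nonneg A_bounded X)
  qed
  have \<pi>_proj: "\<pi> X (proj K y) = \<pi> X y" for X y
    by (simp add: \<pi>_def proj_id[OF K(1) proj_in[OF K(1)]])
  have \<pi>_bops: "\<pi> X \<in> bops K" if X: "X \<in> A" for X
  proof (rule bopsI[OF \<pi>_lin[OF X]])
    have "{L (W w) h |w h. True} \<subseteq> {y. \<pi> X y \<in> K}"
      using L_K[OF A_compose[OF X word_in_A]] by (auto simp: \<pi>_L[OF X word_in_A])
    then have "K \<subseteq> {y. \<pi> X y \<in> K}"
      using closed_cspan_minimal[OF _ closed_csubspace_vimage[OF \<pi>_lin[OF X] K(1)]] K_def by blast
    then show "\<pi> X y \<in> K" for y using proj_in[OF K(1), of y] \<pi>_proj[of X y] by auto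
    show "\<pi> X y = 0" if "y \<in> orth_compl K" for y
      using \<pi>_proj[of X y] by (simp add: proj_orth_zero[OF K(1) that] clinear_simps[OF \<pi>_lin[OF X]])
  qed
  have "star_representation A K \<pi>"
    unfolding star_representation_def
  proof (intro conjI ballI allI)
    show "\<pi> X \<in> bops K" if "X \<in> A" for X by (rule \<pi>_bops[OF that])
  next
    fix X Y assume XY: "X \<in> A" "Y \<in> A"
    show "\<pi> (\<lambda>x. X x + Y x) = (\<lambda>k. \<pi> X k + \<pi> Y k)"
    proof
      fix y show "\<pi> (\<lambda>x. X x + Y x) y = \<pi> X y + \<pi> Y y"
        using \<pi>[OF A_add[OF XY], of y] tendsto_add[OF \<pi>[OF XY(1), of y] \<pi>[OF XY(2), of y]]
        by (simp add: Z_def amp_add A_bounded XY lu LIMSEQ_unique)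
    qed
    show "\<pi> (X \<circ> Y) = \<pi> X \<circ> \<pi> Y"
    proof (rule bops_eqI[OF K(1)])
      show "\<pi> (X \<circ> Y) \<in> bops K" by (rule \<pi>_bops[OF A_compose[OF XY]])
      show "\<pi> X \<circ> \<pi> Y \<in> bops K" by (intro bops_compose \<pi>_bops K XY)
      show "closed_cspan {L (W w) h |w h. True} = K" by (simp add: K_def)
      show "\<pi> (X \<circ> Y) y = (\<pi> X \<circ> \<pi> Y) y" if "y \<in> {L (W w) h |w h. True}" for y
        using that by (auto simp: \<pi>_L word_in_A A_compose XY comp_assoc)
    qed
  next
    fix c X assume X: "X \<in> A"
    show "\<pi> (\<lambda>x. c *\<^sub>C X x) = (\<lambda>k. c *\<^sub>C \<pi> X k)"
    proof
      fix y show "\<pi> (\<lambda>x. c *\<^sub>C X x) y = c *\<^sub>C \<pi> X y"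
        using \<pi>[OF A_scale[OF X], of c y] tendsto_scaleC[OF \<pi>[OF X, of y], of c]
        by (simp add: Z_def amp_scale A_bounded X lu LIMSEQ_unique)
    qed
  next
    fix X assume X: "X \<in> A"
    have Z_adj: "cinner (Z X N y) z = cinner y (Z (cadjoint X) N z)" for N y z
      by (simp add: Z_def cinner_cadjoint[OF u] cinner_cadjoint'[OF u] cinner_amp[OF A_bounded[OF X]])
    \<comment> \<open>The adjoint relation passes to the limit with one argument projected on each
      side; the projections then disappear because both operators have range in K.\<close>
    have eq: "cinner (\<pi> X y) (proj K z) = cinner (proj K y) (\<pi> (cadjoint X) z)" for y z
      using tendsto_cinner[OF \<pi>[OF X, of y] tendsto_const[of "proj K z"]]
        tendsto_cinner[OF tendsto_const[of "proj K y"] \<pi>[OF A_adjoint[OF X], of z]]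
      by (simp add: Z_adj LIMSEQ_unique)
    have "cinner (\<pi> X y) z = cinner y (\<pi> (cadjoint X) z)" for y z
      using eq[of y z] \<pi>_bops[OF X] \<pi>_bops[OF A_adjoint[OF X]]
      by (metis bops_range cinner_proj K(1) proj_id)
    then show "\<pi> (cadjoint X) = cadjoint (\<pi> X)" by (simp add: cadjointI)
  qed
  moreover have "bounded_clinear (L (proj M))"
  proof (rule bounded_clinear_limit[OF _ _ L[OF A_proj]])
    show "bounded_clinear (\<lambda>h. u N (amp (proj M) (v N h)))" for N
      using bounded_clinear_compose[OF u amp_v[OF A_proj]] by (simp add: o_def)
    show "norm (u N (amp (proj M) (v N h))) \<le> onorm (proj M) * norm h" for N h
      using u_le amp_v_le[OF A_proj] order_trans by blast
  qed
  moreover have \<pi>R: "\<pi> X (L (proj M) h) = L X h" if "X \<in> A" for X h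
    using that by (simp add: \<pi>_L A_proj bops_proj_right[OF M A_bops])
  ultimately show ?thesis
    using that[OF s K(1), of \<pi> "L (proj M)"] L_K[OF A_proj] L_inner
    by (simp add: word_in_A A_proj K_def v_def)
qed

section \<open>The constrained Fock space\<close>

text \<open>Adjoint of left creation. Coefficients are taken in any Hilbert space, because it acts
  on scalar Fock vectors as well as on the Poisson kernel with values in H.\<close>

lift_definition annihilation :: "'n \<Rightarrow> ('n list, 'h::complex_hilbert) l2 \<Rightarrow> ('n list, 'h) l2"
  is "\<lambda>i f w. f (i # w)"
proof -
  fix i :: 'n and f :: "'n list \<Rightarrow> 'h"
  assume "(\<lambda>w. (norm (f w))\<^sup>2) summable_on UNIV"
  then have "(\<lambda>w. (norm (f w))\<^sup>2) summable_on range ((#) i)"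
    by (rule summable_on_subset_banach) simp
  then show "(\<lambda>w. (norm (f (i # w)))\<^sup>2) summable_on UNIV"
    by (subst (asm) summable_on_reindex) (auto simp: inj_on_def o_def)
qed

text \<open>Vector-valued \<open>creation\<close>, that is, S_i tensor I.\<close>

lift_definition shift :: "'n \<Rightarrow> ('n list, 'h::complex_hilbert) l2 \<Rightarrow> ('n list, 'h) l2"
  is "\<lambda>i f w. case w of [] \<Rightarrow> 0 | j # v \<Rightarrow> if j = i then f v else 0"
proof -
  fix i :: 'n and f :: "'n list \<Rightarrow> 'h"
  let ?g = "\<lambda>w. case w of [] \<Rightarrow> 0 | j # v \<Rightarrow> if j = i then f v else 0"
  assume "(\<lambda>w. (norm (f w))\<^sup>2) summable_on UNIV"
  then have "((\<lambda>w. (norm (?g w))\<^sup>2) \<circ> (#) i) summable_on UNIV" by (simp add: o_def)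
  then have "(\<lambda>w. (norm (?g w))\<^sup>2) summable_on range ((#) i)"
    by (subst summable_on_reindex) (auto simp: inj_on_def)
  moreover have "(\<lambda>w. (norm (?g w))\<^sup>2) summable_on range ((#) i) \<longleftrightarrow>
      (\<lambda>w. (norm (?g w))\<^sup>2) summable_on UNIV"
    by (rule summable_on_cong_neutral) (auto simp: image_iff split: list.splits)
  ultimately show "(\<lambda>w. (norm (?g w))\<^sup>2) summable_on UNIV" by simp
qed

lemma Rep_shift [simp]: "Rep_l2 (shift i f) [] = 0"
  "Rep_l2 (shift i f) (j # v) = (if j = i then Rep_l2 f v else 0)"
  by (simp_all add: shift.rep_eq)

lemma Rep_annihilation [simp]: "Rep_l2 (annihilation i f) w = Rep_l2 f (i # w)"
  by (simp add: annihilation.rep_eq)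

lemma creation_eq_shift: "creation = shift"
proof (intro ext l2_eqI)
  fix i :: 'n and f w show "Rep_l2 (creation i f) w = Rep_l2 (shift i f) w"
    by (simp add: creation.rep_eq shift.rep_eq creation_coeff_def)
qed

lemma word_l2_eqI:
  assumes "Rep_l2 f [] = Rep_l2 g []" "\<And>j v. Rep_l2 f (j # v) = Rep_l2 g (j # v)"
  shows "f = g"
proof (rule l2_eqI)
  fix w show "Rep_l2 f w = Rep_l2 g w" by (cases w) (simp_all add: assms)
qed

lemma cinner_shift: "cinner (shift i f) g = cinner f (annihilation i g)"
proof -
  have "cinner (shift i f) g = (\<Sum>\<^sub>\<infinity>w\<in>range ((#) i). cinner (Rep_l2 (shift i f) w) (Rep_l2 g w))"
    unfolding cinner_l2_def
    by (rule infsum_cong_neutral) (auto simp: image_iff shift.rep_eq split: list.splits)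
  also have "\<dots> = (\<Sum>\<^sub>\<infinity>w. cinner (Rep_l2 f w) (Rep_l2 (annihilation i g) w))"
    by (subst infsum_reindex) (auto simp: inj_on_def o_def)
  finally show ?thesis by (simp add: cinner_l2_def)
qed

lemma annihilation_shift: "annihilation i (shift i f) = f"
  by (rule l2_eqI) simp

lemma norm_shift: "norm (shift i f) = norm f"
  using cinner_shift[of i f "shift i f"]
  by (simp only: annihilation_shift cinner_self of_real_eq_iff) simp

lemma bounded_clinear_shift: "bounded_clinear (shift i)"
  by (rule bounded_clinearI[of _ 1]) (auto intro!: word_l2_eqI simp: norm_shift)

lemma cadjoint_shift: "cadjoint (shift i) = annihilation i"
  by (rule cadjointI) (rule cinner_shift)

lemma bounded_clinear_annihilation: "bounded_clinear (annihilation i)"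
  using bounded_clinear_cadjoint[OF bounded_clinear_shift[of i]] by (simp add: cadjoint_shift)

lemma shift_tensor: "shift i (f \<otimes>\<^sub>v h) = shift i f \<otimes>\<^sub>v h"
  by (rule word_l2_eqI) (simp_all add: tensor.rep_eq)

text \<open>Stripping and restoring the first letter loses only the empty word: sum S_i S_i^* is I
  minus the vacuum projection, here tensored with the identity.\<close>

lemma sum_shift_annihilation:
  fixes f :: "('n::finite list, 'h::complex_hilbert) l2"
  shows "(\<Sum>i\<in>UNIV. shift i (annihilation i f)) = f - l2_basis [] \<otimes>\<^sub>v Rep_l2 f []"
  by (rule word_l2_eqI) (simp_all add: Rep_l2_sum tensor.rep_eq l2_basis.rep_eq)

lemma shift_basis: "shift i (l2_basis w) = l2_basis (i # w)"
  by (rule word_l2_eqI) (auto simp: l2_basis.rep_eq)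

lemma annihilation_basis: "annihilation i (l2_basis w) = (case w of [] \<Rightarrow> 0 | j # v \<Rightarrow> if j = i then l2_basis v else 0)"
  by (rule l2_eqI) (auto simp: l2_basis.rep_eq split: list.splits)

lemma word_op_append: "word_op T (u @ v) = word_op T u \<circ> word_op T v"
  by (induction u) (simp_all add: comp_assoc)

lemma bounded_clinear_word_op: "(\<And>i. bounded_clinear (T i)) \<Longrightarrow> bounded_clinear (word_op T w)"
  by (induction w) (simp_all only: word_op.simps bounded_clinear_id bounded_clinear_compose)

lemma bounded_clinear_ncpoly_eval:
  "(\<And>i. bounded_clinear (T i)) \<Longrightarrow> bounded_clinear (ncpoly_eval p T)"
  unfolding ncpoly_eval_def
  by (intro bounded_clinear_setsum bounded_clinear_scale bounded_clinear_word_op)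

lemma word_op_shift_basis: "word_op shift u (l2_basis v) = l2_basis (u @ v)"
  by (induction u) (simp_all add: shift_basis)

lemma word_op_ncpoly_eval:
  assumes "\<And>i. bounded_clinear (T i)"
  shows "word_op T a (ncpoly_eval p T (word_op T b x))
    = (\<Sum>w\<in>Poly_Mapping.keys p. Poly_Mapping.lookup p w *\<^sub>C word_op T (a @ w @ b) x)"
  unfolding ncpoly_eval_def
  by (simp add: bounded_clinear_sum bounded_clinear_scaleC bounded_clinear_word_op assms
      word_op_append)

section \<open>The weak operator topology and the algebra F_n^infty\<close>

lemma topspace_wot: "topspace (wot :: ('a::complex_hilbert \<Rightarrow> 'a) topology) = bops UNIV"
  by (simp add: wot_def topspace_pullback_topology)

lemma closedin_wot_coeff:
  fixes x y :: "'a::complex_hilbert"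
  shows "closedin wot {X \<in> bops UNIV. cinner (X x) y = 0}"
proof -
  let ?f = "\<lambda>X (x, y). cinner (X x) (y::'a)"
  have "continuous_map euclidean euclidean (\<lambda>\<phi> :: 'a \<times> 'a \<Rightarrow> complex. \<phi> (x, y))"
    by (simp add: continuous_on_product_coordinates)
  then have "continuous_map wot euclidean ((\<lambda>\<phi>. \<phi> (x, y)) \<circ> ?f)"
    unfolding wot_def by (rule continuous_map_pullback)
  then have "closedin wot {X \<in> topspace wot. ((\<lambda>\<phi>. \<phi> (x, y)) \<circ> ?f) X \<in> {0}}"
    by (rule closedin_continuous_map_preimage) simp
  then show ?thesis by (simp add: topspace_wot)
qed

lemma closedin_wot_coeffs:
  "closedin wot {X \<in> bops UNIV. \<forall>x\<in>S. \<forall>y\<in>R. cinner (X x) y = 0}"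
proof (cases "S = {} \<or> R = {}")
  \<comment> \<open>An empty family would have all functions as its intersection instead of the
    topspace.\<close>
  case True
  then have "{X \<in> bops UNIV. \<forall>x\<in>S. \<forall>y\<in>R. cinner (X x) y = 0} = topspace wot"
    by (auto simp: topspace_wot)
  then show ?thesis by (simp only: closedin_topspace)
next
  case False
  then have "{X \<in> bops UNIV. \<forall>x\<in>S. \<forall>y\<in>R. cinner (X x) y = 0}
      = \<Inter>((\<lambda>(x, y). {X \<in> bops UNIV. cinner (X x) y = 0}) ` (S \<times> R))"
    by auto
  moreover have "closedin wot (\<Inter>((\<lambda>(x, y). {X \<in> bops UNIV. cinner (X x) y = 0}) ` (S \<times> R)))"
    using False by (intro closedin_Inter) (auto intro: closedin_wot_coeff)
  ultimately show ?thesis by simp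
qed

lemma analytic_toeplitz_props:
  shows analytic_toeplitz_bops: "analytic_toeplitz \<subseteq> bops (UNIV :: 'n fock set)"
    and closedin_analytic_toeplitz: "closedin wot (analytic_toeplitz :: ('n fock \<Rightarrow> 'n fock) set)"
    and subalgebra_analytic_toeplitz: "subalgebra (analytic_toeplitz :: ('n fock \<Rightarrow> 'n fock) set)"
    and id_analytic_toeplitz: "id \<in> (analytic_toeplitz :: ('n fock \<Rightarrow> 'n fock) set)"
    and shift_analytic_toeplitz: "shift i \<in> (analytic_toeplitz :: ('n fock \<Rightarrow> 'n fock) set)"
proof -
  let ?\<A> = "{A :: ('n fock \<Rightarrow> 'n fock) set. A \<subseteq> bops UNIV \<and> closedin wot A \<and> subalgebra A \<and>
    id \<in> A \<and> range creation \<subseteq> A}"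
  have "closedin wot (bops (UNIV :: 'n fock set))" by (metis topspace_wot closedin_topspace)
  \<comment> \<open>The family is nonempty, so its intersection consists of bounded operators and is
    closed in the topology.\<close>
  then have mem: "bops UNIV \<in> ?\<A>"
    by (auto simp: bops_UNIV subalgebra_def bounded_clinear_add bounded_clinear_scale
        bounded_clinear_compose bounded_clinear_id creation_eq_shift bounded_clinear_shift)
  then show "analytic_toeplitz \<subseteq> bops (UNIV :: 'n fock set)"
    unfolding analytic_toeplitz_def by blast
  show "closedin wot (analytic_toeplitz :: ('n fock \<Rightarrow> 'n fock) set)"
    unfolding analytic_toeplitz_def using mem by (intro closedin_Inter) auto
  show "subalgebra (analytic_toeplitz :: ('n fock \<Rightarrow> 'n fock) set)"
    unfolding analytic_toeplitz_def subalgebra_def by blast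
  show "id \<in> (analytic_toeplitz :: ('n fock \<Rightarrow> 'n fock) set)"
    unfolding analytic_toeplitz_def by blast
  show "shift i \<in> (analytic_toeplitz :: ('n fock \<Rightarrow> 'n fock) set)"
    unfolding analytic_toeplitz_def creation_eq_shift by blast
qed

lemma analytic_toeplitz_add:
  "X \<in> analytic_toeplitz \<Longrightarrow> Y \<in> analytic_toeplitz \<Longrightarrow> (\<lambda>x. X x + Y x) \<in> analytic_toeplitz"
  and analytic_toeplitz_scale: "X \<in> analytic_toeplitz \<Longrightarrow> (\<lambda>x. c *\<^sub>C X x) \<in> analytic_toeplitz"
  and analytic_toeplitz_compose:
  "X \<in> analytic_toeplitz \<Longrightarrow> Y \<in> analytic_toeplitz \<Longrightarrow> X \<circ> Y \<in> analytic_toeplitz"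
  using subalgebra_analytic_toeplitz unfolding subalgebra_def by blast+

lemma analytic_toeplitz_scale_id: "(\<lambda>x. c *\<^sub>C x) \<in> analytic_toeplitz"
  using analytic_toeplitz_scale[OF id_analytic_toeplitz] by simp

lemma analytic_toeplitz_zero: "(\<lambda>_. 0) \<in> analytic_toeplitz"
  using analytic_toeplitz_scale_id[of 0] by simp

lemma word_op_analytic_toeplitz: "word_op shift w \<in> analytic_toeplitz"
  by (induction w)
     (simp_all only: word_op.simps id_analytic_toeplitz shift_analytic_toeplitz analytic_toeplitz_compose)

lemma ncpoly_eval_analytic_toeplitz: "ncpoly_eval p shift \<in> analytic_toeplitz"
proof -
  have "(\<lambda>x. \<Sum>w\<in>S. c w *\<^sub>C word_op shift w x) \<in> analytic_toeplitz"
    for S and c :: "'a list \<Rightarrow> complex"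
  proof (induction S rule: infinite_finite_induct)
    case (insert w S)
    have "(\<lambda>x. c w *\<^sub>C word_op shift w x) \<in> analytic_toeplitz"
      by (rule analytic_toeplitz_scale[OF word_op_analytic_toeplitz])
    from analytic_toeplitz_add[OF this insert(3)] show ?case using insert(1,2) by simp
  qed (simp_all add: analytic_toeplitz_zero)
  then show ?thesis by (simp add: ncpoly_eval_def[abs_def])
qed

text \<open>Supplies a member of the family intersected in \<open>wot_ideal_generated\<close>, which
  places J inside F_n^infty.\<close>

lemma wot_ideal_analytic_toeplitz: "wot_ideal (analytic_toeplitz :: ('n fock \<Rightarrow> 'n fock) set)"
  using closedin_analytic_toeplitz subalgebra_analytic_toeplitz analytic_toeplitz_zero
  unfolding wot_ideal_def subalgebra_def by blast

text \<open>Coordinate form of <S_a p(S) e_b, v>.\<close>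

abbreviation ncpoly_pairing :: "'n ncpoly \<Rightarrow> 'n fock \<Rightarrow> 'n list \<Rightarrow> 'n list \<Rightarrow> complex"
  where "ncpoly_pairing p v a b \<equiv>
    \<Sum>w\<in>Poly_Mapping.keys p. Poly_Mapping.lookup p w * cnj (Rep_l2 v (a @ w @ b))"

text \<open>
  \<open>v\<close> lies in this space iff \<open>v\<close> is orthogonal to all \<open>S\<^sub>a p(S) e\<^sub>b\<close>.
\<close>

definition variety_coeffs :: "'n ncpoly set \<Rightarrow> 'n fock set"
  where "variety_coeffs P = {v. \<forall>p\<in>P. \<forall>a b. ncpoly_pairing p v a b = 0}"

lemma variety_coeffsD:
  "v \<in> variety_coeffs P \<Longrightarrow> p \<in> P \<Longrightarrow> ncpoly_pairing p v a b = 0"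
  unfolding variety_coeffs_def by blast

lemma cinner_word_ncpoly_basis:
  "cinner (word_op shift a (ncpoly_eval p shift (l2_basis b))) v
    = ncpoly_pairing p v a b"
proof -
  have "word_op shift a (ncpoly_eval p shift (l2_basis b))
      = word_op shift a (ncpoly_eval p shift (word_op shift b (l2_basis [])))"
    by (simp add: word_op_shift_basis)
  also have "\<dots> = (\<Sum>w\<in>Poly_Mapping.keys p. Poly_Mapping.lookup p w *\<^sub>C l2_basis (a @ w @ b))"
    by (subst word_op_ncpoly_eval) (simp_all add: bounded_clinear_shift word_op_shift_basis)
  finally show ?thesis
    by (simp add: cinner_sum_left cinner_scaleC_left cinner_l2_basis')
qed

text \<open>The letter i is absorbed into the free prefix a. This is co-invariance of the
  constrained space under the creation operators.\<close>

lemma annihilation_variety_coeffs: "v \<in> variety_coeffs P \<Longrightarrow> annihilation i v \<in> variety_coeffs P"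
  unfolding variety_coeffs_def by (auto simp flip: append_Cons)

text \<open>
  The operators in \<open>F\<^sub>n\<^sup>\<infinity>\<close> with range orthogonal to \<open>variety_coeffs P\<close> form a WOT-closed
  ideal, because \<open>F\<^sub>n\<^sup>\<infinity>\<close> leaves the orthogonal complement invariant.
\<close>

lemma variety_space_eq:
  fixes P :: "'n ncpoly set"
  assumes J: "J = wot_ideal_generated ((\<lambda>p. ncpoly_eval p creation) ` P)"
  shows "variety_space J = variety_coeffs P"
proof
  let ?N = "variety_coeffs P"
  have Jsub: "J \<subseteq> J'" if "wot_ideal J'" "(\<lambda>p. ncpoly_eval p shift) ` P \<subseteq> J'" for J'
    using that by (auto simp: J wot_ideal_generated_def creation_eq_shift)
  have PJ: "ncpoly_eval p shift \<in> J" if "p \<in> P" for p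
    using that by (auto simp: J wot_ideal_generated_def creation_eq_shift)
  have left: "A \<circ> X \<in> J" if "A \<in> analytic_toeplitz" "X \<in> J" for A X
    using that by (auto simp: J wot_ideal_generated_def wot_ideal_def)
  have vs: "variety_space J = orth_compl {X f |X f. X \<in> J}"
    by (simp add: variety_space_def orth_compl_cspan)
  show "variety_space J \<subseteq> ?N"
  proof
    fix v assume v: "v \<in> variety_space J"
    have "cinner (word_op shift a (ncpoly_eval p shift (l2_basis b))) v = 0" if "p \<in> P" for p a b
    proof -
      have "(word_op shift a \<circ> ncpoly_eval p shift) (l2_basis b) \<in> {X f |X f. X \<in> J}"
        using left[OF word_op_analytic_toeplitz PJ[OF that]] by blast
      then show ?thesis using cinner_orth(2)[of v "{X f |X f. X \<in> J}"] v by (simp add: vs)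
    qed
    then show "v \<in> ?N" by (simp add: variety_coeffs_def flip: cinner_word_ncpoly_basis)
  qed
  \<comment> \<open>Operators leaving the complement of the candidate invariant. Written through
    coefficients, C is visibly WOT-closed; as an algebra containing I and the S_i it contains
    F_n^infty.\<close>
  define C where "C = {X \<in> bops UNIV. \<forall>x\<in>orth_compl ?N. \<forall>y\<in>?N. cinner (X x) y = 0}"
  have C_iff: "X \<in> C \<longleftrightarrow> bounded_clinear X \<and> (\<forall>x\<in>orth_compl ?N. X x \<in> orth_compl ?N)" for X
    by (auto simp: C_def bops_UNIV orth_compl_def)
  have cs: "csubspace (orth_compl ?N)" by (simp add: closed_csubspaceD)
  have "shift i \<in> C" for i
    by (auto simp: C_def bops_UNIV bounded_clinear_shift cinner_shift
        intro!: cinner_orth(1)[of _ ?N] annihilation_variety_coeffs)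
  moreover have "closedin wot C" unfolding C_def by (rule closedin_wot_coeffs)
  moreover have "subalgebra C" "id \<in> C"
    by (auto simp: C_iff subalgebra_def bounded_clinear_add bounded_clinear_scale
        bounded_clinear_compose bounded_clinear_id csubspace_add[OF cs] csubspace_scaleC[OF cs])
  moreover have "C \<subseteq> bops UNIV" by (auto simp: C_def)
  ultimately have "analytic_toeplitz \<subseteq> C"
    unfolding analytic_toeplitz_def creation_eq_shift
    by (intro Inter_lower CollectI conjI image_subsetI)
  then have inv: "A x \<in> orth_compl ?N" if "A \<in> analytic_toeplitz" "x \<in> orth_compl ?N" for A x
    using that C_iff by blast
  define J' where "J' = {X \<in> analytic_toeplitz. \<forall>f. X f \<in> orth_compl ?N}"
  have J'_eq: "J' = analytic_toeplitz \<inter> {X \<in> bops UNIV. \<forall>f\<in>UNIV. \<forall>v\<in>?N. cinner (X f) v = 0}"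
    using analytic_toeplitz_bops by (auto simp: J'_def orth_compl_def)
  have "closedin wot J'"
    unfolding J'_eq by (rule closedin_Int[OF closedin_analytic_toeplitz closedin_wot_coeffs])
  then have "wot_ideal J'"
    by (auto simp: wot_ideal_def J'_def analytic_toeplitz_zero analytic_toeplitz_add
        analytic_toeplitz_compose inv csubspace_add[OF cs] csubspace_0[OF cs]
        analytic_toeplitz_compose[unfolded o_def])
  moreover have "ncpoly_eval p shift \<in> J'" if p: "p \<in> P" for p
  proof -
    have "ncpoly_eval p shift f \<in> orth_compl ?N" for f
    proof -
      have "cinner (ncpoly_eval p shift (l2_basis b)) v = 0" if "v \<in> ?N" for b v
        using cinner_word_ncpoly_basis[of "[]" p b v] variety_coeffsD[OF that p, of "[]" b] by simp
      then have "range l2_basis \<subseteq> {f. ncpoly_eval p shift f \<in> orth_compl ?N}"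
        by (auto simp: orth_compl_def)
      then have "closed_cspan (range l2_basis) \<subseteq> {f. ncpoly_eval p shift f \<in> orth_compl ?N}"
        by (rule closed_cspan_minimal)
           (intro closed_csubspace_vimage bounded_clinear_ncpoly_eval bounded_clinear_shift
             closed_csubspace_orth_compl)
      then show ?thesis by (auto simp: closed_cspan_l2_basis)
    qed
    then show ?thesis by (simp add: J'_def ncpoly_eval_analytic_toeplitz)
  qed
  ultimately have "J \<subseteq> J'" using Jsub by blast
  then have "X f \<in> orth_compl ?N" if "X \<in> J" for X f using that by (auto simp: J'_def)
  then have "cinner v (X f) = 0" if "X \<in> J" "v \<in> ?N" for X f v using cinner_orth(2) that by blast
  then show "?N \<subseteq> variety_space J" by (auto simp: vs orth_compl_def)
qed

text \<open>A homogeneous polynomial with nonzero constant term is a nonzero scalar, which would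
  generate all of F_n^infty. So constant terms vanish, and with them the pairings with the vacuum,
  which see only a = w = b = [].\<close>

lemma vacuum_in_variety:
  fixes P :: "'n ncpoly set"
  assumes J: "J = wot_ideal_generated ((\<lambda>p. ncpoly_eval p creation) ` P)"
    and homog: "\<forall>p\<in>P. homogeneous p" and proper: "J \<noteq> analytic_toeplitz"
  shows "l2_basis [] \<in> variety_coeffs P"
proof -
  have "Poly_Mapping.lookup p [] = 0" if p: "p \<in> P" for p
  proof (rule ccontr)
    assume c: "Poly_Mapping.lookup p [] \<noteq> 0"
    then have nil: "[] \<in> Poly_Mapping.keys p" by (simp add: in_keys_iff)
    obtain k where k: "\<And>w. w \<in> Poly_Mapping.keys p \<Longrightarrow> length w = k"
      using homog p by (auto simp: homogeneous_def)
    then have "k = 0" using nil by force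
    then have "Poly_Mapping.keys p = {[]}" using k nil by auto
    then have eval: "ncpoly_eval p shift = (\<lambda>x. Poly_Mapping.lookup p [] *\<^sub>C x)"
      by (simp add: ncpoly_eval_def[abs_def])
    have "analytic_toeplitz \<subseteq> J'" if J': "wot_ideal J'" "(\<lambda>p. ncpoly_eval p shift) ` P \<subseteq> J'" for J'
    proof
      fix A :: "'n fock \<Rightarrow> 'n fock" assume A: "A \<in> analytic_toeplitz"
      have pJ: "ncpoly_eval p shift \<in> J'" using J' p by blast
      have mult: "X \<circ> Y \<in> J'" if "X \<in> analytic_toeplitz" "Y \<in> J'" for X Y
        using J'(1) that by (simp add: wot_ideal_def)
      have "A \<circ> ((\<lambda>x. (1 / Poly_Mapping.lookup p []) *\<^sub>C x) \<circ> ncpoly_eval p shift) \<in> J'"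
        by (intro mult A analytic_toeplitz_scale_id pJ)
      then show "A \<in> J'" using c by (simp add: eval scaleC_scaleC o_def)
    qed
    then have "analytic_toeplitz \<subseteq> J"
      by (auto simp: J wot_ideal_generated_def creation_eq_shift)
    moreover have "J \<subseteq> analytic_toeplitz"
      using wot_ideal_analytic_toeplitz ncpoly_eval_analytic_toeplitz
      by (auto simp: J wot_ideal_generated_def creation_eq_shift)
    ultimately show False using proper by blast
  qed
  then show ?thesis
    by (auto simp: variety_coeffs_def l2_basis.rep_eq intro!: sum.neutral)
qed

section \<open>Row contractions\<close>

lemma tensor_add_left: "(a + b) \<otimes>\<^sub>v f = a \<otimes>\<^sub>v f + b \<otimes>\<^sub>v f"
  by (rule l2_eqI) (simp add: tensor.rep_eq scaleC_add_left)

lemma tensor_scaleC_left: "(c *\<^sub>C a) \<otimes>\<^sub>v f = c *\<^sub>C (a \<otimes>\<^sub>v f)"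
  by (rule l2_eqI) (simp add: tensor.rep_eq scaleC_scaleC scaleC_complex_def)

lemma tensor_zero_right [simp]: "a \<otimes>\<^sub>v 0 = 0"
  by (rule l2_eqI) (simp add: tensor.rep_eq)

lemma norm_tensor: "norm (a \<otimes>\<^sub>v f) = norm a * norm f"
proof -
  have "complex_of_real ((norm (a \<otimes>\<^sub>v f))\<^sup>2) = complex_of_real ((norm a * norm f)\<^sup>2)"
    using cinner_tensor[of a f a f] unfolding cinner_self by (simp add: power_mult_distrib)
  then have "(norm (a \<otimes>\<^sub>v f))\<^sup>2 = (norm a * norm f)\<^sup>2" using of_real_eq_iff by blast
  then show ?thesis by (simp add: power2_eq_iff_nonneg)
qed

lemma bounded_clinear_tensor_left: "bounded_clinear (\<lambda>a. a \<otimes>\<^sub>v f)"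
  by (rule bounded_clinearI[of _ "norm f"])
     (simp_all add: tensor_add_left tensor_scaleC_left norm_tensor mult.commute)

lemma bounded_clinear_tensor_right: "bounded_clinear (\<lambda>h. a \<otimes>\<^sub>v h)"
  by (rule bounded_clinearI[of _ "norm a"])
     (auto intro!: l2_eqI simp: tensor.rep_eq scaleC_add_right scaleC_scaleC norm_tensor mult.commute)

section \<open>Sums over words of a given length\<close>

lemma finite_words_of_length: "finite {w :: 'n::finite list. length w = l}"
  using finite_lists_length_eq[of "UNIV :: 'n set" l] by simp

lemma sum_words_Suc_Cons:
  fixes f :: "'n::finite list \<Rightarrow> 'a::comm_monoid_add"
  shows "(\<Sum>w | length w = Suc l. f w) = (\<Sum>i\<in>UNIV. \<Sum>w | length w = l. f (i # w))"
proof -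
  have "(\<Sum>i\<in>UNIV. \<Sum>w | length w = l. f (i # w))
      = (\<Sum>(i, w)\<in>UNIV \<times> {w. length w = l}. f (i # w))"
    by (simp add: sum.cartesian_product)
  also have "\<dots> = (\<Sum>w | length w = Suc l. f w)"
    by (rule sum.reindex_bij_witness[where i = "\<lambda>w. (hd w, tl w)" and j = "\<lambda>(i, w). i # w"])
       (auto simp: length_Suc_conv)
  finally show ?thesis by simp
qed

text \<open>The last letter is the outermost adjoint in \<open>Ts (w @ [i])\<close>, so this
  splitting serves the mass recursion; the first-letter version serves
  \<open>annihilation\<close>.\<close>

lemma sum_words_Suc_snoc:
  fixes f :: "'n::finite list \<Rightarrow> 'a::comm_monoid_add"
  shows "(\<Sum>w | length w = Suc l. f w) = (\<Sum>w | length w = l. \<Sum>i\<in>UNIV. f (w @ [i]))"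
proof -
  have "(\<Sum>w | length w = l. \<Sum>i\<in>UNIV. f (w @ [i]))
      = (\<Sum>(w, i)\<in>{w. length w = l} \<times> UNIV. f (w @ [i]))"
    by (simp add: sum.cartesian_product)
  also have "\<dots> = (\<Sum>w | length w = Suc l. f w)"
    by (rule sum.reindex_bij_witness[where i = "\<lambda>w. (butlast w, last w)" and j = "\<lambda>(w, i). w @ [i]"])
       (auto simp flip: append_butlast_last_id, metis append_butlast_last_id length_0_conv nat.distinct(1))
  finally show ?thesis by simp
qed

text \<open>
  \<open>p(T) = 0\<close> makes the Poisson kernel satisfy the linear relations defining the constrained Fock
  space; the weight \<open>c\<close> on the levels is harmless because \<open>p\<close> is homogeneous.
\<close>

lemma annihilated_in_variety:
  fixes P :: "'n ncpoly set" and T :: "'n \<Rightarrow> 'h::complex_hilbert \<Rightarrow> 'h"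
  assumes homog: "\<forall>p\<in>P. homogeneous p" and zero: "\<forall>p\<in>P. ncpoly_eval p T = (\<lambda>_. 0)"
    and T: "\<And>i. bounded_clinear (T i)"
    and v: "\<And>w. Rep_l2 v w = c (length w) * cinner (cadjoint (word_op T w) h) k"
  shows "v \<in> variety_coeffs P"
  unfolding variety_coeffs_def
proof (intro CollectI ballI allI)
  fix p a b assume p: "p \<in> P"
  obtain m where m: "\<And>w. w \<in> Poly_Mapping.keys p \<Longrightarrow> length w = m"
    using homog p by (auto simp: homogeneous_def)
  note Tw = bounded_clinear_word_op[of T, OF T]
  have adj: "cnj (cinner (cadjoint (word_op T w) h) k) = cinner (word_op T w k) h" for w
    by (simp add: cinner_cadjoint[OF Tw] flip: cinner_commute)
  have "ncpoly_pairing p v a b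
      = (\<Sum>w\<in>Poly_Mapping.keys p. cnj (c (length a + m + length b)) *
          cinner (Poly_Mapping.lookup p w *\<^sub>C word_op T (a @ w @ b) k) h)"
    by (intro sum.cong refl) (simp add: v m adj cinner_scaleC_left add.assoc mult_ac)
  also have "\<dots> = cnj (c (length a + m + length b)) *
      cinner (word_op T a (ncpoly_eval p T (word_op T b k))) h"
    by (simp add: word_op_ncpoly_eval[of T, OF T] cinner_sum_left sum_distrib_left)
  also have "\<dots> = 0" using zero p clinear_simps(4)[OF Tw] by simp
  finally show "ncpoly_pairing p v a b = 0" .
qed

section \<open>Defect operator, level masses and the Poisson kernel\<close>

locale row_contraction_tuple =
  fixes T :: "'n::finite \<Rightarrow> 'h::complex_hilbert \<Rightarrow> 'h"
  assumes row: "row_contraction T"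
begin

text \<open>The operator T_w^*. Taking adjoints reverses the order, so the first letter of w acts
  first.\<close>

definition Ts :: "'n list \<Rightarrow> 'h \<Rightarrow> 'h"
  where "Ts w = cadjoint (word_op T w)"

text \<open>This is <Phi^l(I) h, h> for the completely positive map Phi(X) = sum_i T_i X
  T_i^*.\<close>

definition level_mass :: "nat \<Rightarrow> 'h \<Rightarrow> real"
  where "level_mass l h = (\<Sum>w | length w = l. (norm (Ts w h))\<^sup>2)"

abbreviation "\<Delta> \<equiv> sqrt_op (defect_square T)"

lemma T: "bounded_clinear (T i)" and pos_defect: "pos_op (defect_square T)"
  using row by (auto simp: row_contraction_def)

lemma Ts_simps: "Ts [] h = h" "Ts (i # w) h = Ts w (cadjoint (T i) h)"
  "Ts (w @ [i]) h = cadjoint (T i) (Ts w h)"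
  by (simp_all add: Ts_def cadjoint_id word_op_append cadjoint_compose T bounded_clinear_word_op
      bounded_clinear_compose bounded_clinear_id del: id_apply)
     (simp_all add: id_def)

lemma bounded_clinear_Ts: "bounded_clinear (Ts w)"
  by (simp add: Ts_def bounded_clinear_cadjoint bounded_clinear_word_op T)

lemmas Ts_lin = clinear_simps[OF bounded_clinear_Ts]

lemma cinner_defect:
  "cinner (defect_square T h) k = cinner h k - (\<Sum>i\<in>UNIV. cinner (cadjoint (T i) h) (cadjoint (T i) k))"
  by (simp add: defect_square_def cinner_diff_left cinner_sum_left cinner_cadjoint[OF T])

lemma Re_cinner_defect:
  "Re (cinner (defect_square T h) h) = (norm h)\<^sup>2 - (\<Sum>i\<in>UNIV. (norm (cadjoint (T i) h))\<^sup>2)"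
  by (simp add: cinner_defect cinner_self)

lemma sum_norm_adjoint_le: "(\<Sum>i\<in>UNIV. (norm (cadjoint (T i) h))\<^sup>2) \<le> (norm h)\<^sup>2"
  using pos_op_Re[OF pos_defect, of h] by (simp add: Re_cinner_defect)

text \<open>With z = sum T_i T_i^* h, |z|^2 = Re sum <T_i^* h, T_i^* z> is at most (|h|^2 + |z|^2) /
  2 by the row condition at both h and z. \<open>sqrt_op_props\<close> asks for this
  contractivity.\<close>

lemma norm_diff_defect_le: "norm (h - defect_square T h) \<le> norm h"
proof -
  define z where "z = h - defect_square T h"
  have "complex_of_real ((norm z)\<^sup>2) = (\<Sum>i\<in>UNIV. cinner (cadjoint (T i) h) (cadjoint (T i) z))"
    unfolding cinner_self[symmetric]
    by (subst (1) z_def) (simp add: cinner_diff_left cinner_defect)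
  then have "(norm z)\<^sup>2 = Re (\<Sum>i\<in>UNIV. cinner (cadjoint (T i) h) (cadjoint (T i) z))"
    by (metis Re_complex_of_real)
  also have "\<dots> = (\<Sum>i\<in>UNIV. Re (cinner (cadjoint (T i) h) (cadjoint (T i) z)))" by simp
  also have "\<dots> \<le> (\<Sum>i\<in>UNIV. ((norm (cadjoint (T i) h))\<^sup>2 + (norm (cadjoint (T i) z))\<^sup>2) / 2)"
  proof (rule sum_mono)
    fix i
    have "Re (cinner (cadjoint (T i) h) (cadjoint (T i) z))
        \<le> norm (cadjoint (T i) h) * norm (cadjoint (T i) z)"
      using cmod_cinner_le complex_Re_le_cmod order_trans by blast
    also have "\<dots> \<le> ((norm (cadjoint (T i) h))\<^sup>2 + (norm (cadjoint (T i) z))\<^sup>2) / 2"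
      using sum_squares_bound[of "norm (cadjoint (T i) h)" "norm (cadjoint (T i) z)"] by simp
    finally show "Re (cinner (cadjoint (T i) h) (cadjoint (T i) z))
        \<le> ((norm (cadjoint (T i) h))\<^sup>2 + (norm (cadjoint (T i) z))\<^sup>2) / 2" .
  qed
  also have "\<dots> \<le> ((norm h)\<^sup>2 + (norm z)\<^sup>2) / 2"
    using sum_norm_adjoint_le[of h] sum_norm_adjoint_le[of z]
    by (simp add: sum.distrib flip: sum_divide_distrib)
  finally have "(norm z)\<^sup>2 \<le> (norm h)\<^sup>2" by simp
  then show ?thesis by (simp add: z_def)
qed

lemma pos_defect_op: "pos_op \<Delta>" and defect_op_square: "\<Delta> (\<Delta> h) = defect_square T h"
  using sqrt_op_props[OF pos_defect norm_diff_defect_le] by auto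

lemmas defect_op_lin = clinear_simps[OF pos_op_bounded[OF pos_defect_op]]

lemma norm_defect_op: "(norm (\<Delta> h))\<^sup>2 = (norm h)\<^sup>2 - (\<Sum>i\<in>UNIV. (norm (cadjoint (T i) h))\<^sup>2)"
proof -
  have "cinner (\<Delta> h) (\<Delta> h) = cinner (defect_square T h) h"
    using pos_op_selfadjoint[OF pos_defect_op, of "\<Delta> h" h] by (simp add: defect_op_square)
  then show ?thesis by (metis Re_cinner_defect Re_complex_of_real cinner_self)
qed

lemma level_mass_0: "level_mass 0 h = (norm h)\<^sup>2"
  by (simp add: level_mass_def Ts_simps)

text \<open>The Poisson mass on level l is the drop in level mass, so the sum over all levels
  telescopes.\<close>

lemma defect_level_mass:
  "(\<Sum>w | length w = l. (norm (\<Delta> (Ts w h)))\<^sup>2) = level_mass l h - level_mass (Suc l) h"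
  by (simp add: norm_defect_op sum_subtractf level_mass_def sum_words_Suc_snoc Ts_simps)

lemma level_mass_nonneg: "0 \<le> level_mass l h"
  by (simp add: level_mass_def sum_nonneg)

lemma level_mass_antimono: "decseq (\<lambda>l. level_mass l h)"
proof (rule decseq_SucI)
  fix l
  have "0 \<le> (\<Sum>w | length w = l. (norm (\<Delta> (Ts w h)))\<^sup>2)" by (simp add: sum_nonneg)
  then show "level_mass (Suc l) h \<le> level_mass l h" by (simp add: defect_level_mass)
qed

lemma level_mass_le: "level_mass l h \<le> (norm h)\<^sup>2"
  using decseqD[OF level_mass_antimono, of 0 l h] by (simp add: level_mass_0)

text \<open>The quadratic form of the limit of the decreasing sequence Phi^l(I).\<close>

definition residual_mass :: "'h \<Rightarrow> real"
  where "residual_mass h = lim (\<lambda>l. level_mass l h)"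

lemma level_mass_tendsto: "(\<lambda>l. level_mass l h) \<longlonglongrightarrow> residual_mass h"
proof -
  have "\<forall>l. 0 \<le> level_mass l h" by (simp add: level_mass_nonneg)
  then obtain L where "(\<lambda>l. level_mass l h) \<longlonglongrightarrow> L"
    by (rule decseq_convergent[OF level_mass_antimono])
  then show ?thesis by (simp add: residual_mass_def limI)
qed

lemma short_words: "{w :: 'n list. length w < Suc L} = {w. length w < L} \<union> {w. length w = L}"
  by auto

lemma finite_short_words: "finite {w :: 'n list. length w < L}"
proof (induction L)
  case (Suc L)
  then show ?case by (simp only: short_words finite_Un finite_words_of_length)
qed simp

lemma defect_short_mass:
  "(\<Sum>w | length w < L. (norm (\<Delta> (Ts w h)))\<^sup>2) = (norm h)\<^sup>2 - level_mass L h"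
proof (induction L)
  case (Suc L)
  have "(\<Sum>w | length w < Suc L. (norm (\<Delta> (Ts w h)))\<^sup>2)
      = (\<Sum>w | length w < L. (norm (\<Delta> (Ts w h)))\<^sup>2) + (\<Sum>w | length w = L. (norm (\<Delta> (Ts w h)))\<^sup>2)"
    unfolding short_words
    by (rule sum.union_disjoint[OF finite_short_words finite_words_of_length]) auto
  then show ?case by (simp add: Suc defect_level_mass)
qed (simp add: level_mass_0)

text \<open>Balls in word length eventually contain every finite set of words, so an unconditional
  sum over words may be computed as a limit over the length.\<close>

lemma filterlim_short_words: "filterlim (\<lambda>L. {w :: 'n list. length w < L}) (finite_subsets_at_top UNIV) sequentially"
  unfolding filterlim_finite_subsets_at_top
proof (intro allI impI)
  fix X :: "'n list set" assume X: "finite X \<and> X \<subseteq> UNIV"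
  have "X \<subseteq> {w. length w < L}" if "L > Max (length ` X)" for L
  proof
    fix w assume "w \<in> X"
    then have "length w \<le> Max (length ` X)" using X by simp
    then show "w \<in> {w. length w < L}" using that by simp
  qed
  then show "\<forall>\<^sub>F L in sequentially. finite {w :: 'n list. length w < L} \<and> X \<subseteq> {w. length w < L}
      \<and> {w. length w < L} \<subseteq> UNIV"
    by (intro eventually_mono[OF eventually_gt_at_top[of "Max (length ` X)"]])
       (simp add: finite_short_words)
qed

lemma defect_summable: "(\<lambda>w. (norm (\<Delta> (Ts w h)))\<^sup>2) summable_on UNIV"
proof (rule nonneg_bdd_above_summable_on)
  have "(\<Sum>w\<in>F. (norm (\<Delta> (Ts w h)))\<^sup>2) \<le> (norm h)\<^sup>2" if F: "finite F" for F
  proof -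
    have "F \<subseteq> {w. length w < Suc (Max (length ` F))}" using F by (auto simp: less_Suc_eq_le)
    then have "(\<Sum>w\<in>F. (norm (\<Delta> (Ts w h)))\<^sup>2)
        \<le> (\<Sum>w | length w < Suc (Max (length ` F)). (norm (\<Delta> (Ts w h)))\<^sup>2)"
      by (intro sum_mono2 finite_short_words) auto
    also have "\<dots> \<le> (norm h)\<^sup>2" by (simp add: defect_short_mass level_mass_nonneg del: length_greater_0_conv)
    finally show ?thesis .
  qed
  then show "bdd_above (sum (\<lambda>w. (norm (\<Delta> (Ts w h)))\<^sup>2) ` {F. F \<subseteq> UNIV \<and> finite F})"
    by (auto simp: bdd_above_def)
qed simp

definition poisson :: "'h \<Rightarrow> ('n list, 'h) l2"
  where "poisson h = Abs_l2 (\<lambda>w. \<Delta> (Ts w h))"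

lemma Rep_poisson [simp]: "Rep_l2 (poisson h) w = \<Delta> (Ts w h)"
  using Abs_l2_inverse'[OF defect_summable[of h]] by (simp add: poisson_def)

lemma norm_poisson: "(norm (poisson h))\<^sup>2 = (norm h)\<^sup>2 - residual_mass h"
proof -
  have "((\<lambda>w. (norm (\<Delta> (Ts w h)))\<^sup>2) has_sum (norm (poisson h))\<^sup>2) UNIV"
    unfolding norm_l2_eq Rep_poisson using defect_summable by (rule has_sum_infsum)
  then have "(\<lambda>L. \<Sum>w | length w < L. (norm (\<Delta> (Ts w h)))\<^sup>2) \<longlonglongrightarrow> (norm (poisson h))\<^sup>2"
    unfolding has_sum_def using filterlim_short_words by (rule filterlim_compose)
  moreover have "(\<lambda>L. (norm h)\<^sup>2 - level_mass L h) \<longlonglongrightarrow> (norm h)\<^sup>2 - residual_mass h"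
    by (intro tendsto_diff tendsto_const level_mass_tendsto)
  ultimately show ?thesis by (simp add: defect_short_mass LIMSEQ_unique)
qed

lemma annihilation_poisson: "annihilation i (poisson h) = poisson (cadjoint (T i) h)"
  by (rule l2_eqI) (simp add: Ts_simps)

lemma residual_mass_nonneg: "0 \<le> residual_mass h"
  by (rule LIMSEQ_le_const[OF level_mass_tendsto]) (use level_mass_nonneg in blast)

lemma bounded_clinear_poisson: "bounded_clinear poisson"
proof (rule bounded_clinearI[of _ 1])
  have "(norm (poisson h))\<^sup>2 \<le> (norm h)\<^sup>2" for h
    using residual_mass_nonneg[of h] by (simp only: norm_poisson)
  then show "norm (poisson h) \<le> 1 * norm h" for h by (simp add: power2_le_iff_abs_le)
qed (auto intro!: l2_eqI simp: Ts_lin defect_op_lin)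

end

section \<open>The asymptotic part of a row contraction\<close>

text \<open>Finite combinations of basis vectors are eventually orthogonal to u m; density and the
  norm bound then give weak convergence to 0.\<close>

lemma cinner_vanishing_support:
  fixes u :: "nat \<Rightarrow> 'n fock"
  assumes u: "\<And>m. norm (u m) \<le> 1" and z: "\<And>m w. length w < m \<Longrightarrow> Rep_l2 (u m) w = 0"
  shows "(\<lambda>m. cinner f (u m)) \<longlonglongrightarrow> 0"
proof (rule LIMSEQ_I)
  fix e :: real assume e: "0 < e"
  define H where "H = {g. \<exists>m0. \<forall>m\<ge>m0. cinner g (u m) = 0}"
  have "csubspace H"
    unfolding csubspace_def
  proof (intro conjI ballI allI)
    fix g g' assume "g \<in> H" "g' \<in> H"
    then obtain m0 m0' where "\<forall>m\<ge>m0. cinner g (u m) = 0" "\<forall>m\<ge>m0'. cinner g' (u m) = 0"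
      by (auto simp: H_def)
    then show "g + g' \<in> H"
      unfolding H_def by (intro CollectI exI[of _ "max m0 m0'"]) (simp add: cinner_add_left)
  qed (auto simp: H_def cinner_scaleC_left)
  moreover have "range l2_basis \<subseteq> H"
  proof (rule image_subsetI)
    fix w :: "'n list"
    have "\<forall>m\<ge>Suc (length w). cinner (l2_basis w) (u m) = 0" by (simp add: cinner_l2_basis' z)
    then show "l2_basis w \<in> H" unfolding H_def by blast
  qed
  ultimately have "csubspace hull (range l2_basis) \<subseteq> H" by (rule hull_minimal[rotated])
  then have "f \<in> closure H"
    using closed_cspan_l2_basis closure_mono unfolding closed_cspan_def by blast
  then obtain g where g: "g \<in> H" "dist g f < e" using e closure_approachable by blast
  then obtain m0 where m0: "\<And>m. m \<ge> m0 \<Longrightarrow> cinner g (u m) = 0" by (auto simp: H_def)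
  have "norm (cinner f (u m) - 0) < e" if "m \<ge> m0" for m
  proof -
    have "cinner f (u m) = cinner (f - g) (u m)" using m0[OF that] by (simp add: cinner_diff_left)
    then have "norm (cinner f (u m)) \<le> norm (f - g) * norm (u m)" by (metis cmod_cinner_le)
    also have "\<dots> \<le> norm (f - g) * 1" by (intro mult_left_mono u) simp
    finally show ?thesis using g(2) by (simp add: dist_norm norm_minus_commute)
  qed
  then show "\<exists>m0. \<forall>m\<ge>m0. norm (cinner f (u m) - 0) < e" by blast
qed

text \<open>Otherwise there are unit vectors with supports moving to infinity whose images under Y
  keep norm at least e. They tend weakly to 0, and a compact operator would send a subsequence of
  them to 0 in norm.\<close>

lemma compact_op_tail:
  fixes Y :: "'n fock \<Rightarrow> 'n fock"
  assumes Y: "compact_op Y" and e: "0 < e"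
  shows "\<exists>m. \<forall>v. (\<forall>w. length w < m \<longrightarrow> Rep_l2 v w = 0) \<longrightarrow> norm (Y v) \<le> e * norm v"
proof (rule ccontr)
  assume "\<not> ?thesis"
  then have "\<forall>m. \<exists>v. (\<forall>w. length w < m \<longrightarrow> Rep_l2 v w = 0) \<and> e * norm v < norm (Y v)"
    by (auto simp: not_le)
  then obtain v where v0: "\<And>m w. length w < m \<Longrightarrow> Rep_l2 (v m) w = 0"
    and v: "\<And>m. e * norm (v m) < norm (Y (v m))" by metis
  have lin: "bounded_clinear Y" and comp: "compact (closure (Y ` cball 0 1))"
    using Y by (auto simp: compact_op_def)
  have nz: "v m \<noteq> 0" for m using v[of m] clinear_simps(4)[OF lin] by auto
  define u where "u m = complex_of_real (1 / norm (v m)) *\<^sub>C v m" for m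
  have nu: "norm (u m) = 1" for m using nz[of m] by (simp add: u_def norm_scaleC norm_divide)
  have Yu: "e \<le> norm (Y (u m))" for m
    using v[of m] nz[of m]
    by (simp add: u_def bounded_clinear_scaleC[OF lin] norm_scaleC norm_divide field_simps less_imp_le)
  have "Y (u m) \<in> closure (Y ` cball 0 1)" for m
    using nu by (intro closure_subset[THEN subsetD]) auto
  then obtain z r where r: "strict_mono (r :: nat \<Rightarrow> nat)" and z: "((\<lambda>m. Y (u m)) \<circ> r) \<longlonglongrightarrow> z"
    using comp compact_imp_seq_compact unfolding seq_compact_def by metis
  \<comment> \<open>Pairing the images with their own limit z moves Y onto z, where weak convergence
    applies; this forces z = 0.\<close>
  have "(\<lambda>m. cinner (cadjoint Y z) (u m)) \<longlonglongrightarrow> 0"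
    by (rule cinner_vanishing_support) (simp_all add: nu, simp add: u_def v0 scaleC_complex_def)
  then have "(\<lambda>m. cinner z (Y (u (r m)))) \<longlonglongrightarrow> 0"
    using LIMSEQ_subseq_LIMSEQ[OF _ r] by (fastforce simp: cinner_cadjoint'[OF lin] o_def)
  moreover have "(\<lambda>m. cinner z (Y (u (r m)))) \<longlonglongrightarrow> cinner z z"
    using z by (intro tendsto_cinner tendsto_const) (simp add: o_def)
  ultimately have "cinner z z = 0" using LIMSEQ_unique by blast
  then have "z = 0" by simp
  moreover have "e \<le> norm z"
    by (rule LIMSEQ_le_const[OF tendsto_norm[OF z]]) (use Yu in auto)
  ultimately show False using e by simp
qed

section \<open>Levels of the Fock space and their averages\<close>

context row_contraction_tuple
begin

text \<open>The multiplicity factor stands first, so the value is a sequence of Fock vectors on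
  which operators act through \<open>amp\<close>.\<close>

definition level :: "('h \<Rightarrow> (nat, complex) l2) \<Rightarrow> nat \<Rightarrow> 'h \<Rightarrow> (nat, 'n fock) l2"
  where "level G l h = (\<Sum>w | length w = l. G (Ts w h) \<otimes>\<^sub>v l2_basis w)"

text \<open>
  Averaging over the levels from \<open>N + 1\<close> to \<open>2 N + 1\<close> makes the boundary terms negligible in the
  intertwining relation, while the support moves to infinity.
\<close>

definition spread :: "('h \<Rightarrow> (nat, complex) l2) \<Rightarrow> nat \<Rightarrow> 'h \<Rightarrow> (nat, 'n fock) l2"
  where "spread G N h = complex_of_real (1 / sqrt (Suc N)) *\<^sub>C (\<Sum>l\<in>{Suc N..<2 * Suc N}. level G l h)"

context
  fixes G :: "'h \<Rightarrow> (nat, complex) l2"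
  assumes G: "bounded_clinear G" and G_iso: "\<And>x y. cinner (G x) (G y) = cinner x y"
begin

lemma cinner_level:
  "cinner (level G l h) (level G m h) = (if l = m then complex_of_real (level_mass l h) else 0)"
proof -
  have "cinner (level G l h) (level G m h)
      = (\<Sum>w | length w = l. \<Sum>u | length u = m. if u = w then complex_of_real ((norm (Ts w h))\<^sup>2) else 0)"
    unfolding level_def cinner_sum_left
    unfolding cinner_sum_right cinner_tensor cinner_l2_basis G_iso
    by (intro sum.cong refl) (auto simp: l2_basis.rep_eq cinner_self)
  also have "\<dots> = (\<Sum>w | length w = l. if length w = m then complex_of_real ((norm (Ts w h))\<^sup>2) else 0)"
    by (simp add: finite_words_of_length)
  also have "\<dots> = (if l = m then complex_of_real (level_mass l h) else 0)"
    by (cases "l = m") (simp_all add: level_mass_def)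
  finally show ?thesis .
qed

lemma norm_level: "norm (level G l h) = sqrt (level_mass l h)"
proof -
  have "complex_of_real ((norm (level G l h))\<^sup>2) = complex_of_real (level_mass l h)"
    using cinner_level[of l h l] by (simp only: cinner_self simp_thms if_True)
  then have "(norm (level G l h))\<^sup>2 = level_mass l h" using of_real_eq_iff by blast
  then show ?thesis by (metis norm_ge_zero real_sqrt_unique)
qed

lemma norm_level_le: "norm (level G l h) \<le> norm h"
  unfolding norm_level by (rule real_le_lsqrt) (simp_all add: level_mass_le)

lemma bounded_clinear_level: "bounded_clinear (level G l)"
  unfolding level_def
  by (intro bounded_clinear_setsum bounded_clinear_compose[OF bounded_clinear_tensor_left
        bounded_clinear_compose[OF G bounded_clinear_Ts], unfolded o_def])

text \<open>For w = i # v, T_w^* h is T_v^* applied to T_i^* h. On a single level the intertwining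
  is thus exact apart from the change of level.\<close>

lemma amp_annihilation_level:
  "amp (annihilation i) (level G (Suc l) h) = level G l (cadjoint (T i) h)"
proof -
  have "amp (annihilation i) (level G (Suc l) h)
      = (\<Sum>j\<in>UNIV. \<Sum>w | length w = l. if j = i then G (Ts w (cadjoint (T i) h)) \<otimes>\<^sub>v l2_basis w else 0)"
    unfolding level_def bounded_clinear_sum[OF bounded_clinear_amp[OF bounded_clinear_annihilation]]
      amp_tensor[OF bounded_clinear_annihilation] sum_words_Suc_Cons
    by (intro sum.cong refl) (auto simp: annihilation_basis Ts_simps)
  also have "\<dots> = (\<Sum>j\<in>UNIV. if j = i then level G l (cadjoint (T i) h) else 0)"
    by (intro sum.cong refl) (auto simp: level_def)
  finally show ?thesis by simp
qed

text \<open>Levels are mutually orthogonal, so the normalisation turns the squared norm into a plain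
  average of \<open>Suc N\<close> level masses.\<close>

lemma norm_spread: "(norm (spread G N h))\<^sup>2 = (\<Sum>l\<in>{Suc N..<2 * Suc N}. level_mass l h) / real (Suc N)"
proof -
  have "cinner (\<Sum>l\<in>S. level G l h) (\<Sum>l\<in>S. level G l h) = complex_of_real (\<Sum>l\<in>S. level_mass l h)"
    if "finite S" for S
    using that by (simp add: cinner_sum_left cinner_sum_right cinner_level)
  from this[OF finite_atLeastLessThan]
  have "(norm (\<Sum>l\<in>{Suc N..<2 * Suc N}. level G l h))\<^sup>2 = (\<Sum>l\<in>{Suc N..<2 * Suc N}. level_mass l h)"
    unfolding cinner_self using of_real_eq_iff by blast
  then show ?thesis
    by (simp add: spread_def norm_scaleC norm_divide power_mult_distrib power_divide del: of_nat_Suc)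
qed

lemma norm_spread_le: "norm (spread G N h) \<le> norm h"
proof -
  have "(norm (spread G N h))\<^sup>2 \<le> (\<Sum>l\<in>{Suc N..<2 * Suc N}. (norm h)\<^sup>2) / real (Suc N)"
    unfolding norm_spread by (intro divide_right_mono sum_mono level_mass_le) simp
  also have "\<dots> = (norm h)\<^sup>2" by simp
  finally show ?thesis by (simp add: power2_le_iff_abs_le)
qed

text \<open>Level masses decrease, so their average lies between the masses at the two ends of the
  window.\<close>

lemma norm_spread_tendsto: "(\<lambda>N. (norm (spread G N h))\<^sup>2) \<longlonglongrightarrow> residual_mass h"
proof (rule tendsto_sandwich)
  have "strict_mono (\<lambda>N. 2 * Suc N)" by (auto simp: strict_mono_def)
  from LIMSEQ_subseq_LIMSEQ[OF level_mass_tendsto this]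
  show "(\<lambda>N. level_mass (2 * Suc N) h) \<longlonglongrightarrow> residual_mass h" by (simp add: o_def)
  show "(\<lambda>N. level_mass (Suc N) h) \<longlonglongrightarrow> residual_mass h"
    using level_mass_tendsto by (rule LIMSEQ_Suc)
  have "level_mass (2 * Suc N) h \<le> (norm (spread G N h))\<^sup>2" for N
  proof -
    have "level_mass (2 * Suc N) h = (\<Sum>l\<in>{Suc N..<2 * Suc N}. level_mass (2 * Suc N) h) / real (Suc N)"
      by simp
    also have "\<dots> \<le> (norm (spread G N h))\<^sup>2"
      unfolding norm_spread
      by (intro divide_right_mono sum_mono) (auto intro: decseqD[OF level_mass_antimono])
    finally show ?thesis .
  qed
  then show "\<forall>\<^sub>F N in sequentially. level_mass (2 * Suc N) h \<le> (norm (spread G N h))\<^sup>2" by simp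
  have "(norm (spread G N h))\<^sup>2 \<le> level_mass (Suc N) h" for N
  proof -
    have "(norm (spread G N h))\<^sup>2 \<le> (\<Sum>l\<in>{Suc N..<2 * Suc N}. level_mass (Suc N) h) / real (Suc N)"
      unfolding norm_spread
      by (intro divide_right_mono sum_mono) (auto intro: decseqD[OF level_mass_antimono])
    also have "\<dots> = level_mass (Suc N) h" by simp
    finally show ?thesis .
  qed
  then show "\<forall>\<^sub>F N in sequentially. (norm (spread G N h))\<^sup>2 \<le> level_mass (Suc N) h" by simp
qed

lemma bounded_clinear_spread: "bounded_clinear (spread G N)"
  unfolding spread_def by (intro bounded_clinear_scale bounded_clinear_setsum bounded_clinear_level)

text \<open>Annihilation shifts the window by one level; the difference telescopes to two boundary
  levels, each of norm at most |T_i^* h|, divided by sqrt(N + 1).\<close>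

lemma spread_intertwining:
  "(\<lambda>N. norm (amp (annihilation i) (spread G N h) - spread G N (cadjoint (T i) h))) \<longlonglongrightarrow> 0"
proof (rule Lim_null_comparison)
  let ?k = "cadjoint (T i) h"
  note lin = bounded_clinear_amp[OF bounded_clinear_annihilation]
  have "norm (amp (annihilation i) (spread G N h) - spread G N ?k) \<le> 2 * norm ?k / sqrt (Suc N)" for N
  proof -
    have "amp (annihilation i) (\<Sum>l\<in>{Suc N..<2 * Suc N}. level G l h)
        = amp (annihilation i) (\<Sum>l\<in>{N..<2 * N + 1}. level G (Suc l) h)"
      using sum.shift_bounds_Suc_ivl[of "\<lambda>l. level G l h" N "2 * N + 1"] by simp
    also have "\<dots> = (\<Sum>l\<in>{N..<2 * N + 1}. level G l ?k)"
      by (simp only: bounded_clinear_sum[OF lin] amp_annihilation_level)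
    finally have a: "amp (annihilation i) (\<Sum>l\<in>{Suc N..<2 * Suc N}. level G l h)
        = (\<Sum>l\<in>{N..<2 * N + 1}. level G l ?k)" .
    have b: "(\<Sum>l\<in>{Suc N..<2 * Suc N}. level G l ?k) = (\<Sum>l\<in>{N..<2 * N + 1}. level G (Suc l) ?k)"
      using sum.shift_bounds_Suc_ivl[of "\<lambda>l. level G l ?k" N "2 * N + 1"] by simp
    have "(\<Sum>l\<in>{N..<2 * N + 1}. level G (Suc l) ?k - level G l ?k) = level G (2 * N + 1) ?k - level G N ?k"
      by (rule sum_Suc_diff') simp
    then have c: "(\<Sum>l\<in>{N..<2 * N + 1}. level G l ?k) - (\<Sum>l\<in>{N..<2 * N + 1}. level G (Suc l) ?k)
        = level G N ?k - level G (2 * N + 1) ?k"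
      by (simp only: sum_subtractf) (metis minus_diff_eq)
    have "amp (annihilation i) (spread G N h) - spread G N ?k
        = complex_of_real (1 / sqrt (Suc N)) *\<^sub>C (level G N ?k - level G (2 * N + 1) ?k)"
      unfolding spread_def bounded_clinear_scaleC[OF lin] a b scaleC_diff_right[symmetric] c ..
    also have "norm \<dots> = norm (level G N ?k - level G (2 * N + 1) ?k) / sqrt (Suc N)"
      by (simp add: norm_scaleC norm_divide)
    also have "\<dots> \<le> (norm ?k + norm ?k) / sqrt (Suc N)"
      by (intro divide_right_mono order_trans[OF norm_triangle_ineq4] add_mono norm_level_le) simp
    finally show ?thesis by simp
  qed
  then show "\<forall>\<^sub>F N in sequentially.
      norm (norm (amp (annihilation i) (spread G N h) - spread G N ?k)) \<le> 2 * norm ?k / sqrt (Suc N)"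
    by simp
  have "filterlim (\<lambda>N. sqrt (real N)) at_top sequentially"
    by (rule filterlim_compose[OF sqrt_at_top filterlim_real_sequentially])
  then have "(\<lambda>N. 2 * norm ?k / sqrt (real N)) \<longlonglongrightarrow> 0"
    by (intro tendsto_divide_0[OF tendsto_const]) (simp add: filterlim_at_top_imp_at_infinity)
  then show "(\<lambda>N. 2 * norm ?k / sqrt (Suc N)) \<longlonglongrightarrow> 0" by (rule LIMSEQ_Suc)
qed

lemma Rep_level:
  "Rep_l2 (Rep_l2 (level G l h) k) w = (if length w = l then cinner (Ts w h) (cadjoint G (l2_basis k)) else 0)"
proof -
  have "Rep_l2 (Rep_l2 (level G l h) k) w
      = (\<Sum>u | length u = l. if u = w then Rep_l2 (G (Ts w h)) k else 0)"
    unfolding level_def Rep_l2_sum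
    by (intro sum.cong refl) (auto simp: tensor.rep_eq scaleC_complex_def l2_basis.rep_eq)
  also have "\<dots> = (if length w = l then Rep_l2 (G (Ts w h)) k else 0)"
    by (simp add: finite_words_of_length)
  finally show ?thesis by (simp add: cinner_l2_basis flip: cinner_cadjoint[OF G])
qed

text \<open>A weight depending only on the length of w times <T_w^* h, k>: the shape to which
  \<open>annihilated_in_variety\<close> applies. It also shows that words of length at most N are
  absent.\<close>

lemma Rep_spread:
  "Rep_l2 (Rep_l2 (spread G N h) k) w
    = (if length w \<in> {Suc N..<2 * Suc N} then complex_of_real (1 / sqrt (Suc N)) else 0)
      * cinner (Ts w h) (cadjoint G (l2_basis k))"
  unfolding spread_def scaleC_l2.rep_eq Rep_l2_sum Rep_level
  by (simp add: scaleC_complex_def)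

text \<open>Every coordinate of the spread vector is supported on words longer than N, so for N >= m
  the tail estimate holds coordinatewise with one constant.\<close>

lemma amp_compact_spread:
  assumes Y: "compact_op Y"
  shows "(\<lambda>N. norm (amp Y (spread G N h))) \<longlonglongrightarrow> 0"
proof (rule LIMSEQ_I)
  fix e :: real assume e: "0 < e"
  define d where "d = e / (norm h + 1)"
  have d: "0 < d" unfolding d_def using e by (simp add: add_nonneg_pos)
  have lin: "bounded_clinear Y" using Y by (simp add: compact_op_def)
  obtain m where m: "\<And>v. (\<forall>w. length w < m \<longrightarrow> Rep_l2 v w = 0) \<Longrightarrow> norm (Y v) \<le> d * norm v"
    using compact_op_tail[OF Y d] by blast
  have "norm (norm (amp Y (spread G N h)) - 0) < e" if "N \<ge> m" for N
  proof -
    have "norm (amp Y (spread G N h)) \<le> d * norm (spread G N h)"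
      by (rule norm_amp_le_on[OF lin m]) (use that d in \<open>auto simp: Rep_spread\<close>)
    also have "\<dots> \<le> d * norm h" using d by (intro mult_left_mono norm_spread_le) simp
    also have "\<dots> < d * (norm h + 1)" using d by simp
    also have "\<dots> = e" unfolding d_def using norm_ge_zero[of h] by (simp add: add_nonneg_eq_0_iff)
    finally show ?thesis by simp
  qed
  then show "\<exists>m. \<forall>N\<ge>m. norm (norm (amp Y (spread G N h)) - 0) < e" by blast
qed

end

end

section \<open>Tensor products of subspaces\<close>

lemma cinner_basis_tensor: "cinner f (l2_basis i \<otimes>\<^sub>v d) = cinner (Rep_l2 f i) d"
  unfolding cinner_l2_def
  by (subst infsum_single[of i]) (auto simp: tensor.rep_eq l2_basis.rep_eq)

text \<open>The slice map I tensor <., d>, which removes the second tensor factor.\<close>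

definition slice :: "'h::complex_hilbert \<Rightarrow> ('i, 'h) l2 \<Rightarrow> ('i, complex) l2"
  where "slice d = cadjoint (\<lambda>a. a \<otimes>\<^sub>v d)"

lemma bounded_clinear_slice: "bounded_clinear (slice d)"
  unfolding slice_def by (intro bounded_clinear_cadjoint bounded_clinear_tensor_left)

lemma cinner_slice: "cinner (slice d f) a = cinner f (a \<otimes>\<^sub>v d)"
  unfolding slice_def by (rule cinner_cadjoint'[OF bounded_clinear_tensor_left])

lemma Rep_slice: "Rep_l2 (slice d f) i = cinner (Rep_l2 f i) d"
  by (simp add: cinner_slice cinner_basis_tensor flip: cinner_l2_basis)

lemma slice_tensor: "slice d (a \<otimes>\<^sub>v h) = cinner h d *\<^sub>C a"
  by (rule l2_eqI) (simp add: Rep_slice tensor.rep_eq cinner_scaleC_left scaleC_complex_def)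

lemma closed_csubspace_tensor_space [simp]: "closed_csubspace (tensor_space M D)"
  by (simp add: tensor_space_def)

lemma tensor_in_tensor_space: "a \<in> M \<Longrightarrow> h \<in> D \<Longrightarrow> a \<otimes>\<^sub>v h \<in> tensor_space M D"
  unfolding tensor_space_def by (rule closed_cspan_base) blast

text \<open>Let g be the part of f orthogonal to the tensor space. Its slices along D lie in M and
  are orthogonal to M, hence vanish; its coordinates lie in D and are then orthogonal to D.\<close>

lemma tensor_space_memI:
  assumes M: "closed_csubspace M" and D: "closed_csubspace D"
    and fD: "\<And>i. Rep_l2 f i \<in> D" and fM: "\<And>d. d \<in> D \<Longrightarrow> slice d f \<in> M"
  shows "f \<in> tensor_space M D"
proof -
  let ?S = "tensor_space M D"
  define g where "g = f - proj ?S f"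
  have pS: "proj ?S f \<in> ?S" and gS: "g \<in> orth_compl ?S"
    unfolding g_def by (simp_all add: proj_in proj_orth)
  have "?S \<subseteq> {x. Rep_l2 x i \<in> D}" for i
    unfolding tensor_space_def
    by (rule closed_cspan_minimal[OF _ closed_csubspace_vimage[OF bounded_clinear_Rep_l2 D]])
       (auto simp: tensor.rep_eq csubspace_scaleC closed_csubspaceD D)
  then have gD: "Rep_l2 g i \<in> D" for i
    using pS fD[of i] by (auto simp: g_def intro: csubspace_diff closed_csubspaceD D)
  have "?S \<subseteq> {x. slice d x \<in> M}" for d
    unfolding tensor_space_def
    by (rule closed_cspan_minimal[OF _ closed_csubspace_vimage[OF bounded_clinear_slice M]])
       (auto simp: slice_tensor csubspace_scaleC closed_csubspaceD M)
  then have gM: "slice d g \<in> M" if "d \<in> D" for d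
    using pS fM[OF that] M
    by (auto simp: g_def clinear_simps[OF bounded_clinear_slice] intro: csubspace_diff closed_csubspaceD)
  have "cinner (slice d g) a = 0" if "d \<in> D" "a \<in> M" for d a
    using cinner_orth(1)[OF gS tensor_in_tensor_space] that by (simp add: cinner_slice)
  then have "slice d g = 0" if "d \<in> D" for d
    using gM[OF that] that by (metis cinner_self_eq_0)
  then have "cinner (Rep_l2 g i) d = 0" if "d \<in> D" for i d
    using that by (metis Rep_slice zero_l2.rep_eq)
  then have "Rep_l2 g i = 0" for i using gD by (metis cinner_self_eq_0)
  then have "g = 0" by (intro l2_eqI) simp
  then show ?thesis using pS by (simp add: g_def)
qed

lemma proj_tensor:
  assumes M: "closed_csubspace M" and h: "h \<in> D"
  shows "proj (tensor_space M D) (x \<otimes>\<^sub>v h) = proj M x \<otimes>\<^sub>v h"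
proof (rule proj_eqI[OF closed_csubspace_tensor_space])
  show "proj M x \<otimes>\<^sub>v h \<in> tensor_space M D" by (intro tensor_in_tensor_space proj_in M h)
  have "x \<otimes>\<^sub>v h - proj M x \<otimes>\<^sub>v h = (x - proj M x) \<otimes>\<^sub>v h"
    by (simp add: clinear_simps[OF bounded_clinear_tensor_left])
  then show "x \<otimes>\<^sub>v h - proj M x \<otimes>\<^sub>v h \<in> orth_compl (tensor_space M D)"
    unfolding tensor_space_def orth_compl_cspan
    using cinner_orth(1)[OF proj_orth[OF M]] by (auto simp: orth_compl_def cinner_tensor)
qed

text \<open>Replaces the implicit \<open>tensor_op\<close> by a compression of the vector-valued
  shift, whose adjoint can be computed. Uniqueness holds because elementary tensors span the tensor
  space.\<close>

lemma tensor_op_compression: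
  assumes M: "closed_csubspace M" and D: "closed_csubspace D"
  shows "tensor_op M D (proj M \<circ> shift i \<circ> proj M) (proj D)
    = proj (tensor_space M D) \<circ> shift i \<circ> proj (tensor_space M D)"
  (is "_ = ?Z")
  unfolding tensor_op_def
proof (rule the_equality)
  let ?S = "tensor_space M D"
  have S: "closed_csubspace ?S" by simp
  have Z: "?Z \<in> bops ?S"
    by (rule compression_bops[OF S bounded_clinear_shift])
  have Zt: "?Z (f \<otimes>\<^sub>v h) = (proj M \<circ> shift i \<circ> proj M) f \<otimes>\<^sub>v proj D h" if fh: "f \<in> M" "h \<in> D" for f h
  proof -
    have "proj ?S (shift i f \<otimes>\<^sub>v h) = proj M (shift i f) \<otimes>\<^sub>v h"
      by (rule proj_tensor[OF M fh(2)])
    then show ?thesis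
      by (simp add: proj_id[OF S tensor_in_tensor_space[OF fh]] proj_id[OF M fh(1)]
          proj_id[OF D fh(2)] shift_tensor)
  qed
  show "?Z \<in> bops ?S \<and> (\<forall>f\<in>M. \<forall>h\<in>D. ?Z (f \<otimes>\<^sub>v h) = (proj M \<circ> shift i \<circ> proj M) f \<otimes>\<^sub>v proj D h)"
    using Z Zt by blast
  fix Y assume Y: "Y \<in> bops ?S \<and>
    (\<forall>f\<in>M. \<forall>h\<in>D. Y (f \<otimes>\<^sub>v h) = (proj M \<circ> shift i \<circ> proj M) f \<otimes>\<^sub>v proj D h)"
  show "Y = ?Z"
    by (rule bops_eqI[OF S _ Z, where S = "{f \<otimes>\<^sub>v h |f h. f \<in> M \<and> h \<in> D}"])
       (use Y Zt in \<open>auto simp: tensor_space_def simp del: o_apply\<close>)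
qed

section \<open>Compact operators\<close>

lemma compact_closure_subset: "compact K \<Longrightarrow> S \<subseteq> K \<Longrightarrow> compact (closure S)"
  for K :: "'a::complex_hilbert set"
  by (metis closed_Int_compact closed_closure closure_minimal compact_imp_closed inf.absorb1)

lemma compact_op_compose:
  fixes X :: "'b::complex_hilbert \<Rightarrow> 'c::complex_hilbert" and Y :: "'a::complex_hilbert \<Rightarrow> 'b"
  assumes X: "compact_op X" and Y: "bounded_clinear Y"
  shows "compact_op (X \<circ> Y)"
proof -
  have lin: "bounded_clinear X" and c: "compact (closure (X ` cball 0 1))"
    using X by (auto simp: compact_op_def)
  \<comment> \<open>Strictly positive, so that rescaling by the inverse works even for Y =
    0.\<close>
  define C where "C = onorm Y + 1"
  have C: "0 < C" using clinear_onorm_nonneg[OF Y] by (simp add: C_def)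
  have "(X \<circ> Y) ` cball 0 1 \<subseteq> (\<lambda>z. C *\<^sub>R z) ` closure (X ` cball 0 1)"
  proof (rule image_subsetI)
    fix z :: 'a assume z: "z \<in> cball 0 1"
    have "norm (Y z) \<le> onorm Y * norm z" by (rule bounded_clinear_onorm[OF Y])
    also have "\<dots> \<le> onorm Y * 1"
      using z by (intro mult_left_mono clinear_onorm_nonneg[OF Y]) simp
    finally have "norm (Y z) \<le> C" by (simp add: C_def)
    then have "inverse C * norm (Y z) \<le> inverse C * C" using C by (intro mult_left_mono) auto
    then have "inverse C *\<^sub>R Y z \<in> cball 0 1" using C by simp
    then have "X (inverse C *\<^sub>R Y z) \<in> closure (X ` cball 0 1)"
      by (intro subsetD[OF closure_subset] imageI)
    moreover have "(X \<circ> Y) z = C *\<^sub>R X (inverse C *\<^sub>R Y z)"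
      using C by (simp add: linear_simps(5)[OF clinear_bounded_linear[OF lin]])
    ultimately show "(X \<circ> Y) z \<in> (\<lambda>z. C *\<^sub>R z) ` closure (X ` cball 0 1)" by blast
  qed
  then have "compact (closure ((X \<circ> Y) ` cball 0 1))"
    by (rule compact_closure_subset[OF compact_scaling[OF c]])
  then show ?thesis by (simp add: compact_op_def bounded_clinear_compose lin Y)
qed

lemma compact_op_rank_one:
  assumes v: "norm v = 1"
  shows "compact_op (\<lambda>x. cinner x v *\<^sub>C v)"
proof -
  have "bounded_clinear (\<lambda>x. cinner x v *\<^sub>C v)"
    by (rule bounded_clinearI[of _ 1])
       (use cmod_cinner_le[of _ v] v in \<open>simp_all add: cinner_add_left scaleC_add_left
         cinner_scaleC_left scaleC_scaleC norm_scaleC\<close>)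
  moreover have "(\<lambda>x. cinner x v *\<^sub>C v) ` cball 0 1 \<subseteq> (\<lambda>c. c *\<^sub>C v) ` cball 0 1"
  proof (rule image_subsetI)
    fix x :: 'a assume "x \<in> cball 0 1"
    then have "cinner x v \<in> cball 0 1" using cmod_cinner_le[of x v] v by simp
    then show "cinner x v *\<^sub>C v \<in> (\<lambda>c. c *\<^sub>C v) ` cball 0 1" by blast
  qed
  moreover have "compact ((\<lambda>c. c *\<^sub>C v) ` cball (0::complex) 1)"
  proof (rule compact_continuous_image)
    show "continuous_on (cball 0 1) (\<lambda>c. c *\<^sub>C v)"
      unfolding continuous_on_def by (intro ballI tendsto_scaleC_left tendsto_ident_at)
  qed simp
  ultimately show ?thesis by (simp add: compact_op_def compact_closure_subset)
qed

section \<open>The dilation\<close>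

locale constrained_tuple = row_contraction_tuple T
  for T :: "'n::finite \<Rightarrow> 'h::complex_hilbert \<Rightarrow> 'h" +
  fixes P :: "'n ncpoly set" and J :: "('n fock \<Rightarrow> 'n fock) set"
  assumes homog: "\<forall>p\<in>P. homogeneous p"
    and J_generated: "J = wot_ideal_generated ((\<lambda>p. ncpoly_eval p creation) ` P)"
    and J_proper: "J \<noteq> analytic_toeplitz"
    and separable: "separable_space (euclidean :: 'h topology)"
    and annihilated: "\<forall>p\<in>P. ncpoly_eval p T = (\<lambda>_. 0)"
begin

abbreviation "N \<equiv> variety_space J"
abbreviation "B \<equiv> constrained_shift J"
abbreviation "D \<equiv> defect_space T"
abbreviation vac :: "'n fock" where "vac \<equiv> l2_basis []"

lemma N_eq: "N = variety_coeffs P"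
  by (rule variety_space_eq[OF J_generated])

lemma N: "closed_csubspace N"
  by (simp add: variety_space_def)

lemma annihilation_N: "v \<in> N \<Longrightarrow> annihilation i v \<in> N"
  unfolding N_eq by (rule annihilation_variety_coeffs)

lemma vac_N: "vac \<in> N"
  unfolding N_eq by (rule vacuum_in_variety[OF J_generated homog J_proper])

lemma B_eq: "B i = proj N \<circ> shift i \<circ> proj N"
  by (simp add: constrained_shift_def creation_eq_shift)

lemma B_bops: "B i \<in> bops N"
  unfolding B_eq by (rule compression_bops[OF N bounded_clinear_shift])

sublocale operator_family N B
  by unfold_locales (rule N, rule B_bops)

text \<open>N is co-invariant, so the outer projection in the adjoint of the compression
  disappears.\<close>

lemma adjoint_B: "cadjoint (B i) v = annihilation i (proj N v)"
proof -
  have "cadjoint (B i) = proj N \<circ> (annihilation i \<circ> proj N)"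
    by (simp add: B_eq cadjoint_compose bounded_clinear_compose bounded_clinear_proj N
        bounded_clinear_shift cadjoint_proj cadjoint_shift comp_assoc)
  then show ?thesis by (simp add: proj_id[OF N annihilation_N] proj_in[OF N])
qed

text \<open>Co-invariance reduces the sum to the compression of I minus the vacuum projection, and
  the vacuum lies in N.\<close>

lemma sum_B_adjoint: "(\<Sum>i\<in>UNIV. B i (cadjoint (B i) x)) = proj N x - cinner x vac *\<^sub>C vac"
proof -
  have "(\<Sum>i\<in>UNIV. B i (cadjoint (B i) x)) = proj N (\<Sum>i\<in>UNIV. shift i (annihilation i (proj N x)))"
    unfolding adjoint_B
    by (simp add: B_eq proj_id[OF N annihilation_N] proj_in[OF N]
        bounded_clinear_sum[OF bounded_clinear_proj[OF N]])
  also have "(\<Sum>i\<in>UNIV. shift i (annihilation i (proj N x))) = proj N x - cinner x vac *\<^sub>C vac"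
  proof -
    have "vac \<otimes>\<^sub>v Rep_l2 (proj N x) [] = cinner (proj N x) vac *\<^sub>C vac"
      by (rule l2_eqI) (simp add: tensor.rep_eq scaleC_complex_def cinner_l2_basis)
    then show ?thesis by (simp add: sum_shift_annihilation cinner_proj[OF N] proj_id[OF N vac_N])
  qed
  finally show ?thesis
    by (simp add: clinear_simps[OF bounded_clinear_proj[OF N]] proj_id[OF N vac_N]
        proj_id[OF N proj_in[OF N]])
qed

lemma A_sum: "(\<And>i. i \<in> I \<Longrightarrow> X i \<in> A) \<Longrightarrow> (\<lambda>x. \<Sum>i\<in>I. X i x) \<in> A"
proof (induction I rule: infinite_finite_induct)
  case (insert i I)
  then show ?case using A_add[of "X i" "\<lambda>x. \<Sum>i\<in>I. X i x"] by simp
qed (use A_scale[OF A_proj, of 0] in simp_all)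

text \<open>The compact operator I - sum B_i B_i^* on N lies in the algebra, so a representation
  that kills compacts and sends \<open>proj N\<close> to \<open>proj K\<close> must satisfy the sum
  condition.\<close>

lemma vacuum_projection_A: "(\<lambda>x. cinner x vac *\<^sub>C vac) \<in> A"
proof -
  have "(\<lambda>x. \<Sum>i\<in>UNIV. (B i \<circ> cadjoint (B i)) x) \<in> A"
    by (intro A_sum A_compose B_in_A A_adjoint)
  from A_add[OF A_proj A_scale[OF this, of "- 1"]] show ?thesis
    by (simp add: sum_B_adjoint scaleC_minus_one)
qed

lemma representation_sum:
  assumes \<pi>: "star_representation A K \<pi>" and X: "\<And>i. i \<in> I \<Longrightarrow> X i \<in> A"
  shows "\<pi> (\<lambda>x. \<Sum>i\<in>I. X i x) = (\<lambda>k. \<Sum>i\<in>I. \<pi> (X i) k)"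
proof -
  have "\<pi> (\<lambda>x. 0 *\<^sub>C proj N x) = (\<lambda>k. 0 *\<^sub>C \<pi> (proj N) k)"
    using \<pi> A_proj unfolding star_representation_def by blast
  then have zero: "\<pi> (\<lambda>_. 0) = (\<lambda>_. 0)" by simp
  show ?thesis
    using X
  proof (induction I rule: infinite_finite_induct)
    case (insert i I)
    have "\<pi> (\<lambda>x. X i x + (\<Sum>i\<in>I. X i x)) = (\<lambda>k. \<pi> (X i) k + \<pi> (\<lambda>x. \<Sum>i\<in>I. X i x) k)"
      using \<pi> insert A_sum[of I X] unfolding star_representation_def by simp
    then show ?case using insert by simp
  qed (simp_all add: zero)
qed

lemma D: "closed_csubspace D"
proof -
  have "csubspace (range \<Delta>)"
    unfolding csubspace_def
    by (auto simp flip: defect_op_lin(1,2) intro: range_eqI[of _ _ 0] simp: defect_op_lin(4))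
  then show ?thesis by (simp add: closed_csubspace_def defect_space_def csubspace_closure)
qed

lemma defect_in_D: "\<Delta> h \<in> D"
  using closure_subset[of "range \<Delta>"] by (auto simp: defect_space_def)

text \<open>Since \<Delta> is self-adjoint, slicing along d gives the coefficients <T_w^* h,
  \<Delta> d>, the case of constant weight 1.\<close>

lemma poisson_tensor_space: "poisson h \<in> tensor_space N D"
proof (rule tensor_space_memI[OF N D])
  show "Rep_l2 (poisson h) w \<in> D" for w by (simp add: defect_in_D)
  show "slice d (poisson h) \<in> N" for d
    unfolding N_eq
  proof (rule annihilated_in_variety[OF homog annihilated T])
    show "Rep_l2 (slice d (poisson h)) w = 1 * cinner (cadjoint (word_op T w) h) (\<Delta> d)" for w
      by (simp add: Rep_slice pos_op_selfadjoint[OF pos_defect_op] flip: Ts_def)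
  qed
qed

lemma spread_N:
  assumes "bounded_clinear G" "\<And>x y. cinner (G x) (G y) = cinner x y"
  shows "Rep_l2 (spread G m h) k \<in> N"
  unfolding N_eq
proof (rule annihilated_in_variety[OF homog annihilated T])
  show "Rep_l2 (Rep_l2 (spread G m h) k) w
    = (\<lambda>l. if l \<in> {Suc m..<2 * Suc m} then complex_of_real (1 / sqrt (Suc m)) else 0) (length w)
      * cinner (cadjoint (word_op T w) h) (cadjoint G (l2_basis k))" for w
    using Rep_spread[OF assms] by (simp add: Ts_def)
qed

lemma asymptotic_part:
  obtains K \<pi> R where "closed_csubspace (K :: (nat, complex) l2 set)" "star_representation A K \<pi>"
    "\<And>X. X \<in> A \<Longrightarrow> compact_op X \<Longrightarrow> \<pi> X = (\<lambda>_. 0)" "\<pi> (proj N) = proj K"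
    "bounded_clinear R" "\<And>h. R h \<in> K" "\<And>h. (norm (R h))\<^sup>2 = residual_mass h"
    "\<And>i h. cadjoint (\<pi> (B i)) (R h) = R (cadjoint (T i) h)"
    "K = closed_cspan {\<pi> (W w) (R h) |w h. True}"
proof -
  obtain G :: "'h \<Rightarrow> (nat, complex) l2"
    where G: "bounded_clinear G" "\<And>x y. cinner (G x) (G y) = cinner x y"
    using separable_isometry[OF separable] by blast
  note spread = bounded_clinear_spread[OF G] norm_spread_le[OF G]
  obtain s K \<pi> R where s: "strict_mono (s :: nat \<Rightarrow> nat)"
    and K: "closed_csubspace (K :: (nat, complex) l2 set)" and \<pi>: "star_representation A K \<pi>"
    and R: "bounded_clinear R" "\<And>h. R h \<in> K"
    and lim: "\<And>X Y h k. X \<in> A \<Longrightarrow> Y \<in> A \<Longrightarrow>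
      (\<lambda>m. cinner (amp X (spread G (s m) h)) (amp Y (spread G (s m) k))) \<longlonglongrightarrow> cinner (\<pi> X (R h)) (\<pi> Y (R k))"
    and K_span: "K = closed_cspan {\<pi> (W w) (R h) |w h. True}"
    and \<pi>1: "\<And>h. \<pi> (proj N) (R h) = R h"
    by (rule limit_representation[where V = "spread G"])
       (use separable spread in \<open>auto simp: countable_finite\<close>)
  have sub: "(\<lambda>m. f (s m)) \<longlonglongrightarrow> l" if "f \<longlonglongrightarrow> l" for f :: "nat \<Rightarrow> real" and l
    using LIMSEQ_subseq_LIMSEQ[OF that s] by (simp add: o_def)
  have \<pi>_bops: "\<pi> X \<in> bops K" and \<pi>_comp: "Y \<in> A \<Longrightarrow> \<pi> (X \<circ> Y) = \<pi> X \<circ> \<pi> Y"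
    and \<pi>_adj: "\<pi> (cadjoint X) = cadjoint (\<pi> X)" if "X \<in> A" for X Y
    using \<pi> that by (auto simp: star_representation_def)
  \<comment> \<open>The coordinates of spread vectors lie in N, so the unit \<open>proj N\<close>
    fixes them; below it is the neutral choice of operator in \<open>lim\<close>.\<close>
  have amp1: "amp (proj N) (spread G m h) = spread G m h" for m h
    by (rule l2_eqI) (simp add: Rep_amp bounded_clinear_proj[OF N] proj_id[OF N spread_N[OF G]])
  have ampB: "amp (cadjoint (B i)) (spread G m h) = amp (annihilation i) (spread G m h)" for i m h
    by (rule l2_eqI) (simp add: Rep_amp bounded_clinear_cadjoint bops_bounded[OF B_bops]
        bounded_clinear_annihilation adjoint_B proj_id[OF N spread_N[OF G]])
  have norm_lim: "(\<lambda>m. (norm (amp X (spread G (s m) h)))\<^sup>2) \<longlonglongrightarrow> (norm (\<pi> X (R h)))\<^sup>2"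
    if "X \<in> A" for X h
    using lim[OF that that, of h h] unfolding cinner_self tendsto_of_real_iff .
  have "(norm (R h))\<^sup>2 = residual_mass h" for h
    using norm_lim[OF A_proj, of h] sub[OF norm_spread_tendsto[OF G, of h]]
    by (simp add: amp1 \<pi>1 LIMSEQ_unique)
  moreover have "\<pi> X = (\<lambda>_. 0)" if X: "X \<in> A" "compact_op X" for X
  proof (rule bops_eqI[OF K \<pi>_bops[OF X(1)] _ K_span[symmetric]])
    show "(\<lambda>_. 0) \<in> bops K"
      by (rule bopsI) (auto simp: bounded_clinear_zero csubspace_0 closed_csubspaceD K)
    fix y assume "y \<in> {\<pi> (W w) (R h) |w h. True}"
    then obtain w h where y: "y = \<pi> (W w) (R h)" by blast
    \<comment> \<open>On the spanning vectors the monomial is absorbed into X, and the product is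
      still compact.\<close>
    have "compact_op (X \<circ> W w)" by (rule compact_op_compose[OF X(2) A_bounded[OF word_in_A]])
    from sub[OF amp_compact_spread[OF G this, of h]]
    have "(\<lambda>m. (norm (amp (X \<circ> W w) (spread G (s m) h)))\<^sup>2) \<longlonglongrightarrow> 0\<^sup>2" by (rule tendsto_power)
    then have "(norm (\<pi> (X \<circ> W w) (R h)))\<^sup>2 = 0\<^sup>2"
      using norm_lim[OF A_compose[OF X(1) word_in_A]] LIMSEQ_unique by blast
    then show "\<pi> X y = 0" by (simp add: y \<pi>_comp X(1) word_in_A)
  qed
  moreover have "\<pi> (proj N) = proj K"
  proof (rule bops_eqI[OF K \<pi>_bops[OF A_proj] bops_proj[OF K] K_span[symmetric]])
    fix y assume "y \<in> {\<pi> (W w) (R h) |w h. True}"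
    then obtain w h where y: "y = \<pi> (W w) (R h)" by blast
    have "\<pi> (proj N) y = \<pi> (proj N \<circ> W w) (R h)" by (simp add: y \<pi>_comp A_proj word_in_A)
    also have "\<dots> = y" by (simp only: bops_proj_left[OF N word_bops] y)
    also have "\<dots> = proj K y" using bops_range[OF \<pi>_bops[OF word_in_A]] by (simp add: y proj_id[OF K])
    finally show "\<pi> (proj N) y = proj K y" .
  qed
  moreover have "cadjoint (\<pi> (B i)) (R h) = R (cadjoint (T i) h)" for i h
  proof -
    let ?k = "cadjoint (T i) h" and ?X = "cadjoint (B i)"
    have X: "?X \<in> A" by (intro A_adjoint B_in_A)
    \<comment> \<open>\<open>lim\<close> speaks of inner products of ampliations and not of
      differences, so the squared norm of the intertwining error is split into four such
      products.\<close>
    have expand: "cinner (a - b) (a - b) = cinner a a - cinner a b - cinner b a + cinner b b"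
      for a b :: "'z::complex_hilbert"
      by (simp add: cinner_diff_left cinner_diff_right)
    have "(\<lambda>m. cinner (amp ?X (spread G (s m) h) - amp (proj N) (spread G (s m) ?k))
          (amp ?X (spread G (s m) h) - amp (proj N) (spread G (s m) ?k)))
        \<longlonglongrightarrow> cinner (\<pi> ?X (R h) - \<pi> (proj N) (R ?k)) (\<pi> ?X (R h) - \<pi> (proj N) (R ?k))"
      unfolding expand by (intro tendsto_add tendsto_diff lim X A_proj)
    then have "(\<lambda>m. (norm (amp (annihilation i) (spread G (s m) h) - spread G (s m) ?k))\<^sup>2)
        \<longlonglongrightarrow> (norm (\<pi> ?X (R h) - R ?k))\<^sup>2"
      unfolding cinner_self tendsto_of_real_iff amp1 ampB \<pi>1 .
    moreover have "(\<lambda>m. (norm (amp (annihilation i) (spread G (s m) h) - spread G (s m) ?k))\<^sup>2) \<longlonglongrightarrow> 0\<^sup>2"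
      using sub[OF spread_intertwining[OF G, of i h]] by (rule tendsto_power)
    ultimately have "(norm (\<pi> ?X (R h) - R ?k))\<^sup>2 = 0\<^sup>2" by (rule LIMSEQ_unique)
    then show ?thesis by (simp add: \<pi>_adj[OF B_in_A])
  qed
  ultimately show ?thesis using that[OF K \<pi>] R K_span by blast
qed

section \<open>Direct sum of the Poisson kernel and the asymptotic part\<close>

theorem dilation:
  "\<exists>(K :: (nat, complex) l2 set) \<pi>.
    closed_csubspace K \<and> star_representation A K \<pi> \<and>
    (\<forall>X\<in>A. compact_op X \<longrightarrow> \<pi> X = (\<lambda>_. 0)) \<and>
    (\<lambda>k. \<Sum>i\<in>UNIV. \<pi> (B i) (cadjoint (\<pi> (B i)) k)) = proj K \<and>
    (let Ktilde = tensor_space N D \<times> K;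
         V = (\<lambda>i. direct_sum_op (tensor_op N D (B i) (proj D)) (\<pi> (B i)))
     in \<exists>U :: 'h \<Rightarrow> ('n list, 'h) l2 \<times> (nat, complex) l2.
          linear_isometry U \<and> range U \<subseteq> Ktilde \<and>
          coinvariant V (range U) \<and> star_cyclic Ktilde V (range U) \<and>
          (\<forall>i h. U (cadjoint (T i) h) = cadjoint (V i) (U h)))"
proof -
  obtain K \<pi> R where K: "closed_csubspace (K :: (nat, complex) l2 set)"
    and \<pi>: "star_representation A K \<pi>"
    and compact: "\<And>X. X \<in> A \<Longrightarrow> compact_op X \<Longrightarrow> \<pi> X = (\<lambda>_. 0)"
    and \<pi>1: "\<pi> (proj N) = proj K"
    and R: "bounded_clinear R" "\<And>h. R h \<in> K" and R_norm: "\<And>h. (norm (R h))\<^sup>2 = residual_mass h"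
    and R_adj: "\<And>i h. cadjoint (\<pi> (B i)) (R h) = R (cadjoint (T i) h)"
    and K_span: "K = closed_cspan {\<pi> (W w) (R h) |w h. True}"
    by (rule asymptotic_part) (rule that; (assumption | blast))
  have \<pi>_bops: "\<pi> X \<in> bops K" and \<pi>_comp: "Y \<in> A \<Longrightarrow> \<pi> (X \<circ> Y) = \<pi> X \<circ> \<pi> Y"
    and \<pi>_add: "Y \<in> A \<Longrightarrow> \<pi> (\<lambda>x. X x + Y x) = (\<lambda>k. \<pi> X k + \<pi> Y k)"
    and \<pi>_adj: "\<pi> (cadjoint X) = cadjoint (\<pi> X)" if "X \<in> A" for X Y
    using \<pi> that by (auto simp: star_representation_def)
  have sum_K: "(\<Sum>i\<in>UNIV. \<pi> (B i) (cadjoint (\<pi> (B i)) k)) = proj K k" for k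
  proof -
    define E where "E = (\<lambda>x. cinner x vac *\<^sub>C vac)"
    have E: "E \<in> A" "\<pi> E = (\<lambda>_. 0)"
      unfolding E_def
      by (rule vacuum_projection_A)
         (rule compact[OF vacuum_projection_A compact_op_rank_one[OF norm_l2_basis]])
    have BB: "B i \<circ> cadjoint (B i) \<in> A" for i by (intro A_compose B_in_A A_adjoint)
    define F where "F = (\<lambda>x. \<Sum>i\<in>UNIV. (B i \<circ> cadjoint (B i)) x)"
    have F: "F \<in> A" unfolding F_def by (rule A_sum[OF BB])
    have "proj N = (\<lambda>x. E x + F x)" by (simp add: fun_eq_iff sum_B_adjoint E_def F_def)
    then have "\<pi> (proj N) = \<pi> (\<lambda>x. E x + F x)" by (rule arg_cong)
    also have "\<dots> = (\<lambda>k. \<pi> E k + \<pi> F k)" by (rule \<pi>_add[OF E(1) F])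
    also have "\<pi> F = (\<lambda>k. \<Sum>i\<in>UNIV. \<pi> (B i \<circ> cadjoint (B i)) k)"
      unfolding F_def by (rule representation_sum[OF \<pi> BB])
    finally show ?thesis
      by (simp add: E(2) \<pi>1 \<pi>_comp[OF B_in_A A_adjoint[OF B_in_A]] \<pi>_adj[OF B_in_A])
  qed
  define S where "S = tensor_space N D"
  define Z where "Z i = tensor_op N D (B i) (proj D)" for i
  define V where "V i = direct_sum_op (Z i) (\<pi> (B i))" for i
  define U where "U h = (poisson h, R h)" for h
  have S: "closed_csubspace S" by (simp add: S_def)
  note pS = bounded_clinear_proj[OF S]
  have Z_eq: "Z i = proj S \<circ> shift i \<circ> proj S" for i
    unfolding Z_def S_def B_eq by (rule tensor_op_compression[OF N D])
  have Z: "bounded_clinear (Z i)" for i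
    by (simp only: Z_eq bounded_clinear_compose pS bounded_clinear_shift)
  have Z_adj: "cadjoint (Z i) = proj S \<circ> annihilation i \<circ> proj S" for i
    by (simp add: Z_eq cadjoint_compose bounded_clinear_compose pS bounded_clinear_shift
        cadjoint_proj[OF S] cadjoint_shift comp_assoc)
  have \<pi>B: "bounded_clinear (\<pi> (B i))" for i by (rule bops_bounded[OF \<pi>_bops[OF B_in_A]])
  have V_adj: "cadjoint (V i) = direct_sum_op (cadjoint (Z i)) (cadjoint (\<pi> (B i)))" for i
    by (rule cadjointI)
       (auto simp: V_def direct_sum_op_def cinner_prod_def cinner_cadjoint[OF Z] cinner_cadjoint[OF \<pi>B])
  have poisson_S: "poisson h \<in> S" for h unfolding S_def by (rule poisson_tensor_space)
  have Z_adj_poisson: "cadjoint (Z i) (poisson h) = poisson (cadjoint (T i) h)" for i h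
    by (simp add: Z_adj proj_id[OF S poisson_S] annihilation_poisson)
  have U_adj: "U (cadjoint (T i) h) = cadjoint (V i) (U h)" for i h
    by (simp add: U_def V_adj direct_sum_op_def Z_adj_poisson R_adj)
  have "linear_isometry U"
    unfolding linear_isometry_def
  proof
    have nU: "norm (U h) = norm h" for h
      by (simp add: U_def norm_Pair norm_poisson R_norm)
    show "bounded_clinear U"
      by (rule bounded_clinearI[of _ 1])
         (simp_all add: nU, simp_all add: U_def scaleC_prod_def clinear_simps[OF R(1)]
           clinear_simps[OF bounded_clinear_poisson])
    show "\<forall>h. norm (U h) = norm h" using nU by blast
  qed
  moreover have U_range: "range U \<subseteq> S \<times> K" by (auto simp: U_def poisson_S R(2))
  moreover have "coinvariant V (range U)"
    unfolding coinvariant_def by (auto simp flip: U_adj)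
  moreover have "star_cyclic (S \<times> K) V (range U)"
    unfolding star_cyclic_def
  proof (rule equalityI)
    have "Z i x \<in> S" "cadjoint (Z i) x \<in> S" for i x
      unfolding Z_adj by (simp_all add: Z_eq proj_in[OF S])
    then have "V i ` (S \<times> K) \<subseteq> S \<times> K \<and> cadjoint (V i) ` (S \<times> K) \<subseteq> S \<times> K" for i
      unfolding V_adj unfolding V_def direct_sum_op_def
      using bops_range[OF \<pi>_bops[OF B_in_A]] bops_range[OF \<pi>_bops[OF A_adjoint[OF B_in_A]]]
      by (auto simp: \<pi>_adj[OF B_in_A])
    then have "reducing V (S \<times> K)" by (simp add: reducing_def)
    then show "\<Inter>{M. closed_csubspace M \<and> range U \<subseteq> M \<and> M \<subseteq> S \<times> K \<and> reducing V M} \<subseteq> S \<times> K"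
      using closed_csubspace_Times[OF S K] U_range by blast
  next
    \<comment> \<open>The vacuum tensors generate all of S; subtracting the Poisson component of U h
      then isolates R h, and monomials applied to these vectors span K.\<close>
    have "S \<times> K \<subseteq> M" if M: "closed_csubspace M" "range U \<subseteq> M" and red: "reducing V M" for M
    proof -
      have sub: "csubspace M" using M(1) by (rule closed_csubspaceD)
      have VM: "V i x \<in> M" and VM': "cadjoint (V i) x \<in> M" if "x \<in> M" for i x
        using red that by (auto simp: reducing_def)
      have UM: "(poisson h, R h) \<in> M" for h using M(2) by (auto simp: U_def)
      have left_cs: "closed_csubspace {x. (f x, 0) \<in> M}" if "bounded_clinear f"
        for f :: "'z::complex_hilbert \<Rightarrow> ('n list, 'h) l2"
      proof (rule closed_csubspace_vimage[OF _ M(1), of "\<lambda>x. (f x, 0)"])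
        show "bounded_clinear (\<lambda>x. (f x, 0 :: (nat, complex) l2))"
          by (rule bounded_clinearI[of _ "onorm f"])
             (simp_all add: scaleC_prod_def clinear_simps[OF that] norm_Pair
               bounded_clinear_onorm[OF that])
      qed
      have V_left: "(Z i x, 0) \<in> M" if "(x, 0) \<in> M" for i x
        using VM[OF that, of i] by (simp add: V_def direct_sum_op_def clinear_simps[OF \<pi>B])
      \<comment> \<open>On K the operators \<pi>(B_i) \<pi>(B_i)^* sum to the identity, so I - sum
        V_i V_i^* erases the second component of U h; in the first it leaves only the vacuum
        coefficient \<Delta> h.\<close>
      have vac_M: "(vac \<otimes>\<^sub>v \<Delta> h, 0) \<in> M" for h
      proof -
        have "(\<Sum>i\<in>UNIV. V i (cadjoint (V i) (U h))) \<in> M"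
          by (intro csubspace_sum[OF sub] VM VM') (use M(2) in auto)
        then have "U h - (\<Sum>i\<in>UNIV. V i (cadjoint (V i) (U h))) \<in> M"
          using M(2) by (intro csubspace_diff[OF sub]) auto
        moreover have "V i (cadjoint (V i) (U h))
            = (proj S (shift i (annihilation i (poisson h))), \<pi> (B i) (cadjoint (\<pi> (B i)) (R h)))" for i
          by (simp add: V_adj) (simp add: V_def U_def direct_sum_op_def Z_adj_poisson, simp add: Z_eq
            proj_id[OF S poisson_S] annihilation_poisson)
        then have "(\<Sum>i\<in>UNIV. V i (cadjoint (V i) (U h)))
            = (proj S (\<Sum>i\<in>UNIV. shift i (annihilation i (poisson h))), proj K (R h))"
          by (simp add: sum_prod sum_K bounded_clinear_sum[OF pS])
        moreover have "proj S (\<Sum>i\<in>UNIV. shift i (annihilation i (poisson h)))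
            = poisson h - vac \<otimes>\<^sub>v \<Delta> h"
        proof -
          have "vac \<otimes>\<^sub>v \<Delta> h \<in> S"
            unfolding S_def by (rule tensor_in_tensor_space[OF vac_N defect_in_D])
          then show ?thesis
            by (simp add: sum_shift_annihilation clinear_simps[OF pS] proj_id[OF S]
                poisson_S Ts_simps)
        qed
        ultimately show ?thesis by (simp add: U_def proj_id[OF K R(2)])
      qed
      have word_M: "(proj N (l2_basis w) \<otimes>\<^sub>v \<Delta> h, 0) \<in> M" for w h
      proof (induction w)
        case Nil
        then show ?case by (simp add: proj_id[OF N vac_N] vac_M)
      next
        case (Cons i w)
        let ?e = "l2_basis w :: 'n fock"
        have p: "proj N ?e \<otimes>\<^sub>v \<Delta> h \<in> S"
          unfolding S_def by (rule tensor_in_tensor_space[OF proj_in[OF N] defect_in_D])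
        \<comment> \<open>The complement of N is invariant under creation, so proj N S_i = proj N
          S_i proj N: compressed shifts carry projected basis vectors to projected basis
          vectors.\<close>
        have inv: "proj N (shift i x) = 0" if "x \<in> orth_compl N" for x
        proof (rule proj_orth_zero[OF N])
          show "shift i x \<in> orth_compl N"
            using cinner_orth(1)[OF that annihilation_N] by (auto simp: orth_compl_def cinner_shift)
        qed
        have "proj N (shift i ?e) = proj N (shift i (proj N ?e))"
          using inv[OF proj_orth[OF N, of ?e]]
          by (simp add: clinear_simps[OF bounded_clinear_shift]
              clinear_simps[OF bounded_clinear_proj[OF N]])
        moreover have "Z i (proj N ?e \<otimes>\<^sub>v \<Delta> h) = B i (proj N ?e) \<otimes>\<^sub>v \<Delta> h"
        proof -
          have "proj S (shift i (proj N ?e) \<otimes>\<^sub>v \<Delta> h) = proj N (shift i (proj N ?e)) \<otimes>\<^sub>v \<Delta> h"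
            unfolding S_def by (rule proj_tensor[OF N defect_in_D])
          then show ?thesis
            by (simp add: Z_eq proj_id[OF S p] shift_tensor B_eq proj_id[OF N proj_in[OF N]])
        qed
        ultimately have "proj N (l2_basis (i # w)) \<otimes>\<^sub>v \<Delta> h = Z i (proj N ?e \<otimes>\<^sub>v \<Delta> h)"
          by (simp add: B_eq proj_id[OF N proj_in[OF N]] flip: shift_basis)
        then show ?case using V_left[OF Cons] by simp
      qed
      have range_M: "(f \<otimes>\<^sub>v \<Delta> h, 0) \<in> M" if "f \<in> N" for f h
      proof -
        have "bounded_clinear (\<lambda>f. proj N f \<otimes>\<^sub>v \<Delta> h)"
          using bounded_clinear_compose[OF bounded_clinear_tensor_left bounded_clinear_proj[OF N]]
          by (simp add: o_def)
        from closed_cspan_minimal[OF _ left_cs[OF this], of "range l2_basis"]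
        have "f \<in> {f. (proj N f \<otimes>\<^sub>v \<Delta> h, 0) \<in> M}"
          using word_M by (auto simp: closed_cspan_l2_basis)
        then show ?thesis using that by (simp add: proj_id[OF N])
      qed
      have "(f \<otimes>\<^sub>v d, 0) \<in> M" if "f \<in> N" "d \<in> D" for f d
      proof -
        have "closed {d. (f \<otimes>\<^sub>v d, 0) \<in> M}"
          using left_cs[OF bounded_clinear_tensor_right] by (simp add: closed_csubspace_def)
        then have "closure (range \<Delta>) \<subseteq> {d. (f \<otimes>\<^sub>v d, 0) \<in> M}"
          using range_M[OF that(1)] by (intro closure_minimal) auto
        then show ?thesis using that(2) by (auto simp: defect_space_def)
      qed
      then have "S \<subseteq> {x. (x, 0) \<in> M}"
        unfolding S_def tensor_space_def
        using left_cs[OF bounded_clinear_id] by (intro closed_cspan_minimal) auto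
      then have S_M: "(x, 0) \<in> M" if "x \<in> S" for x using that by blast
      have R_M: "(0, R h) \<in> M" for h
        using csubspace_diff[OF sub UM[of h] S_M[OF poisson_S[of h]]] by simp
      have W_M: "(0, \<pi> (W w) (R h)) \<in> M" for w h
      proof (induction w)
        case Nil
        then show ?case by (simp add: \<pi>1 proj_id[OF K R(2)] R_M)
      next
        case (Cons l w)
        obtain i s where l: "l = (i, s)" by fastforce
        have "V i (0, \<pi> (W w) (R h)) = (0, \<pi> (B i) (\<pi> (W w) (R h)))"
          "cadjoint (V i) (0, \<pi> (W w) (R h)) = (0, \<pi> (cadjoint (B i)) (\<pi> (W w) (R h)))"
          unfolding V_adj unfolding V_def
          by (simp_all add: direct_sum_op_def \<pi>_adj[OF B_in_A] clinear_simps(4)[OF Z]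
              clinear_simps(4)[OF bounded_clinear_cadjoint[OF Z]])
        then have "(0, \<pi> (if s then cadjoint (B i) else B i) (\<pi> (W w) (R h))) \<in> M"
          using VM[OF Cons, of i] VM'[OF Cons, of i] by simp
        moreover have "(if s then cadjoint (B i) else B i) \<in> A" by (simp add: A_adjoint B_in_A)
        then have "\<pi> (W (l # w)) = \<pi> (if s then cadjoint (B i) else B i) \<circ> \<pi> (W w)"
          unfolding l word_Cons by (rule \<pi>_comp[OF _ word_in_A])
        ultimately show ?case by simp
      qed
      have "closed_csubspace {y. (0 :: ('n list, 'h) l2, y) \<in> M}"
      proof (rule closed_csubspace_vimage[OF _ M(1), of "\<lambda>y. (0, y)"])
        show "bounded_clinear (\<lambda>y :: (nat, complex) l2. (0 :: ('n list, 'h) l2, y))"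
          by (rule bounded_clinearI[of _ 1]) (simp_all add: scaleC_prod_def norm_Pair)
      qed
      moreover have "{\<pi> (W w) (R h) |w h. True} \<subseteq> {y. (0, y) \<in> M}" using W_M by auto
      ultimately have "closed_cspan {\<pi> (W w) (R h) |w h. True} \<subseteq> {y. (0, y) \<in> M}"
        by (intro closed_cspan_minimal)
      then have "K \<subseteq> {y. (0, y) \<in> M}" by (simp only: K_span[symmetric])
      then have "(x, y) \<in> M" if "x \<in> S" "y \<in> K" for x y
        using csubspace_add[OF sub S_M[OF that(1)], of "(0, y)"] that by auto
      then show ?thesis by auto
    qed
    then show "S \<times> K \<subseteq> \<Inter>{M. closed_csubspace M \<and> range U \<subseteq> M \<and> M \<subseteq> S \<times> K \<and> reducing V M}"
      by blast
  qed
  ultimately have "\<exists>U. linear_isometry U \<and> range U \<subseteq> S \<times> K \<and> coinvariant V (range U) \<and>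
      star_cyclic (S \<times> K) V (range U) \<and> (\<forall>i h. U (cadjoint (T i) h) = cadjoint (V i) (U h))"
    using U_adj by blast
  then show ?thesis
    using K \<pi> compact sum_K unfolding Let_def S_def V_def[abs_def] Z_def by blast
qed

end

theorem theorem2p4:
  fixes P :: "'n::finite ncpoly set"
    and J :: "('n fock \<Rightarrow> 'n fock) set"
    and T :: "'n \<Rightarrow> 'h::complex_hilbert \<Rightarrow> 'h"
  assumes homog: "\<forall>p\<in>P. homogeneous p"
    and J_generated: "J = wot_ideal_generated ((\<lambda>p. ncpoly_eval p creation) ` P)"
    and J_proper: "J \<noteq> analytic_toeplitz"
    and separable: "separable_space (euclidean :: 'h topology)"
    and row: "row_contraction T"
    and annihilated: "\<forall>p\<in>P. ncpoly_eval p T = (\<lambda>_. 0)"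
  defines "B \<equiv> constrained_shift J"
    and "N \<equiv> variety_space J"
    and "D \<equiv> defect_space T"
  shows "\<exists>(K :: (nat, complex) l2 set) \<pi>.
    closed_csubspace K \<and>
    star_representation (variety_cstar J) K \<pi> \<and>
    (\<forall>X\<in>variety_cstar J. compact_op X \<longrightarrow> \<pi> X = (\<lambda>_. 0)) \<and>
    (\<lambda>k. \<Sum>i\<in>UNIV. \<pi> (B i) (cadjoint (\<pi> (B i)) k)) = proj K \<and>
    (let Ktilde = tensor_space N D \<times> K;
         V = (\<lambda>i. direct_sum_op (tensor_op N D (B i) (proj D)) (\<pi> (B i)))
     in \<exists>U :: 'h \<Rightarrow> ('n list, 'h) l2 \<times> (nat, complex) l2.
          linear_isometry U \<and> range U \<subseteq> Ktilde \<and>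
          coinvariant V (range U) \<and> star_cyclic Ktilde V (range U) \<and>
          (\<forall>i h. U (cadjoint (T i) h) = cadjoint (V i) (U h)))"
proof -
  interpret constrained_tuple T P J
    by unfold_locales (fact row homog J_generated J_proper separable annihilated)+
  show ?thesis
    using dilation unfolding variety_cstar_def B_def N_def D_def .
qed

end
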